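(* Let $0<p\le 1$ and let $\varphi:\mathbb D\to\mathbb D$ be analytic. Then the composition operator $C_\varphi:\mathcal Q_p\to\mathcal Q_p$, $C_\varphi f=f\circ\varphi$, is bounded if and only if there exists a dyadic system $\mathcal D$ on $\mathbb T$ such that $$\sup_{a\in\mathbb D}\|h_a^{\varphi}\|_{\mathcal B_p(\mathcal D)}<\infty ,$$ where for $a\in\mathbb D$ and an arc $I\subseteq\mathbb T$ $$h_a^{\varphi}(I):=\frac{1}{|I|^{p+2}}\int_{Q_I^{\mathrm{up}}}\mathcal N_{p,\varphi,a}(\zeta)\,dA(\zeta),\qquad \mathcal N_{p,\varphi,a}(\zeta):=\sum_{\varphi(z)=\zeta}g(z,a)^p .$$ Moreover, $$|||C_\varphi|||_{\mathcal Q_p,*,\mathrm{op}}^2\simeq \sup_{\mathcal D}\Big[\sup_{a\in\mathbb D}\|h_a^{\varphi}\|_{\mathcal B_p(\mathcal D)}\Big]\simeq \inf_{\mathcal D}\Big[\sup_{a\in\mathbb D}\|h_a^{\varphi}\|_{\mathcal B_p(\mathcal D)}\Big],$$ where the supremum and infimum are taken over all dyadic systems $\mathcal D$ on $\mathbb T$.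
   Context: $\mathbb D$ is the open unit disc, $\mathbb T$ the unit circle, $dA$ is normalized area measure on $\mathbb D$, and $H(\mathbb D)$ is the space of holomorphic functions on $\mathbb D$. For $a\in\mathbb D$, $\sigma_a(z)=\frac{a-z}{1-\overline a z}$ and $g(z,a)=\log\frac{1}{|\sigma_a(z)|}$. $\mathcal Q_p$ is the space of $f\in H(\mathbb D)$ with $\|f\|_{\mathcal Q_p,*}^2:=\sup_{a\in\mathbb D}\int_{\mathbb D}|f'(z)|^2g(z,a)^p\,dA(z)<\infty$, normed by $\|f\|_{\mathcal Q_p}:=|f(0)|+\|f\|_{\mathcal Q_p,*}$. The seminorm operator norm is $|||C_\varphi|||_{\mathcal Q_p,*,\mathrm{op}}:=\sup\{\|f\circ\varphi\|_{\mathcal Q_p,*}: f\in\mathcal Q_p,\ \|f\|_{\mathcal Q_p,*}\le1\}$ (possibly $+\infty$). The sum defining $\mathcal N_{p,\varphi,a}(\zeta)$ runs over the preimages $z\in\mathbb D$ of $\zeta$ under $\varphi$, counted with multiplicity (it is $0$ if there are none). $|I|$ denotes arc length normalized so that $|\mathbb T|=1$; arcs include $\mathbb T$ itself. For an arc $I$, $Q_I^{\mathrm{up}}:=\{re^{it}: e^{it}\in I,\ 1-|I|\le r<1-\frac{|I|}{2}\}$. A dyadic system on $\mathbb T$ is a family $\mathcal D=\bigcup_{k\ge0}\mathcal D_k$ of half-open arcs where $\mathcal D_0=\{\mathbb T\}$, each $\mathcal D_k$ is a partition of $\mathbb T$ into $2^k$ arcs of length $2^{-k}$, and each arc of $\mathcal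 D_{k+1}$ is contained in an arc of $\mathcal D_k$. For a nonnegative sequence $h=\{h(I)\}_{I\in\mathcal D}$, the dyadic $p$-capacity gauge is $$\|h\|_{\mathcal B_p(\mathcal D)}:=\inf\Big\{\sum_{J\in\mathcal D}\lambda_J|J|^p:\ \lambda_J\ge0,\ \sum_{J\in\mathcal D,\,J\supseteq I}\lambda_J\ge h(I)\ \text{for all }I\in\mathcal D\Big\}\in[0,\infty],$$ with $\inf\emptyset=+\infty$; in $\|h_a^\varphi\|_{\mathcal B_p(\mathcal D)}$ the sequence is $\{h_a^\varphi(I)\}_{I\in\mathcal D}$. $A\simeq B$ means $C^{-1}B\le A\le CB$ with a constant $C\ge 1$ depending only on $p$ (in particular independent of $\varphi$). *)

theory Defs
  imports "HOL-Complex_Analysis.Complex_Analysis"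
begin

text \<open>
  Nonnegative quantities that may be infinite (Green function, integrals, seminorms, counting
  functions, capacity gauges) are valued in \<^typ>\<open>ennreal\<close>.
\<close>

abbreviation unit_disc :: "complex set" where
  "unit_disc \<equiv> ball 0 1"

abbreviation unit_circle :: "complex set" where
  "unit_circle \<equiv> sphere 0 1"

text \<open>Normalized area measure \<open>dA\<close>; it has total mass one on the disc.\<close>

definition area :: "complex measure" where
  "area = uniform_measure lborel unit_disc"

text \<open>Real powers on \<open>[0,\<infinity>]\<close>; only used for exponents \<open>r > 0\<close>.\<close>

definition enn_powr :: "ennreal \<Rightarrow> real \<Rightarrow> ennreal" where
  "enn_powr x r = (if x = \<infinity> then \<infinity> else ennreal (enn2real x powr r))"

definition disc_aut :: "complex \<Rightarrow> complex \<Rightarrow> complex" where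
  "disc_aut a z = (a - z) / (1 - cnj a * z)"

text \<open>The case split gives the logarithmic pole at \<open>z = a\<close>, where \<^term>\<open>ln\<close> would return \<open>0\<close>.\<close>

definition green :: "complex \<Rightarrow> complex \<Rightarrow> ennreal" where
  "green z a = (if z = a then \<infinity> else ennreal (ln (1 / cmod (disc_aut a z))))"


subsection \<open>The spaces \<open>Q\<^sub>p\<close> and composition operators\<close>

definition Qp_seminorm :: "real \<Rightarrow> (complex \<Rightarrow> complex) \<Rightarrow> ennreal" where
  "Qp_seminorm p f =
     enn_powr (SUP a\<in>unit_disc.
       \<integral>\<^sup>+ z\<in>unit_disc. (ennreal ((cmod (deriv f z))\<^sup>2) * enn_powr (green z a) p) \<partial>area) (1/2)"

text \<open>Elements are functions on the whole plane of which only the restriction to the disc matters.\<close>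

definition Qp :: "real \<Rightarrow> (complex \<Rightarrow> complex) set" where
  "Qp p = {f. f holomorphic_on unit_disc \<and> Qp_seminorm p f < \<infinity>}"

definition Qp_norm :: "real \<Rightarrow> (complex \<Rightarrow> complex) \<Rightarrow> ennreal" where
  "Qp_norm p f = ennreal (cmod (f 0)) + Qp_seminorm p f"

definition comp_bounded_on_Qp :: "real \<Rightarrow> (complex \<Rightarrow> complex) \<Rightarrow> bool" where
  "comp_bounded_on_Qp p \<phi> \<longleftrightarrow>
     (\<forall>f\<in>Qp p. f \<circ> \<phi> \<in> Qp p) \<and>
     (\<exists>M::real. \<forall>f\<in>Qp p. Qp_norm p (f \<circ> \<phi>) \<le> ennreal M * Qp_norm p f)"

definition comp_seminorm_opnorm :: "real \<Rightarrow> (complex \<Rightarrow> complex) \<Rightarrow> ennreal" where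
  "comp_seminorm_opnorm p \<phi> =
     (SUP f\<in>{f\<in>Qp p. Qp_seminorm p f \<le> 1}. Qp_seminorm p (f \<circ> \<phi>))"


subsection \<open>Dyadic systems and capacity gauges\<close>

definition arc_length :: "complex set \<Rightarrow> real" where
  "arc_length I = measure lborel {t\<in>{0..<1}. cis (2 * pi * t) \<in> I}"

text \<open>Both half-open orientations are admitted, and the full circle is the case
  \<open>\<beta> = \<alpha> + 2\<pi>\<close>.\<close>

definition half_open_arc :: "complex set \<Rightarrow> bool" where
  "half_open_arc I \<longleftrightarrow>
     (\<exists>\<alpha> \<beta>::real. \<alpha> < \<beta> \<and> \<beta> \<le> \<alpha> + 2 * pi \<and> (I = cis ` {\<alpha>..<\<beta>} \<or> I = cis ` {\<alpha><..\<beta>}))"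

definition dyadic_system :: "complex set set \<Rightarrow> bool" where
  "dyadic_system \<D> \<longleftrightarrow>
     (\<exists>level :: nat \<Rightarrow> complex set set.
        \<D> = (\<Union>k. level k) \<and>
        level 0 = {unit_circle} \<and>
        (\<forall>k. partition_on unit_circle (level k) \<and> card (level k) = 2 ^ k \<and>
             (\<forall>I\<in>level k. half_open_arc I \<and> arc_length I = 1 / 2 ^ k) \<and>
             (\<forall>I\<in>level (Suc k). \<exists>J\<in>level k. I \<subseteq> J)))"

definition upper_box :: "complex set \<Rightarrow> complex set" where
  "upper_box I =
     {of_real r * w | r w. w \<in> I \<and> 1 - arc_length I \<le> r \<and> r < 1 - arc_length I / 2}"

definition gauge_Bp :: "real \<Rightarrow> complex set set \<Rightarrow> (complex set \<Rightarrow> ennreal) \<Rightarrow> ennreal" where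
  "gauge_Bp p \<D> h =
     Inf {(\<Sum>\<^sub>\<infinity>J\<in>\<D>. ennreal (lam J * arc_length J powr p)) | lam :: complex set \<Rightarrow> real.
            (\<forall>J\<in>\<D>. 0 \<le> lam J) \<and>
            (\<forall>I\<in>\<D>. h I \<le> (\<Sum>\<^sub>\<infinity>J\<in>{J\<in>\<D>. I \<subseteq> J}. ennreal (lam J)))}"


subsection \<open>Counting functions\<close>

text \<open>
  The multiplicity of the preimage \<open>z\<close> of \<open>\<zeta>\<close> is the order of the zero of \<open>\<phi> - \<zeta>\<close> at \<open>z\<close>.
  For constant \<open>\<phi>\<close> the value at the single point \<open>\<zeta>\<close> in the range of \<open>\<phi>\<close> is irrelevant, since
  the counting function is only integrated against area measure.
\<close>

definition counting_fun ::
  "real \<Rightarrow> (complex \<Rightarrow> complex) \<Rightarrow> complex \<Rightarrow> complex \<Rightarrow> ennreal" where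
  "counting_fun p \<phi> a \<zeta> =
     (\<Sum>\<^sub>\<infinity>z\<in>{z\<in>unit_disc. \<phi> z = \<zeta>}.
        of_nat (nat (zorder (\<lambda>w. \<phi> w - \<zeta>) z)) * enn_powr (green z a) p)"

definition box_average ::
  "real \<Rightarrow> (complex \<Rightarrow> complex) \<Rightarrow> complex \<Rightarrow> complex set \<Rightarrow> ennreal" where
  "box_average p \<phi> a I =
     ennreal (1 / arc_length I powr (p + 2)) * (\<integral>\<^sup>+ \<zeta>\<in>upper_box I. counting_fun p \<phi> a \<zeta> \<partial>area)"

definition sup_gauge :: "real \<Rightarrow> (complex \<Rightarrow> complex) \<Rightarrow> complex set set \<Rightarrow> ennreal" where
  "sup_gauge p \<phi> \<D> = (SUP a\<in>unit_disc. gauge_Bp p \<D> (box_average p \<phi> a))"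

definition comparable :: "real \<Rightarrow> ennreal \<Rightarrow> ennreal \<Rightarrow> bool" where
  "comparable C A B \<longleftrightarrow> ennreal (1 / C) * B \<le> A \<and> A \<le> ennreal C * B"

end

theory Submission
  imports Defs
begin

text \<open>
  Fix \<open>a\<close> in the disc and let \<open>\<mu>\<close> be the push-forward of \<open>|\<phi>'|\<^sup>2 g(\<cdot>,a)\<^sup>p dA\<close> under \<open>\<phi>\<close>. By the area
  formula \<open>\<mu>\<close> has the counting function as its density (\<open>counting_fun_integral\<close>), and by the chain rule
  the energy of \<open>f \<circ> \<phi>\<close> at \<open>a\<close> is \<open>\<integral> |f'|\<^sup>2 d\<mu>\<close>. Hence the square of the operator norm is the supremum of
  these integrals over \<open>a\<close> and over the unit ball of \<open>Q\<^sub>p\<close>. It is compared, for each single dyadic system,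
  with the gauge of the box averages \<open>h(I) = \<mu>(Q\<^sub>I) / |I|\<^sup>p\<^sup>+\<^sup>2\<close>, with constants that depend on \<open>p\<close> only;
  the supremum and the infimum over all systems are then comparable with each other.

  \<^emph>\<open>The operator norm is at most the gauge.\<close> On a box \<open>|f'|\<^sup>2\<close> is dominated by its average over a slightly
  larger region, so that \<open>\<integral> |f'|\<^sup>2 d\<mu>\<close> is at most a sum over \<open>I\<close> of \<open>h(I)\<close> times the integral of
  \<open>|f'|\<^sup>2 (1 - |z|)\<^sup>p\<close> near the box over \<open>I\<close>. If \<open>\<lambda>\<close> covers \<open>h\<close>, interchanging sums leaves
  \<open>\<Sum> \<lambda>\<^sub>J |J|\<^sup>p\<close>, because \<open>|f'|\<^sup>2 (1 - |z|)\<^sup>p dA\<close> is a \<open>p\<close>-Carleson measure when \<open>f\<close> is in \<open>Q\<^sub>p\<close>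
  (\<open>energy_carleson\<close>).

  \<^emph>\<open>The gauge is at most the operator norm.\<close> By linear programming duality the gauge of \<open>h\<close> is the
  supremum of \<open>\<Sum> h(I) x\<^sub>I\<close> over finitely supported \<open>x \<ge> 0\<close> with \<open>\<Sum>\<^bsub>I \<subseteq> J\<^esub> x\<^sub>I \<le> |J|\<^sup>p\<close> for all \<open>J\<close>
  (\<open>gauge_Bp_le_dual\<close>); on a tree the constraints are laminar and a greedy choice of \<open>x\<close> is optimal. For
  such an \<open>x\<close> consider the functions with derivative
  \<open>\<Sum> \<plusminus> x\<^sub>I\<^sup>1\<^sup>/\<^sup>2 |I|\<^sup>-\<^sup>p\<^sup>/\<^sup>2\<^sup>-\<^sup>1 (|I| / (1 - z\<^sub>I\<^sup>* z))\<^sup>4\<close>, where \<open>z\<^sub>I\<close> is a point in the box over \<open>I\<close>. Their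
  seminorms are bounded for every choice of signs (\<open>bump_energy\<close>), whereas for a suitable choice the
  parallelogram law makes \<open>\<integral> |f'|\<^sup>2 d\<mu>\<close> at least the sum of the diagonal terms (\<open>exists_signs\<close>), which is
  comparable with \<open>\<Sum> h(I) x\<^sub>I\<close>.

  The seminorm bound combines three estimates: a Schur test for the sums of \<open>|I|\<^sup>4\<^sup>-\<^sup>s / |1 - z\<^sub>I\<^sup>* z|\<^sup>4\<close>
  (\<open>schur_sum\<close>), the passage from the dyadic Carleson condition to its conformally invariant form
  (\<open>carleson_invariant\<close>), and an estimate for the Green function integrated against
  \<open>|1 - w\<^sup>* z|\<^sup>-\<^sup>4\<close> (\<open>nn_integral_kernel_green\<close>). The last one is reduced by the substitution \<open>z = \<sigma>\<^sub>w(u)\<close>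
  to \<open>w = 0\<close>, where only circular means matter and Jensen's formula applies.
\<close>

section \<open>The area formula for holomorphic maps\<close>

text \<open>Jacobian determinants live on \<open>real ^ 2\<close>, so the area formula is transported along this
  measure preserving identification.\<close>

definition complex_of_vec :: "real ^ 2 \<Rightarrow> complex" where
  "complex_of_vec v = Complex (v $ 1) (v $ 2)"

definition vec_of_complex :: "complex \<Rightarrow> real ^ 2" where
  "vec_of_complex z = vector [Re z, Im z]"

lemma vec_complex_inverse [simp]:
  "complex_of_vec (vec_of_complex z) = z" "vec_of_complex (complex_of_vec v) = v"
  by (simp_all add: complex_of_vec_def vec_of_complex_def vec_eq_iff forall_2 complex_eq_iff)

lemma bounded_linear_complex_of_vec: "bounded_linear complex_of_vec"
  unfolding complex_of_vec_def
  by (intro linear_conv_bounded_linear[THEN iffD1] linearI) (auto simp: complex_eq_iff)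

lemma bounded_linear_vec_of_complex: "bounded_linear vec_of_complex"
  unfolding vec_of_complex_def
  by (intro linear_conv_bounded_linear[THEN iffD1] linearI) (auto simp: vec_eq_iff forall_2)

lemma measurable_complex_of_vec [measurable]: "complex_of_vec \<in> borel_measurable borel"
  by (intro borel_measurable_continuous_onI linear_continuous_on bounded_linear_complex_of_vec)

lemma distr_complex_of_vec: "distr lborel borel complex_of_vec = lborel"
proof (rule lborel_eqI[symmetric])
  fix l u :: complex
  assume le: "\<And>b. b \<in> Basis \<Longrightarrow> l \<bullet> b \<le> u \<bullet> b"
  have "complex_of_vec -` box l u = box (vec_of_complex l) (vec_of_complex u)"
    by (auto simp: in_box_complex_iff complex_of_vec_def vec_of_complex_def mem_box_cart forall_2)
  moreover have "emeasure lborel (box (vec_of_complex l) (vec_of_complex u)) = (\<Prod>b\<in>Basis. (u - l) \<bullet> b)"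
  proof -
    have B: "(Basis :: (real ^ 2) set) = (\<lambda>i. axis i 1) ` UNIV"
      by (auto simp: Basis_vec_def)
    have inj: "inj (\<lambda>i::2. axis i (1::real))" by (simp add: inj_on_def axis_eq_axis)
    have *: "(\<Prod>b\<in>Basis. v \<bullet> b) = v $ 1 * v $ 2" for v :: "real ^ 2"
      unfolding B prod.reindex[OF inj] by (simp add: UNIV_2 inner_axis)
    have le2: "vec_of_complex l \<bullet> b \<le> vec_of_complex u \<bullet> b" if "b \<in> Basis" for b :: "real ^ 2"
    proof -
      obtain i where i: "b = axis i 1" using \<open>b \<in> Basis\<close> unfolding B by blast
      have "Re l \<le> Re u" "Im l \<le> Im u" using le[of 1] le[of \<i>] by (auto simp: Basis_complex_def)
      then show ?thesis using exhaust_2[of i] by (auto simp: i inner_axis vec_of_complex_def)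
    qed
    have "emeasure lborel (box (vec_of_complex l) (vec_of_complex u))
        = (\<Prod>b\<in>Basis. (vec_of_complex u - vec_of_complex l) \<bullet> b)"
      using le2 by (rule emeasure_lborel_box)
    also have "\<dots> = ennreal ((Re u - Re l) * (Im u - Im l))"
      unfolding * by (simp add: vec_of_complex_def)
    finally show ?thesis by (simp add: Basis_complex_def)
  qed
  ultimately show "emeasure (distr lborel borel complex_of_vec) (box l u) = (\<Prod>b\<in>Basis. (u - l) \<bullet> b)"
    by (subst emeasure_distr) auto
qed simp

text \<open>Both sides may be infinite: if the right-hand side is finite this is the change of variables
  formula, and conversely that formula makes the Jacobian integrable when the image has finite measure.\<close>

lemma emeasure_differentiable_image_vec:
  fixes g :: "real ^ 2 \<Rightarrow> real ^ 2"
  assumes S: "S \<in> sets borel" and gS: "g ` S \<in> sets borel"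
    and der: "\<And>x. x \<in> S \<Longrightarrow> (g has_derivative g' x) (at x within S)"
    and inj: "inj_on g S"
    and meas [measurable]: "(\<lambda>x. indicator S x * \<bar>det (matrix (g' x))\<bar>) \<in> borel_measurable borel"
  shows "emeasure lborel (g ` S) = (\<integral>\<^sup>+x. ennreal (indicator S x * \<bar>det (matrix (g' x))\<bar>) \<partial>lborel)"
proof -
  let ?J = "\<lambda>x. \<bar>det (matrix (g' x))\<bar>"
  let ?K = "\<lambda>x. indicator S x * ?J x"
  have SL: "S \<in> sets lebesgue" using S by (simp add: sets_completionI_sets)
  have image: "g ` S \<in> lmeasurable \<and> measure lebesgue (g ` S) = m \<longleftrightarrow> (?J has_integral m) S" for m
    using der inj by (intro has_measure_differentiable_image[OF SL]) auto
  have iff: "(?J has_integral m) S \<longleftrightarrow> (?K has_integral m) UNIV" for m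
  proof -
    have "?K = (\<lambda>x. if x \<in> S then ?J x else 0)" by (auto simp: indicator_def)
    then show ?thesis by (simp only: has_integral_restrict_UNIV)
  qed
  have K0: "0 \<le> ?K x" for x by (rule mult_nonneg_nonneg) (auto simp: indicator_def)
  have fin_iff: "emeasure lborel (g ` S) < \<infinity> \<longleftrightarrow> g ` S \<in> lmeasurable"
    using gS by (auto simp: fmeasurable_def sets_completionI_sets)
  show ?thesis
  proof (cases "(\<integral>\<^sup>+x. ennreal (?K x) \<partial>lborel) < \<infinity>")
    case True
    then obtain m where m: "(\<integral>\<^sup>+x. ennreal (?K x) \<partial>lborel) = ennreal m" "m \<ge> 0"
      by (cases "\<integral>\<^sup>+x. ennreal (?K x) \<partial>lborel") auto
    have "(?K has_integral m) UNIV"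
      by (rule nn_integral_has_integral[OF meas K0 m(1) m(2)])
    then have "(?J has_integral m) S" by (rule iffD2[OF iff])
    then have "g ` S \<in> lmeasurable \<and> measure lebesgue (g ` S) = m" by (rule iffD2[OF image])
    then show ?thesis
      using m gS fin_iff by (simp add: emeasure_eq_ennreal_measure)
  next
    case False
    have "\<not> emeasure lborel (g ` S) < \<infinity>"
    proof
      assume "emeasure lborel (g ` S) < \<infinity>"
      then have "(?K has_integral measure lebesgue (g ` S)) UNIV"
        by (intro iffD1[OF iff] iffD1[OF image] conjI iffD1[OF fin_iff] refl)
      then have "(\<integral>\<^sup>+x. ennreal (?K x) \<partial>lborel) = ennreal (measure lebesgue (g ` S))"
        by (rule nn_integral_has_integral_lborel[OF meas K0])
      with False show False by simp
    qed
    then have "emeasure lborel (g ` S) = top" "(\<integral>\<^sup>+x. ennreal (?K x) \<partial>lborel) = top"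
      using False by (simp_all add: not_less top_unique)
    then show ?thesis by (metis (no_types))
  qed
qed

lemma det_complex_mult:
  "det (matrix (vec_of_complex \<circ> (\<lambda>h. c * h) \<circ> complex_of_vec)) = (cmod c)\<^sup>2"
  unfolding cmod_power2
  by (simp add: det_2 matrix_def complex_of_vec_def vec_of_complex_def axis_def power2_eq_square)

lemma borel_inj_holomorphic_image:
  assumes hol: "\<phi> holomorphic_on U" and U: "open U" and inj: "inj_on \<phi> U"
    and E: "E \<in> sets borel" "E \<subseteq> U"
  shows "\<phi> ` E \<in> sets borel"
proof -
  obtain \<psi> where \<psi>: "\<psi> holomorphic_on \<phi> ` U" "\<And>z. z \<in> U \<Longrightarrow> \<psi> (\<phi> z) = z"
    using holomorphic_has_inverse[OF hol U inj] by metis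
  have op: "open (\<phi> ` U)" by (rule open_mapping_thm3[OF hol U inj])
  have "(\<lambda>w. if w \<in> \<phi> ` U then \<psi> w else 0) \<in> borel_measurable borel"
    using op \<psi>(1) by (intro borel_measurable_continuous_on_if) (auto intro: holomorphic_on_imp_continuous_on)
  from measurable_sets[OF this E(1)]
  have "((\<lambda>w. if w \<in> \<phi> ` U then \<psi> w else 0) -` E) \<inter> \<phi> ` U \<in> sets borel"
    using op by simp
  moreover have "((\<lambda>w. if w \<in> \<phi> ` U then \<psi> w else 0) -` E) \<inter> \<phi> ` U = \<phi> ` E"
    using \<psi>(2) E(2) by (auto split: if_splits)
  ultimately show ?thesis by simp
qed

lemma measurable_deriv_sq:
  assumes hol: "\<phi> holomorphic_on U" and U: "open U"
  shows "(\<lambda>z. indicator U z * (cmod (deriv \<phi> z))\<^sup>2) \<in> borel_measurable borel"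
proof -
  have "(\<lambda>z. if z \<in> U then (cmod (deriv \<phi> z))\<^sup>2 else 0) \<in> borel_measurable borel"
    using U hol
    by (intro borel_measurable_continuous_on_if continuous_intros)
       (auto intro!: holomorphic_on_imp_continuous_on holomorphic_deriv)
  also have "(\<lambda>z. if z \<in> U then (cmod (deriv \<phi> z))\<^sup>2 else 0) = (\<lambda>z. indicator U z * (cmod (deriv \<phi> z))\<^sup>2)"
    by auto
  finally show ?thesis .
qed

lemma emeasure_inj_holomorphic_image:
  assumes hol: "\<phi> holomorphic_on U" and U: "open U" and inj: "inj_on \<phi> U"
    and E: "E \<in> sets borel" "E \<subseteq> U"
  shows "emeasure lborel (\<phi> ` E) = (\<integral>\<^sup>+z\<in>E. ennreal ((cmod (deriv \<phi> z))\<^sup>2) \<partial>lborel)"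
proof -
  define g where "g = vec_of_complex \<circ> \<phi> \<circ> complex_of_vec"
  define g' where "g' = (\<lambda>x. vec_of_complex \<circ> (\<lambda>h. deriv \<phi> (complex_of_vec x) * h) \<circ> complex_of_vec)"
  define S where "S = complex_of_vec -` E"
  have S: "S \<in> sets borel"
    using measurable_sets[OF measurable_complex_of_vec E(1)] by (simp add: S_def)
  have gS: "g ` S = complex_of_vec -` (\<phi> ` E)"
  proof (intro subset_antisym subsetI)
    fix v assume "v \<in> complex_of_vec -` (\<phi> ` E)"
    then obtain z where "z \<in> E" "complex_of_vec v = \<phi> z" by auto
    then have "v = g (vec_of_complex z)" "vec_of_complex z \<in> S"
      by (auto simp: g_def S_def) (metis vec_complex_inverse(2))
    then show "v \<in> g ` S" by blast
  qed (auto simp: g_def S_def)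
  have \<phi>E: "\<phi> ` E \<in> sets borel" by (rule borel_inj_holomorphic_image[OF assms])
  have gSb: "g ` S \<in> sets borel"
    using measurable_sets[OF measurable_complex_of_vec \<phi>E] by (simp add: gS)
  have der: "(g has_derivative g' x) (at x within S)" if "x \<in> S" for x
  proof -
    have "complex_of_vec x \<in> U" using that E by (auto simp: S_def)
    then have d: "(\<phi> has_derivative (\<lambda>h. deriv \<phi> (complex_of_vec x) * h)) (at (complex_of_vec x))"
      using holomorphic_derivI[OF hol U] by (simp add: has_field_derivative_def)
    have "(g has_derivative g' x) (at x)"
      unfolding g_def g'_def o_assoc[symmetric]
      by (intro diff_chain_at bounded_linear_imp_has_derivative bounded_linear_complex_of_vec
            bounded_linear_vec_of_complex d)
         
    then show ?thesis by (rule has_derivative_at_withinI)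
  qed
  have injg: "inj_on g S"
    using inj E(2) unfolding inj_on_def g_def S_def
    by (auto simp: subset_iff) (metis vec_complex_inverse)
  have meas: "(\<lambda>z. indicator E z * (cmod (deriv \<phi> z))\<^sup>2) \<in> borel_measurable borel"
  proof -
    have "(\<lambda>z. indicator E z * (indicator U z * (cmod (deriv \<phi> z))\<^sup>2)) \<in> borel_measurable borel"
      by (intro borel_measurable_times borel_measurable_indicator E measurable_deriv_sq[OF hol U])
    also have "(\<lambda>z. indicator E z * (indicator U z * (cmod (deriv \<phi> z))\<^sup>2)) = (\<lambda>z. indicator E z * (cmod (deriv \<phi> z))\<^sup>2)"
      using E(2) by (auto simp: indicator_def fun_eq_iff)
    finally show ?thesis .
  qed
  have ind: "indicator S x * \<bar>det (matrix (g' x))\<bar>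
      = indicator E (complex_of_vec x) * (cmod (deriv \<phi> (complex_of_vec x)))\<^sup>2" for x
    by (simp add: g'_def det_complex_mult S_def indicator_def)
  have "emeasure lborel (\<phi> ` E) = emeasure (distr lborel borel complex_of_vec) (\<phi> ` E)"
    by (simp add: distr_complex_of_vec)
  also have "\<dots> = emeasure lborel (g ` S)"
    using \<phi>E by (subst emeasure_distr) (auto simp: gS)
  also have "\<dots> = (\<integral>\<^sup>+x. ennreal (indicator S x * \<bar>det (matrix (g' x))\<bar>) \<partial>lborel)"
    by (intro emeasure_differentiable_image_vec S gSb der injg)
       (auto simp only: ind intro: measurable_compose[OF measurable_complex_of_vec meas])
  also have "\<dots> = (\<integral>\<^sup>+z. ennreal (indicator E z * (cmod (deriv \<phi> z))\<^sup>2) \<partial>(distr lborel borel complex_of_vec))"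
    unfolding ind using meas by (subst nn_integral_distr) auto
  finally show ?thesis
    by (simp add: distr_complex_of_vec indicator_def if_distrib cong: if_cong)
       (auto intro!: nn_integral_cong)
qed

text \<open>Two measures agree on Borel sets by the previous lemma: the push-forward of \<open>|\<phi>'|\<^sup>2 dA\<close> and area
  measure on \<open>\<phi>(U)\<close>.\<close>

theorem nn_integral_inj_holomorphic:
  assumes hol: "\<phi> holomorphic_on U" and U: "open U" and inj: "inj_on \<phi> U"
    and h [measurable]: "h \<in> borel_measurable borel"
  shows "(\<integral>\<^sup>+z\<in>U. (h (\<phi> z) * ennreal ((cmod (deriv \<phi> z))\<^sup>2)) \<partial>lborel) = (\<integral>\<^sup>+w\<in>\<phi> ` U. h w \<partial>lborel)"
proof -
  define \<phi>' where "\<phi>' = (\<lambda>z. if z \<in> U then \<phi> z else 0)"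
  have [measurable]: "\<phi>' \<in> borel_measurable borel"
    unfolding \<phi>'_def using U hol
    by (intro borel_measurable_continuous_on_if) (auto intro: holomorphic_on_imp_continuous_on)
  define d where "d = (\<lambda>z. ennreal (indicator U z * (cmod (deriv \<phi> z))\<^sup>2))"
  have [measurable]: "d \<in> borel_measurable borel"
    unfolding d_def using measurable_deriv_sq[OF hol U] by simp
  have op: "open (\<phi> ` U)" by (rule open_mapping_thm3[OF hol U inj])
  have eq: "distr (density lborel d) borel \<phi>' = density lborel (indicator (\<phi> ` U))"
  proof (rule measure_eqI)
    fix A assume "A \<in> sets (distr (density lborel d) borel \<phi>')"
    then have A: "A \<in> sets borel" by simp
    have pre: "\<phi>' -` A \<in> sets borel" using measurable_sets[of \<phi>' borel borel, OF _ A] by simp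
    have im: "\<phi> ` (U \<inter> \<phi>' -` A) = A \<inter> \<phi> ` U"
      by (auto simp: \<phi>'_def)
    have "emeasure (distr (density lborel d) borel \<phi>') A = (\<integral>\<^sup>+z. d z * indicator (\<phi>' -` A) z \<partial>lborel)"
      using A pre by (subst emeasure_distr) (auto simp: emeasure_density)
    also have "\<dots> = (\<integral>\<^sup>+z\<in>(U \<inter> \<phi>' -` A). ennreal ((cmod (deriv \<phi> z))\<^sup>2) \<partial>lborel)"
      by (intro nn_integral_cong) (auto simp: d_def indicator_def)
    also have "\<dots> = emeasure lborel (\<phi> ` (U \<inter> \<phi>' -` A))"
      using U pre by (subst emeasure_inj_holomorphic_image[OF hol U inj]) auto
    also have "\<dots> = emeasure (density lborel (indicator (\<phi> ` U))) A"
      using A op unfolding im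
      by (subst emeasure_density) (auto simp: mult.commute simp flip: indicator_inter_arith)
    finally show "emeasure (distr (density lborel d) borel \<phi>') A = emeasure (density lborel (indicator (\<phi> ` U))) A" .
  qed simp
  have "(\<integral>\<^sup>+z\<in>U. (h (\<phi> z) * ennreal ((cmod (deriv \<phi> z))\<^sup>2)) \<partial>lborel) = (\<integral>\<^sup>+z. d z * h (\<phi>' z) \<partial>lborel)"
    by (intro nn_integral_cong) (auto simp: d_def \<phi>'_def indicator_def mult.commute)
  also have "\<dots> = (\<integral>\<^sup>+w. h w \<partial>(distr (density lborel d) borel \<phi>'))"
    by (simp add: nn_integral_distr nn_integral_density)
  also have "\<dots> = (\<integral>\<^sup>+w\<in>\<phi> ` U. h w \<partial>lborel)"
    using op unfolding eq by (subst nn_integral_density) (auto simp: mult.commute)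
  finally show ?thesis .
qed


section \<open>Counting functions as densities\<close>

lemma measurable_enn_powr [measurable]: "(\<lambda>x. enn_powr x r) \<in> borel_measurable borel"
  unfolding enn_powr_def by measurable

lemma measurable_green [measurable]: "(\<lambda>z. green z a) \<in> borel_measurable borel"
  unfolding green_def disc_aut_def by measurable

lemma disc_in_borel [measurable]: "unit_disc \<in> sets borel"
  by simp

lemma emeasure_disc: "emeasure lborel unit_disc = ennreal pi"
  using emeasure_ball[of 1 "0 :: complex"] by (simp add: unit_ball_vol_2)

lemma nn_integral_area:
  assumes "f \<in> borel_measurable borel"
  shows "(\<integral>\<^sup>+x. f x \<partial>area) = ennreal (1 / pi) * (\<integral>\<^sup>+x\<in>unit_disc. f x \<partial>lborel)"
  using assms unfolding area_def
  by (subst nn_integral_uniform_measure)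
     (simp_all add: emeasure_disc divide_ennreal_def inverse_ennreal mult.commute inverse_eq_divide)

lemma sets_area [measurable_cong, simp]: "sets area = sets borel"
  by (simp add: area_def uniform_measure_def)

lemma space_area [simp]: "space area = UNIV"
  by (simp add: area_def uniform_measure_def)

lemma AE_area:
  assumes "AE x in lborel. P x"
  shows "AE x in area. P x"
  unfolding area_def using assms by (intro AE_uniform_measureI) auto

lemma AE_not_in_countable:
  fixes S :: "complex set"
  assumes "countable S" shows "AE x in lborel. x \<notin> S"
  by (rule AE_not_in) (simp add: assms countable_imp_null_set_lborel)

lemma fsigma_disc: "fsigma unit_disc"
proof -
  have "unit_disc = (\<Union>n. cball 0 (1 - 1 / real (Suc n)))"
  proof (intro subset_antisym subsetI)
    fix z :: complex assume "z \<in> unit_disc"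
    then obtain n where "1 / real (Suc n) < 1 - cmod z"
      using nat_approx_posE[of "1 - cmod z"] by (auto simp: inverse_eq_divide)
    then show "z \<in> (\<Union>n. cball 0 (1 - 1 / real (Suc n)))" by (intro UN_I[of n]) auto
  next
    fix z :: complex assume "z \<in> (\<Union>n. cball 0 (1 - 1 / real (Suc n)))"
    then obtain n where "cmod z \<le> 1 - 1 / real (Suc n)" by auto
    moreover have "1 / real (Suc n) > 0" by simp
    ultimately have "cmod z < 1" by linarith
    then show "z \<in> unit_disc" by simp
  qed
  then show ?thesis by (metis closed_cball fsigma.intros)
qed

text \<open>The push-forward under \<open>\<phi>\<close> of \<open>|\<phi>'|\<^sup>2 g(\<cdot>,a)\<^sup>p dA\<close>; its density is the counting function.\<close>

definition pullback_mass ::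
  "real \<Rightarrow> (complex \<Rightarrow> complex) \<Rightarrow> complex \<Rightarrow> complex set \<Rightarrow> ennreal" where
  "pullback_mass p \<phi> a E = (\<integral>\<^sup>+z\<in>unit_disc.
     (indicator E (\<phi> z) * ennreal ((cmod (deriv \<phi> z))\<^sup>2) * enn_powr (green z a) p) \<partial>area)"

lemma zorder_simple:
  assumes "\<phi> holomorphic_on U" "open U" "z \<in> U" "deriv \<phi> z \<noteq> 0" "\<phi> z = \<zeta>"
  shows "zorder (\<lambda>w. \<phi> w - \<zeta>) z = 1"
proof (rule zorder_zero_eqI)
  show "(\<lambda>w. \<phi> w - \<zeta>) holomorphic_on U" using assms by (intro holomorphic_intros)
  have "\<phi> field_differentiable at z"
    using assms holomorphic_on_imp_differentiable_at by blast
  then show "(deriv ^^ nat 1) (\<lambda>w. \<phi> w - \<zeta>) z \<noteq> 0" using assms by simp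
qed (use assms in auto)

lemma countable_injective_cover:
  assumes hol: "\<phi> holomorphic_on U" and U: "open U" and nz: "\<And>z. z \<in> U \<Longrightarrow> deriv \<phi> z \<noteq> 0"
  obtains B :: "nat \<Rightarrow> complex set" where "\<And>n. open (B n)" "\<And>n. inj_on \<phi> (B n)" "(\<Union>n. B n) = U"
proof -
  let ?F = "{S. open S \<and> S \<subseteq> U \<and> inj_on \<phi> S}"
  have "\<Union>?F = U"
  proof (intro subset_antisym subsetI)
    fix z assume "z \<in> U"
    then obtain r where "r > 0" "ball z r \<subseteq> U" "inj_on \<phi> (ball z r)"
      using has_complex_derivative_locally_injective[OF hol _ U nz] by metis
    then show "z \<in> \<Union>?F" by (intro UnionI[of "ball z r"]) auto
  qed auto
  then obtain F' where F': "F' \<subseteq> ?F" "countable F'" "\<Union>F' = U"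
    using Lindelof[of ?F] by (metis (no_types, lifting) mem_Collect_eq)
  define B where "B = from_nat_into (insert {} F')"
  have ran: "range B = insert {} F'"
    unfolding B_def using F' by (intro range_from_nat_into) auto
  show thesis
  proof
    have "B n \<in> insert {} F'" for n using ran by auto
    then show "open (B n)" "inj_on \<phi> (B n)" for n using F'(1) by (metis (no_types, lifting) empty_iff
          insert_iff inj_on_empty mem_Collect_eq open_empty subsetD)+
    show "(\<Union>n. B n) = U" using ran F'(3) by auto
  qed
qed

text \<open>A fibre meets each piece of injectivity at most once, so that it is indexed by the pieces.\<close>

lemma infsum_fibre_eq_suminf:
  fixes G :: "'a \<Rightarrow> ennreal"
  assumes cov: "(\<Union>n. E n) = U" and disj: "disjoint_family E" and inj: "\<And>n::nat. inj_on \<phi> (E n)"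
  shows "infsum G {z \<in> U. \<phi> z = \<zeta>}
    = (\<Sum>n. if \<zeta> \<in> \<phi> ` E n then G (the_inv_into (E n) \<phi> \<zeta>) else 0)"
proof -
  let ?v = "\<lambda>n. the_inv_into (E n) \<phi> \<zeta>"
  let ?N = "{n. \<zeta> \<in> \<phi> ` E n}"
  have v: "?v n \<in> E n" "\<phi> (?v n) = \<zeta>" if "n \<in> ?N" for n
    using that inj by (auto intro: the_inv_into_into f_the_inv_into_f)
  have bij: "bij_betw ?v ?N {z \<in> U. \<phi> z = \<zeta>}"
  proof (rule bij_betwI')
    fix m n assume "m \<in> ?N" "n \<in> ?N"
    then show "(?v m = ?v n) = (m = n)"
      using v disj unfolding disjoint_family_on_def by (metis UNIV_I disjoint_iff)
  next
    fix n assume "n \<in> ?N" then show "?v n \<in> {z \<in> U. \<phi> z = \<zeta>}" using v cov by auto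
  next
    fix z assume "z \<in> {z \<in> U. \<phi> z = \<zeta>}"
    then obtain n where "z \<in> E n" "\<phi> z = \<zeta>" using cov by auto
    then show "\<exists>n\<in>?N. z = ?v n" using inj by (intro bexI[of _ n]) (auto simp: the_inv_into_f_f)
  qed
  have "infsum G {z \<in> U. \<phi> z = \<zeta>} = infsum (\<lambda>n. G (?v n)) ?N"
    by (rule infsum_reindex_bij_betw[OF bij, symmetric])
  also have "\<dots> = infsum (\<lambda>n. if \<zeta> \<in> \<phi> ` E n then G (?v n) else 0) UNIV"
    by (intro infsum_cong_neutral) auto
  also have "\<dots> = (\<Sum>n. if \<zeta> \<in> \<phi> ` E n then G (?v n) else 0)"
    by (intro sums_unique has_sum_imp_sums has_sum_infsum nonneg_summable_on_complete) simp
  finally show ?thesis .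
qed

text \<open>Cutting the regular set of \<open>\<phi>\<close> into countably many pieces of injectivity turns the area
  formula into the change of variables \<open>dA(\<zeta>) = |\<phi>'|\<^sup>2 dA(z)\<close> with multiplicities; there are only
  countably many critical values, so that they carry no area.\<close>

theorem counting_fun_integral:
  assumes hol: "\<phi> holomorphic_on unit_disc" and ran: "\<phi> ` unit_disc \<subseteq> unit_disc" and E: "E \<in> sets borel"
  shows "(\<integral>\<^sup>+\<zeta>\<in>E. counting_fun p \<phi> a \<zeta> \<partial>area) = pullback_mass p \<phi> a E"
proof (cases "\<phi> constant_on unit_disc")
  case True
  then obtain c where c: "\<And>z. z \<in> unit_disc \<Longrightarrow> \<phi> z = c" unfolding constant_on_def by auto
  have der: "deriv \<phi> z = 0" if z: "z \<in> unit_disc" for z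
  proof -
    have "(\<phi> has_field_derivative 0) (at z)"
      by (rule has_field_derivative_transform_within_open[of "\<lambda>_. c" _ _ unit_disc])
         (use z c in auto)
    then show ?thesis by (rule DERIV_imp_deriv)
  qed
  have "AE \<zeta> in area. counting_fun p \<phi> a \<zeta> * indicator E \<zeta> = 0"
  proof (rule AE_area)
    have "AE \<zeta> in lborel. \<zeta> \<notin> {c}" by (rule AE_not_in_countable) simp
    then show "AE \<zeta> in lborel. counting_fun p \<phi> a \<zeta> * indicator E \<zeta> = 0"
    proof eventually_elim
      case (elim \<zeta>)
      then have "{z \<in> unit_disc. \<phi> z = \<zeta>} = {}" using c by auto
      then have "counting_fun p \<phi> a \<zeta> = 0" unfolding counting_fun_def by (simp only: infsum_empty)
      then show ?case by simp
    qed
  qed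
  then have "(\<integral>\<^sup>+\<zeta>\<in>E. counting_fun p \<phi> a \<zeta> \<partial>area) = (\<integral>\<^sup>+\<zeta>. 0 \<partial>area)"
    by (rule nn_integral_cong_AE)
  also have "\<dots> = pullback_mass p \<phi> a E"
    unfolding pullback_mass_def by (intro nn_integral_cong) (auto simp: der indicator_def)
  finally show ?thesis .
next
  case False
  define Z where "Z = {z \<in> unit_disc. deriv \<phi> z = 0}"
  define U where "U = unit_disc - Z"
  define G where "G = (\<lambda>z. enn_powr (green z a) p)"
  have [measurable]: "G \<in> borel_measurable borel" unfolding G_def by measurable
  have dhol: "deriv \<phi> holomorphic_on unit_disc" using hol by (intro holomorphic_deriv) auto
  have U: "open U"
  proof -
    have "U = unit_disc \<inter> deriv \<phi> -` (- {0})" by (auto simp: U_def Z_def)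
    moreover have "open (unit_disc \<inter> deriv \<phi> -` (- {0}))"
      by (intro continuous_open_preimage holomorphic_on_imp_continuous_on dhol) auto
    ultimately show ?thesis by simp
  qed
  have cZ: "countable Z"
  proof (cases "deriv \<phi> constant_on unit_disc")
    case True
    then obtain d where d: "\<And>z. z \<in> unit_disc \<Longrightarrow> deriv \<phi> z = d" unfolding constant_on_def by auto
    have "d \<noteq> 0"
    proof
      assume "d = 0"
      then have "\<phi> constant_on unit_disc"
        using d holomorphic_derivI[OF hol open_ball]
        by (intro has_field_derivative_0_imp_constant_on) fastforce+
      with False show False by simp
    qed
    then have "Z = {}" unfolding Z_def using d by auto
    then show ?thesis by simp
  next
    case False
    show ?thesis unfolding Z_def
      by (intro holomorphic_countable_zeros dhol False) (auto intro: fsigma_disc)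
  qed
  have holU: "\<phi> holomorphic_on U" using hol by (rule holomorphic_on_subset) (auto simp: U_def)
  obtain B :: "nat \<Rightarrow> complex set" where B: "\<And>n. open (B n)" "\<And>n. inj_on \<phi> (B n)" "(\<Union>n. B n) = U"
    using countable_injective_cover[OF holU U] by (auto simp: U_def Z_def)
  define D where "D = disjointed B"
  have DB: "D n \<subseteq> B n" for n by (auto simp: D_def disjointed_def)
  have Dcov: "(\<Union>n. D n) = U" using B(3) by (simp add: D_def UN_disjointed_eq)
  have Ddisj: "disjoint_family D" by (simp add: D_def disjoint_family_disjointed)
  have Dinj: "inj_on \<phi> (D n)" for n using B(2) DB by (rule inj_on_subset)
  have Dmeas [measurable]: "D n \<in> sets borel" for n
    unfolding D_def disjointed_def using B(1) by (intro sets.Diff sets.finite_UN) auto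
  have BU: "B n \<subseteq> U" for n using B(3) by auto
  have holB: "\<phi> holomorphic_on B n" for n using holU BU by (rule holomorphic_on_subset)
  have imD [measurable]: "\<phi> ` D n \<in> sets borel" for n
    by (rule borel_inj_holomorphic_image[OF holB B(1) B(2) Dmeas DB])
  define u where "u = (\<lambda>n \<zeta>. if \<zeta> \<in> \<phi> ` D n then G (the_inv_into (D n) \<phi> \<zeta>) else 0)"
  have u_meas [measurable]: "u n \<in> borel_measurable borel" for n
  proof -
    obtain \<psi> where \<psi>: "\<psi> holomorphic_on \<phi> ` B n" "\<And>z. z \<in> B n \<Longrightarrow> \<psi> (\<phi> z) = z"
      using holomorphic_has_inverse[OF holB B(1) B(2)] by metis
    have op: "open (\<phi> ` B n)" by (rule open_mapping_thm3[OF holB B(1) B(2)])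
    have [measurable]: "(\<lambda>w. if w \<in> \<phi> ` B n then \<psi> w else 0) \<in> borel_measurable borel" (is "?\<psi> \<in> _")
      using op \<psi>(1) by (intro borel_measurable_continuous_on_if) (auto intro: holomorphic_on_imp_continuous_on)
    have "u n = (\<lambda>\<zeta>. indicator (\<phi> ` D n) \<zeta> * G (?\<psi> \<zeta>))"
      using \<psi>(2) DB[of n] Dinj[of n] unfolding u_def
      by (fastforce simp: indicator_def the_inv_into_f_f)
    moreover have "(\<lambda>\<zeta>. indicator (\<phi> ` D n) \<zeta> * G (?\<psi> \<zeta>)) \<in> borel_measurable borel" by measurable
    ultimately show ?thesis by simp
  qed
  have AE1: "AE \<zeta> in area. counting_fun p \<phi> a \<zeta> = (\<Sum>n. u n \<zeta>)"
  proof (rule AE_area)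
    have "AE \<zeta> in lborel. \<zeta> \<notin> \<phi> ` Z" by (rule AE_not_in_countable) (simp add: cZ)
    then show "AE \<zeta> in lborel. counting_fun p \<phi> a \<zeta> = (\<Sum>n. u n \<zeta>)"
    proof eventually_elim
      case (elim \<zeta>)
      have eqs: "{z \<in> unit_disc. \<phi> z = \<zeta>} = {z \<in> U. \<phi> z = \<zeta>}"
        using elim by (auto simp: U_def)
      have "counting_fun p \<phi> a \<zeta> = infsum G {z \<in> U. \<phi> z = \<zeta>}"
        unfolding counting_fun_def eqs G_def
      proof (rule infsum_cong)
        fix z assume z: "z \<in> {z \<in> U. \<phi> z = \<zeta>}"
        then have "zorder (\<lambda>w. \<phi> w - \<zeta>) z = 1"
          by (intro zorder_simple[OF holU U]) (auto simp: U_def Z_def)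
        then show "of_nat (nat (zorder (\<lambda>w. \<phi> w - \<zeta>) z)) * enn_powr (green z a) p = enn_powr (green z a) p"
          by simp
      qed
      also have "\<dots> = (\<Sum>n. u n \<zeta>)"
        unfolding u_def by (rule infsum_fibre_eq_suminf[OF Dcov Ddisj Dinj])
      finally show ?case .
    qed
  qed
  define v where "v = (\<lambda>z. ennreal (indicator unit_disc z * (cmod (deriv \<phi> z))\<^sup>2))"
  have [measurable]: "v \<in> borel_measurable borel"
    unfolding v_def using measurable_deriv_sq[OF hol] by simp
  define \<phi>' where "\<phi>' = (\<lambda>z. if z \<in> unit_disc then \<phi> z else 0)"
  have [measurable]: "\<phi>' \<in> borel_measurable borel"
    unfolding \<phi>'_def using hol
    by (intro borel_measurable_continuous_on_if) (auto intro: holomorphic_on_imp_continuous_on)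
  have [measurable]: "E \<in> sets borel" by (rule E)
  have piece: "(\<integral>\<^sup>+\<zeta>. u n \<zeta> * indicator E \<zeta> * indicator unit_disc \<zeta> \<partial>lborel)
      = (\<integral>\<^sup>+z. v z * G z * indicator E (\<phi>' z) * indicator (D n) z \<partial>lborel)" for n
  proof -
    have "(\<integral>\<^sup>+\<zeta>. u n \<zeta> * indicator E \<zeta> * indicator unit_disc \<zeta> \<partial>lborel)
       = (\<integral>\<^sup>+\<zeta>\<in>\<phi> ` B n. (u n \<zeta> * indicator E \<zeta>) \<partial>lborel)"
    proof (rule nn_integral_cong)
      fix \<zeta>
      have "\<phi> ` D n \<subseteq> \<phi> ` B n" "\<phi> ` B n \<subseteq> unit_disc" using ran BU[of n] DB[of n] by (auto simp: U_def)
      then have "\<zeta> \<in> unit_disc" "\<zeta> \<in> \<phi> ` B n" if "\<zeta> \<in> \<phi> ` D n" using that by blast+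
      then show "u n \<zeta> * indicator E \<zeta> * indicator unit_disc \<zeta>
        = u n \<zeta> * indicator E \<zeta> * indicator (\<phi> ` B n) \<zeta>"
        by (cases "\<zeta> \<in> \<phi> ` D n") (simp_all add: u_def del: mem_ball)
    qed
    also have "\<dots> = (\<integral>\<^sup>+z\<in>B n. (u n (\<phi> z) * indicator E (\<phi> z) * ennreal ((cmod (deriv \<phi> z))\<^sup>2)) \<partial>lborel)"
      by (rule nn_integral_inj_holomorphic[OF holB B(1) B(2), symmetric]) simp
    also have "\<dots> = (\<integral>\<^sup>+z. v z * G z * indicator E (\<phi>' z) * indicator (D n) z \<partial>lborel)"
    proof (rule nn_integral_cong)
      fix z
      have zD: "z \<in> D n" if "z \<in> B n" "\<phi> z \<in> \<phi> ` D n"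
        using that DB[of n] inj_on_image_mem_iff[OF B(2)[of n], of z "D n"] by blast
      have z: "z \<in> unit_disc" if "z \<in> B n" using that BU[of n] by (auto simp: U_def)
      show "u n (\<phi> z) * indicator E (\<phi> z) * ennreal ((cmod (deriv \<phi> z))\<^sup>2) * indicator (B n) z
          = v z * G z * indicator E (\<phi>' z) * indicator (D n) z"
      proof (cases "z \<in> D n")
        case True
        then have "z \<in> B n" using DB by blast
        moreover have "u n (\<phi> z) = G z"
          unfolding u_def using True by (simp add: the_inv_into_f_f[OF Dinj])
        moreover have "v z = ennreal ((cmod (deriv \<phi> z))\<^sup>2)" "\<phi>' z = \<phi> z"
          using z[OF \<open>z \<in> B n\<close>] by (simp_all add: v_def \<phi>'_def)
        ultimately show ?thesis using True by (simp add: mult_ac)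
      next
        case False
        then have "indicator (B n) z * u n (\<phi> z) = 0"
          using zD by (cases "z \<in> B n") (auto simp: u_def)
        with False show ?thesis by auto
      qed
    qed
    finally show ?thesis .
  qed
  have "(\<integral>\<^sup>+\<zeta>\<in>E. counting_fun p \<phi> a \<zeta> \<partial>area) = (\<integral>\<^sup>+\<zeta>. (\<Sum>n. u n \<zeta>) * indicator E \<zeta> \<partial>area)"
    using AE1 by (intro nn_integral_cong_AE) auto
  also have "\<dots> = ennreal (1 / pi) * (\<integral>\<^sup>+\<zeta>. (\<Sum>n. u n \<zeta> * indicator E \<zeta> * indicator unit_disc \<zeta>) \<partial>lborel)"
  proof (subst nn_integral_area)
    show "(\<lambda>\<zeta>. (\<Sum>n. u n \<zeta>) * indicator E \<zeta>) \<in> borel_measurable borel" by measurable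
  qed (simp add: ennreal_suminf_multc)
  also have "\<dots> = ennreal (1 / pi) * (\<Sum>n. \<integral>\<^sup>+z. v z * G z * indicator E (\<phi>' z) * indicator (D n) z \<partial>lborel)"
  proof (subst nn_integral_suminf)
    show "(\<lambda>\<zeta>. u n \<zeta> * indicator E \<zeta> * indicator unit_disc \<zeta>) \<in> borel_measurable lborel" for n
      by measurable
  qed (simp only: piece)
  also have "\<dots> = ennreal (1 / pi) * (\<integral>\<^sup>+z. (\<Sum>n. v z * G z * indicator E (\<phi>' z) * indicator (D n) z) \<partial>lborel)"
  proof (subst nn_integral_suminf)
    show "(\<lambda>z. v z * G z * indicator E (\<phi>' z) * indicator (D n) z) \<in> borel_measurable lborel" for n
      by measurable
  qed (rule refl)
  also have "(\<lambda>z. \<Sum>n. v z * G z * indicator E (\<phi>' z) * indicator (D n) z)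
      = (\<lambda>z. v z * G z * indicator E (\<phi>' z) * indicator U z)"
    by (simp add: suminf_indicator[OF Ddisj] Dcov)
  also have "(\<lambda>z. v z * G z * indicator E (\<phi>' z) * indicator U z)
      = (\<lambda>z. v z * G z * indicator E (\<phi>' z) * indicator unit_disc z)"
    by (auto simp: fun_eq_iff v_def U_def Z_def indicator_def)
  also have "ennreal (1 / pi) * (\<integral>\<^sup>+z. v z * G z * indicator E (\<phi>' z) * indicator unit_disc z \<partial>lborel)
      = (\<integral>\<^sup>+z. v z * G z * indicator E (\<phi>' z) \<partial>area)"
  proof (subst nn_integral_area)
    show "(\<lambda>z. v z * G z * indicator E (\<phi>' z)) \<in> borel_measurable borel" by measurable
  qed (rule refl)
  also have "\<dots> = pullback_mass p \<phi> a E"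
    unfolding pullback_mass_def
    by (intro nn_integral_cong) (auto simp: v_def G_def \<phi>'_def indicator_def mult_ac)
  finally show ?thesis .
qed


section \<open>Averages over circles and rotations\<close>

lemma circle_mean_value:
  assumes "F holomorphic_on cball 0 1"
  shows "((\<lambda>t. F (cis (2 * pi * t))) has_integral F 0) {0..1}"
proof -
  have "((\<lambda>u. F u / (u - 0)) has_contour_integral (2 * of_real pi * \<i> * F 0)) (circlepath 0 1)"
    using assms by (intro Cauchy_integral_circlepath_simple) auto
  then have "((\<lambda>t. F (circlepath 0 1 t) / (circlepath 0 1 t - 0) * vector_derivative (circlepath 0 1) (at t))
      has_integral (2 * of_real pi * \<i> * F 0)) {0..1}"
    unfolding has_contour_integral .
  moreover have "F (circlepath 0 1 t) / (circlepath 0 1 t - 0) * vector_derivative (circlepath 0 1) (at t)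
      = (2 * of_real pi * \<i>) * F (cis (2 * pi * t))" for t
  proof -
    have "circlepath 0 1 t = cis (2 * pi * t)" by (simp add: circlepath cis_conv_exp mult_ac)
    moreover have "vector_derivative (circlepath 0 1) (at t) = 2 * of_real pi * \<i> * cis (2 * pi * t)"
      unfolding vector_derivative_circlepath by (simp add: cis_conv_exp mult_ac)
    ultimately show ?thesis by simp
  qed
  ultimately have "((\<lambda>t. (2 * of_real pi * \<i>) * F (cis (2 * pi * t))) has_integral (2 * of_real pi * \<i> * F 0)) {0..1}"
    by simp
  from has_integral_mult_right[OF this, of "1 / (2 * of_real pi * \<i>)"]
  show ?thesis by simp
qed

lemma circle_mean_Re:
  assumes "F holomorphic_on cball 0 1"
  shows "((\<lambda>t. Re (F (cis (2 * pi * t)))) has_integral Re (F 0)) {0..1}"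
  using has_integral_linear[OF circle_mean_value[OF assms] bounded_linear_Re] by (simp add: o_def)

text \<open>The mean value property of \<open>F\<^sup>2\<close>.\<close>

lemma circle_sub_mean_sq:
  assumes hol: "F holomorphic_on cball 0 1"
  shows "ennreal ((cmod (F 0))\<^sup>2) \<le> (\<integral>\<^sup>+t\<in>{0..1}. ennreal ((cmod (F (cis (2 * pi * t))))\<^sup>2) \<partial>lborel)"
proof -
  let ?f = "\<lambda>t. (F (cis (2 * pi * t)))\<^sup>2"
  have mean: "(?f has_integral (F 0)\<^sup>2) {0..1}"
    using hol by (intro circle_mean_value holomorphic_intros)
  have cont: "continuous_on {0..1} (\<lambda>t. F (cis (2 * pi * t)))"
    by (intro continuous_on_compose2[OF holomorphic_on_imp_continuous_on[OF hol]] continuous_intros) auto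
  have int: "(\<lambda>t. (cmod (F (cis (2 * pi * t))))\<^sup>2) integrable_on {0..1}"
    by (intro integrable_continuous_interval continuous_intros cont)
  have "cmod ((F 0)\<^sup>2) \<le> integral {0..1} (\<lambda>t. (cmod (F (cis (2 * pi * t))))\<^sup>2)"
    using integral_norm_bound_integral[OF has_integral_integrable[OF mean] int] integral_unique[OF mean]
    by (simp add: norm_power)
  then have "ennreal ((cmod (F 0))\<^sup>2) \<le> ennreal (integral {0..1} (\<lambda>t. (cmod (F (cis (2 * pi * t))))\<^sup>2))"
    by (simp add: norm_power ennreal_leI)
  also have "\<dots> = (\<integral>\<^sup>+t\<in>{0..1}. ennreal ((cmod (F (cis (2 * pi * t))))\<^sup>2) \<partial>lborel)"
    by (rule nn_integral_has_integral_lebesgue'[symmetric]) (use int in auto)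
  finally show ?thesis .
qed

lemma one_minus_mult_nonzero:
  fixes c w :: complex
  assumes "cmod c < 1" "cmod w \<le> 1" shows "1 - c * w \<noteq> 0" "0 < Re (1 - c * w)"
proof -
  have "cmod (c * w) \<le> cmod c * 1" unfolding norm_mult using assms(2) by (intro mult_left_mono) auto
  then have "cmod (c * w) < 1" using assms(1) by simp
  then have "Re (c * w) < 1" using abs_Re_le_cmod[of "c * w"] by linarith
  then show *: "0 < Re (1 - c * w)" by simp
  show "1 - c * w \<noteq> 0"
  proof
    assume "1 - c * w = 0"
    with * show False by simp
  qed
qed

text \<open>The Poisson kernel \<open>(1 - |c|\<^sup>2) / |1 - c w|\<^sup>2\<close> is the real part of \<open>(1 + c w) / (1 - c w)\<close> on the circle, so
  that its mean is the value one at \<open>w = 0\<close>.\<close>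

lemma circle_mean_inverse_sq:
  assumes c: "cmod c < 1"
  shows "(\<integral>\<^sup>+t\<in>{0..1}. ennreal (1 / (cmod (1 - c * cis (2 * pi * t)))\<^sup>2) \<partial>lborel) = ennreal (1 / (1 - (cmod c)\<^sup>2))"
proof -
  let ?F = "\<lambda>w. (1 + c * w) / (1 - c * w)"
  have pos: "0 < 1 - (cmod c)\<^sup>2" using c by (simp add: power_less_one_iff abs_square_less_1)
  have re: "Re (?F w) = (1 - (cmod c)\<^sup>2) / (cmod (1 - c * w))\<^sup>2" if "cmod w = 1" for w
  proof -
    have "Re (?F w) = Re ((1 + c * w) * cnj (1 - c * w)) / (cmod (1 - c * w))\<^sup>2"
      by (subst complex_div_cnj) (simp only: of_real_power[symmetric] Re_divide_of_real)
    also have "Re ((1 + c * w) * cnj (1 - c * w)) = 1 - (cmod (c * w))\<^sup>2"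
      unfolding cmod_power2 by (simp add: algebra_simps power2_eq_square)
    finally show ?thesis using that by (simp add: norm_mult)
  qed
  have "?F holomorphic_on cball 0 1"
    using one_minus_mult_nonzero(1)[OF c] by (intro holomorphic_intros) auto
  from circle_mean_Re[OF this]
  have "((\<lambda>t. (1 - (cmod c)\<^sup>2) / (cmod (1 - c * cis (2 * pi * t)))\<^sup>2) has_integral 1) {0..1}"
    by (simp add: re)
  from has_integral_mult_right[OF this, of "1 / (1 - (cmod c)\<^sup>2)"] pos
  have "((\<lambda>t. 1 / (cmod (1 - c * cis (2 * pi * t)))\<^sup>2) has_integral 1 / (1 - (cmod c)\<^sup>2)) {0..1}"
    by simp
  then show ?thesis by (intro nn_integral_has_integral_lebesgue') auto
qed

lemma circle_mean_ln:
  assumes c: "cmod c < 1"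
  shows "((\<lambda>t. ln (cmod (1 - c * cis (2 * pi * t)))) has_integral 0) {0..1}"
proof -
  have "(\<lambda>w. Ln (1 - c * w)) holomorphic_on cball 0 1"
    using one_minus_mult_nonzero(2)[OF c]
    by (intro holomorphic_intros) (auto simp: complex_nonpos_Reals_iff not_le)
  from circle_mean_Re[OF this] show ?thesis
    using one_minus_mult_nonzero(1)[OF c] by (simp add: Re_Ln)
qed

text \<open>Jensen's formula for a single zero: on the circle \<open>|b - w u| = |u - b w\<^sup>*|\<close>, and one of the two
  expressions is free of zeros in the disc.\<close>

lemma circle_mean_ln_linear:
  fixes u b :: complex
  assumes ne: "cmod u \<noteq> cmod b"
  shows "((\<lambda>t. ln (cmod (b - cis (2 * pi * t) * u))) has_integral ln (max (cmod u) (cmod b))) {0..1}"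
proof (cases "cmod u < cmod b")
  case True
  then have b: "b \<noteq> 0" by auto
  have c: "cmod (u / b) < 1" using True b by (simp add: norm_divide)
  have "ln (cmod (b - cis (2 * pi * t) * u)) = ln (cmod b) + ln (cmod (1 - u / b * cis (2 * pi * t)))" for t
  proof -
    have "b - cis (2 * pi * t) * u = b * (1 - u / b * cis (2 * pi * t))"
      using b by (simp add: field_simps)
    then show ?thesis
      using b one_minus_mult_nonzero(1)[OF c, of "cis (2 * pi * t)"] by (simp add: norm_mult ln_mult)
  qed
  then show ?thesis
    using has_integral_add[OF has_integral_const_real[of "ln (cmod b)" 0 1] circle_mean_ln[OF c]] True
    by simp
next
  case False
  with ne have lt: "cmod b < cmod u" by simp
  then have u: "u \<noteq> 0" by auto
  have c: "cmod (cnj (b / u)) < 1" using lt u by (simp add: norm_divide)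
  have "ln (cmod (b - cis (2 * pi * t) * u)) = ln (cmod u) + ln (cmod (1 - cnj (b / u) * cis (2 * pi * t)))" for t
  proof -
    have "b - cis (2 * pi * t) * u = - (u * cis (2 * pi * t) * cnj (1 - cnj (b / u) * cis (2 * pi * t)))"
      using u by (simp add: field_simps cis_cnj cis_mult flip: cis_inverse)
    then have "cmod (b - cis (2 * pi * t) * u) = cmod u * cmod (1 - cnj (b / u) * cis (2 * pi * t))"
      by (simp only: norm_minus_cancel norm_mult complex_mod_cnj norm_cis mult_1_right)
    then show ?thesis
      using u one_minus_mult_nonzero(1)[OF c, of "cis (2 * pi * t)"] by (simp add: ln_mult)
  qed
  then show ?thesis
    using has_integral_add[OF has_integral_const_real[of "ln (cmod u)" 0 1] circle_mean_ln[OF c]] lt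
    by simp
qed

lemma disc_aut_cmod:
  assumes "cmod a < 1" "cmod z < 1"
  shows "1 - (cmod (disc_aut a z))\<^sup>2 = (1 - (cmod a)\<^sup>2) * (1 - (cmod z)\<^sup>2) / (cmod (1 - cnj a * z))\<^sup>2"
proof -
  have ne: "1 - cnj a * z \<noteq> 0" using one_minus_mult_nonzero(1)[of "cnj a" z] assms by simp
  have "(cmod (1 - cnj a * z))\<^sup>2 - (cmod (a - z))\<^sup>2 = (1 - (cmod a)\<^sup>2) * (1 - (cmod z)\<^sup>2)"
    unfolding cmod_power2 by (simp add: algebra_simps power2_eq_square)
  then show ?thesis using ne
    by (simp add: disc_aut_def norm_divide power_divide field_simps)
qed

lemma disc_aut_cmod_less:
  assumes "cmod a < 1" "cmod z < 1" shows "cmod (disc_aut a z) < 1"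
proof -
  have ne: "1 - cnj a * z \<noteq> 0" using one_minus_mult_nonzero(1)[of "cnj a" z] assms by simp
  have "0 < (1 - (cmod a)\<^sup>2) * (1 - (cmod z)\<^sup>2) / (cmod (1 - cnj a * z))\<^sup>2"
    using assms ne by (intro divide_pos_pos mult_pos_pos) (auto simp: abs_square_less_1)
  then have "(cmod (disc_aut a z))\<^sup>2 < 1" using disc_aut_cmod[OF assms] by linarith
  then show ?thesis by (simp add: abs_square_less_1)
qed

lemma circle_mean_green:
  assumes u: "cmod u < 1" and b: "cmod b < 1" and ne: "cmod u \<noteq> cmod b"
  shows "(\<integral>\<^sup>+t\<in>{0..1}. green (cis (2 * pi * t) * u) b \<partial>lborel) = ennreal (- ln (max (cmod u) (cmod b)))"
proof -
  let ?z = "\<lambda>t. cis (2 * pi * t) * u"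
  let ?h = "\<lambda>t. ln (cmod (1 - (cnj b * u) * cis (2 * pi * t))) - ln (cmod (b - ?z t))"
  have "cmod (cnj b * u) \<le> cmod b * 1" unfolding norm_mult using u by (intro mult_mono) auto
  then have cb: "cmod (cnj b * u) < 1" using b by simp
  have mod: "cmod (?z t) = cmod u" for t by (simp add: norm_mult)
  have neq: "?z t \<noteq> b" for t using mod[of t] ne by metis
  have val: "ln (1 / cmod (disc_aut b (?z t))) = ?h t" for t
  proof -
    have "1 - cnj b * ?z t \<noteq> 0" "b - ?z t \<noteq> 0"
      using one_minus_mult_nonzero(1)[of "cnj b" "?z t"] mod u b neq[of t] by auto
    then show ?thesis
      by (simp add: disc_aut_def norm_divide ln_div mult_ac)
  qed
  have nonneg: "0 \<le> ?h t" for t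
  proof -
    have "cmod (disc_aut b (?z t)) < 1" using b u mod by (intro disc_aut_cmod_less) auto
    moreover have "disc_aut b (?z t) \<noteq> 0"
      using neq[of t] one_minus_mult_nonzero(1)[of "cnj b" "?z t"] mod u b by (auto simp: disc_aut_def)
    ultimately show ?thesis unfolding val[symmetric] by (intro ln_ge_zero) (simp add: field_simps)
  qed
  have "(?h has_integral (0 - ln (max (cmod u) (cmod b)))) {0..1}"
    by (intro has_integral_diff circle_mean_ln circle_mean_ln_linear cb ne)
  then have "(\<integral>\<^sup>+t\<in>{0..1}. ennreal (?h t) \<partial>lborel) = ennreal (- ln (max (cmod u) (cmod b)))"
    using nonneg by (subst nn_integral_has_integral_lebesgue') auto
  then show ?thesis using neq val by (simp add: green_def)
qed

lemma nn_integral_rotate: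
  assumes [measurable]: "h \<in> borel_measurable borel" and c: "cmod c = 1"
  shows "(\<integral>\<^sup>+z. h (c * z) \<partial>lborel) = (\<integral>\<^sup>+z. h z \<partial>lborel)"
proof -
  have c0: "c \<noteq> 0" using c by auto
  have "(\<integral>\<^sup>+z\<in>UNIV. (h (c * z) * ennreal ((cmod (deriv ((*) c) z))\<^sup>2)) \<partial>lborel) = (\<integral>\<^sup>+w\<in>(*) c ` UNIV. h w \<partial>lborel)"
    using c0 by (intro nn_integral_inj_holomorphic) (auto intro!: holomorphic_intros inj_onI)
  moreover have "range ((*) c) = UNIV"
    using c0 by (intro surjI[of _ "\<lambda>z. z / c"]) auto
  ultimately show ?thesis using c by simp
qed

text \<open>Lebesgue measure is rotation invariant, so that an integrand may be replaced by its circular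
  means; this replaces polar coordinates.\<close>

lemma nn_integral_circular_mean:
  assumes [measurable]: "G \<in> borel_measurable borel"
  shows "(\<integral>\<^sup>+z. G z \<partial>lborel) = (\<integral>\<^sup>+z. (\<integral>\<^sup>+t\<in>{0..1}. G (cis (2 * pi * t) * z) \<partial>lborel) \<partial>(lborel :: complex measure))"
proof -
  have [measurable]: "(\<lambda>t::real. cis (2 * pi * t)) \<in> borel_measurable borel"
    by (intro borel_measurable_continuous_onI continuous_intros)
  have "(\<integral>\<^sup>+z. (\<integral>\<^sup>+t. G (cis (2 * pi * t) * z) * indicator {0..1} t \<partial>lborel) \<partial>(lborel :: complex measure))
    = (\<integral>\<^sup>+t. (\<integral>\<^sup>+z. G (cis (2 * pi * t) * z) * indicator {0..1} t \<partial>lborel) \<partial>lborel)"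
    by (rule lborel_pair.Fubini') measurable
  also have "\<dots> = (\<integral>\<^sup>+t\<in>{0..1::real}. (\<integral>\<^sup>+z. G z \<partial>lborel) \<partial>lborel)"
    by (intro nn_integral_cong, subst nn_integral_multc) (auto simp: nn_integral_rotate)
  also have "\<dots> = (\<integral>\<^sup>+z. G z \<partial>lborel)"
    by (subst nn_integral_cmult_indicator) simp_all
  finally show ?thesis by simp
qed

text \<open>Subharmonicity of \<open>|F|\<^sup>2\<close>, integrated over all circles around \<open>c\<close> at once.\<close>

lemma disc_sub_mean_sq:
  assumes hol: "F holomorphic_on ball c r" and r: "r > 0"
  shows "ennreal (pi * r\<^sup>2 * (cmod (F c))\<^sup>2) \<le> (\<integral>\<^sup>+z\<in>ball c r. ennreal ((cmod (F z))\<^sup>2) \<partial>lborel)"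
proof -
  define G where "G = (\<lambda>z. ennreal (indicator (ball c r) z * (cmod (F z))\<^sup>2))"
  have [measurable]: "G \<in> borel_measurable borel"
  proof -
    have "(\<lambda>z. if z \<in> ball c r then (cmod (F z))\<^sup>2 else 0) \<in> borel_measurable borel"
      using hol by (intro borel_measurable_continuous_on_if continuous_intros)
         (auto intro!: holomorphic_on_imp_continuous_on)
    also have "(\<lambda>z. if z \<in> ball c r then (cmod (F z))\<^sup>2 else 0) = (\<lambda>z. indicator (ball c r) z * (cmod (F z))\<^sup>2)"
      by auto
    finally show ?thesis unfolding G_def by simp
  qed
  have "ennreal (pi * r\<^sup>2 * (cmod (F c))\<^sup>2) = (\<integral>\<^sup>+v\<in>ball 0 r. ennreal ((cmod (F c))\<^sup>2) \<partial>(lborel :: complex measure))"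
    using emeasure_ball[of r "0 :: complex"] r
    by (subst nn_integral_cmult_indicator) (auto simp: unit_ball_vol_2 ennreal_mult' mult_ac)
  also have "\<dots> \<le> (\<integral>\<^sup>+v. (\<integral>\<^sup>+t\<in>{0..1}. G (c + cis (2 * pi * t) * v) \<partial>lborel) \<partial>lborel)"
  proof (rule nn_integral_mono)
    fix v :: complex
    show "ennreal ((cmod (F c))\<^sup>2) * indicator (ball 0 r) v \<le> (\<integral>\<^sup>+t\<in>{0..1}. G (c + cis (2 * pi * t) * v) \<partial>lborel)"
    proof (cases "v \<in> ball 0 r")
      case True
      have sub: "c + w * v \<in> ball c r" if "w \<in> cball 0 1" for w
      proof -
        have "cmod (w * v) \<le> 1 * cmod v" unfolding norm_mult using that by (intro mult_right_mono) auto
        then show ?thesis using True by (simp add: dist_norm)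
      qed
      have "(\<lambda>w. F (c + w * v)) holomorphic_on cball 0 1"
        by (rule holomorphic_on_compose_gen[OF _ hol, unfolded o_def])
           (use sub in \<open>auto intro!: holomorphic_intros\<close>)
      from circle_sub_mean_sq[OF this]
      have "ennreal ((cmod (F c))\<^sup>2) \<le> (\<integral>\<^sup>+t\<in>{0..1}. ennreal ((cmod (F (c + cis (2 * pi * t) * v)))\<^sup>2) \<partial>lborel)"
        by simp
      also have "\<dots> = (\<integral>\<^sup>+t\<in>{0..1}. G (c + cis (2 * pi * t) * v) \<partial>lborel)"
        using sub[of "cis _"] by (intro nn_integral_cong) (auto simp: G_def)
      finally show ?thesis using True by simp
    qed auto
  qed
  also have "\<dots> = (\<integral>\<^sup>+v. G (c + v) \<partial>lborel)"
    by (rule nn_integral_circular_mean[symmetric]) measurable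
  also have "\<dots> = (\<integral>\<^sup>+v. G v \<partial>lborel)"
    by (subst lborel_distr_plus[of c, symmetric]) (simp add: nn_integral_distr)
  also have "\<dots> = (\<integral>\<^sup>+z\<in>ball c r. ennreal ((cmod (F z))\<^sup>2) \<partial>lborel)"
    by (intro nn_integral_cong) (auto simp: G_def indicator_def)
  finally show ?thesis .
qed


section \<open>A weighted integral of the Green function\<close>

lemma enn_powr_ennreal [simp]: "0 \<le> x \<Longrightarrow> enn_powr (ennreal x) r = ennreal (x powr r)"
  by (simp add: enn_powr_def)

lemma enn_powr_top [simp]: "enn_powr top r = top"
  by (simp add: enn_powr_def)

lemma enn_powr_mono: "0 \<le> r \<Longrightarrow> x \<le> y \<Longrightarrow> enn_powr x r \<le> enn_powr y r"
  by (cases x; cases y) (auto simp: ennreal_leI powr_mono2 top_unique)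

text \<open>The tangent line of the concave function \<open>y\<^sup>p\<close>, up to a factor.\<close>

lemma enn_powr_le_affine:
  assumes "0 < p" "p \<le> 1" "0 < T"
  shows "enn_powr x p \<le> ennreal (T powr p) + ennreal (T powr (p - 1)) * x"
proof (cases x)
  case (real y)
  have "y powr p \<le> T powr p + T powr (p - 1) * y"
  proof (cases "y \<le> T")
    case True
    then have "y powr p \<le> T powr p" using real assms by (intro powr_mono2) auto
    then show ?thesis using real assms by (simp add: add_increasing2)
  next
    case False
    have "y powr p = y * y powr (p - 1)" using False assms by (simp add: powr_diff)
    also have "\<dots> \<le> y * T powr (p - 1)" using False assms by (intro mult_left_mono powr_mono2') auto
    finally show ?thesis using assms by (simp add: mult.commute add_increasing)
  qed
  then show ?thesis using real by (simp flip: ennreal_mult' ennreal_plus add: ennreal_leI)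
next
  case top
  then show ?thesis using assms by (simp add: ennreal_mult_top)
qed

lemma dyadic_bracket:
  fixes x :: real
  assumes "0 < x" "x \<le> 1"
  obtains k :: nat where "1 / 2 ^ Suc k < x" "x \<le> 1 / 2 ^ k"
proof -
  have ex: "\<exists>k::nat. 1 / 2 ^ Suc k < x"
  proof -
    obtain n where "(1/2::real) ^ n < x" using real_arch_pow_inv[of x "1/2"] assms by auto
    then have "1 / 2 ^ Suc n < x"
      using power_decreasing[of n "Suc n" "1/2 :: real"] by (simp add: power_one_over)
    then show ?thesis by blast
  qed
  define k where "k = (LEAST k::nat. 1 / 2 ^ Suc k < x)"
  have "1 / 2 ^ Suc k < x" unfolding k_def using ex by (rule LeastI_ex)
  moreover have "x \<le> 1 / 2 ^ k"
  proof (cases k)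
    case 0 then show ?thesis using assms by simp
  next
    case (Suc j)
    then have "j < k" by simp
    then have "\<not> 1 / 2 ^ Suc j < x" unfolding k_def by (rule not_less_Least)
    then show ?thesis using Suc by simp
  qed
  ultimately show thesis by (rule that)
qed

text \<open>A substitute for polar coordinates in proofs of integrability: the integrand is bounded on each of
  countably many dyadic layers.\<close>

lemma nn_integral_layers_finite:
  fixes f :: "complex \<Rightarrow> ennreal"
  assumes A: "\<And>k::nat. A k \<in> sets borel"
    and cover: "\<And>z. z \<in> S \<Longrightarrow> \<exists>k. z \<in> A k \<and> f z \<le> ennreal (c k)"
    and meas: "\<And>k. emeasure lborel (A k) \<le> ennreal (m k)" and pos: "\<And>k. 0 \<le> c k" "\<And>k. 0 \<le> m k"
    and sum: "summable (\<lambda>k. c k * m k)"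
  shows "(\<integral>\<^sup>+z\<in>S. f z \<partial>lborel) < \<infinity>"
proof -
  have [measurable]: "A k \<in> sets borel" for k by (rule A)
  have "(\<integral>\<^sup>+z\<in>S. f z \<partial>lborel) \<le> (\<integral>\<^sup>+z. (\<Sum>k. ennreal (c k) * indicator (A k) z) \<partial>lborel)"
  proof (rule nn_integral_mono)
    fix z
    show "f z * indicator S z \<le> (\<Sum>k. ennreal (c k) * indicator (A k) z)"
    proof (cases "z \<in> S")
      case True
      then obtain k where k: "z \<in> A k" "f z \<le> ennreal (c k)" using cover by blast
      have "f z \<le> (\<Sum>j\<in>{k}. ennreal (c j) * indicator (A j) z)" using k by simp
      also have "\<dots> \<le> (\<Sum>k. ennreal (c k) * indicator (A k) z)" by (intro sum_le_suminf) auto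
      finally show ?thesis using True by simp
    qed simp
  qed
  also have "\<dots> = (\<Sum>k. ennreal (c k) * emeasure lborel (A k))"
    by (subst nn_integral_suminf) (simp_all add: nn_integral_cmult_indicator A)
  also have "\<dots> \<le> (\<Sum>k. ennreal (c k * m k))"
    using meas pos by (intro suminf_le summableI) (simp add: ennreal_mult' mult_left_mono)
  also have "\<dots> = ennreal (\<Sum>k. c k * m k)"
    using pos sum by (intro suminf_ennreal2) auto
  finally show ?thesis by (simp add: le_less_trans)
qed

lemma emeasure_ball_complex: "0 \<le> r \<Longrightarrow> emeasure lborel (ball (c::complex) r) = ennreal (pi * r\<^sup>2)"
  by (simp add: emeasure_ball unit_ball_vol_2)

lemma nn_integral_inverse_cmod_finite:
  "(\<integral>\<^sup>+z\<in>unit_disc. ennreal (1 / cmod z) \<partial>lborel) < \<infinity>"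
proof (rule nn_integral_layers_finite)
  let ?A = "\<lambda>k::nat. cball 0 (1 / 2 ^ k) :: complex set"
  fix z :: complex assume z: "z \<in> unit_disc"
  show "\<exists>k. z \<in> ?A k \<and> ennreal (1 / cmod z) \<le> ennreal (2 ^ Suc k)"
  proof (cases "z = 0")
    case False
    then obtain k :: nat where k: "1 / 2 ^ Suc k < cmod z" "cmod z \<le> 1 / 2 ^ k"
      using dyadic_bracket[of "cmod z"] z by auto
    have "1 / cmod z \<le> 2 ^ Suc k"
      using k(1) False by (simp add: field_simps)
    then show ?thesis using k(2) by (intro exI[of _ k]) (auto intro: ennreal_leI)
  qed (auto intro!: exI[of _ 0])
next
  fix k :: nat
  show "emeasure lborel (cball 0 (1 / 2 ^ k) :: complex set) \<le> ennreal (pi * (1 / 2 ^ k)\<^sup>2)"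
    by (simp add: emeasure_cball unit_ball_vol_2)
  have "summable (\<lambda>k. 2 * pi * (1 / 2 :: real) ^ k)"
    by (intro summable_mult summable_geometric) simp
  moreover have "2 ^ Suc k * (pi * (1 / 2 ^ k)\<^sup>2) = 2 * pi * (1 / 2) ^ k" for k
    by (simp add: power2_eq_square field_simps power_divide)
  ultimately show "summable (\<lambda>k. 2 ^ Suc k * (pi * (1 / 2 ^ k)\<^sup>2))" by (simp only:)
qed auto

lemma nn_integral_boundary_weight_finite:
  "(\<integral>\<^sup>+z\<in>unit_disc. ennreal ((1 - cmod z) powr (-1/2)) \<partial>lborel) < \<infinity>"
proof (rule nn_integral_layers_finite)
  let ?A = "\<lambda>k::nat. ball 0 1 - ball 0 (1 - 1 / 2 ^ k) :: complex set"
  let ?c = "\<lambda>k::nat. (1 / 2 ^ Suc k) powr (-1/2) :: real"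
  fix z :: complex assume z: "z \<in> unit_disc"
  then obtain k :: nat where k: "1 / 2 ^ Suc k < 1 - cmod z" "1 - cmod z \<le> 1 / 2 ^ k"
    using dyadic_bracket[of "1 - cmod z"] by auto
  have "(1 - cmod z) powr (-1/2) \<le> ?c k" using k(1) z by (intro powr_mono2') auto
  then show "\<exists>k. z \<in> ?A k \<and> ennreal ((1 - cmod z) powr (-1/2)) \<le> ennreal (?c k)"
    using k(2) z by (intro exI[of _ k]) (auto intro: ennreal_leI)
next
  fix k :: nat
  have r: "0 \<le> (1 :: real) - 1 / 2 ^ k" "1 - 1 / 2 ^ k \<le> (1 :: real)"
  proof -
    have "1 / 2 ^ k \<le> (1 :: real)" by (simp add: divide_le_eq)
    then show "0 \<le> (1 :: real) - 1 / 2 ^ k" "1 - 1 / 2 ^ k \<le> (1 :: real)" by auto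
  qed
  have "emeasure lborel (ball 0 1 - ball 0 (1 - 1 / 2 ^ k) :: complex set)
      = ennreal pi - ennreal (pi * (1 - 1 / 2 ^ k)\<^sup>2)"
    using r by (subst emeasure_Diff) (auto simp: emeasure_ball_complex subset_ball)
  also have "\<dots> = ennreal (pi - pi * (1 - 1 / 2 ^ k)\<^sup>2)"
    by (rule ennreal_minus) simp
  also have "\<dots> \<le> ennreal (2 * pi * (1 / 2 ^ k))"
  proof (rule ennreal_leI)
    have "pi - pi * (1 - 1 / 2 ^ k)\<^sup>2 = 2 * pi * (1 / 2 ^ k) - pi * (1 / 2 ^ k)\<^sup>2"
      by (simp add: power2_eq_square algebra_simps)
    also have "\<dots> \<le> 2 * pi * (1 / 2 ^ k)" by simp
    finally show "pi - pi * (1 - 1 / 2 ^ k)\<^sup>2 \<le> 2 * pi * (1 / 2 ^ k)" .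
  qed
  finally show "emeasure lborel (ball 0 1 - ball 0 (1 - 1 / 2 ^ k) :: complex set) \<le> ennreal (2 * pi * (1 / 2 ^ k))" .
  have "(1 / 2 ^ Suc k) powr (-1/2) * (2 * pi * (1 / 2 ^ k)) = 2 * pi * sqrt 2 * (1 / sqrt 2) ^ k" for k
  proof -
    have "(1 / 2 ^ Suc k :: real) powr (-1/2) = (2 ^ Suc k) powr (1/2)"
      by (simp add: powr_minus_divide powr_divide)
    also have "\<dots> = sqrt (2 ^ Suc k)" by (simp add: powr_half_sqrt)
    also have "\<dots> = sqrt 2 * sqrt 2 ^ k" by (simp add: real_sqrt_mult real_sqrt_power)
    finally have *: "(1 / 2 ^ Suc k :: real) powr (-1/2) = sqrt 2 * sqrt 2 ^ k" .
    have "(2::real) ^ k = sqrt 2 ^ k * sqrt 2 ^ k" by (simp flip: power_mult_distrib)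
    then show ?thesis unfolding * by (simp add: power_divide field_simps)
  qed
  moreover have "summable (\<lambda>k. 2 * pi * sqrt 2 * (1 / sqrt 2) ^ k)"
    by (intro summable_mult summable_geometric) simp
  ultimately show "summable (\<lambda>k. (1 / 2 ^ Suc k) powr (-1/2) * (2 * pi * (1 / 2 ^ k)))" by (simp only:)
qed auto

definition weight_mass :: real where
  "weight_mass = enn2real (\<integral>\<^sup>+u\<in>unit_disc. ennreal ((1 - cmod u) powr (-1/2) / cmod u) \<partial>lborel)"

lemma weight_mass:
  "(\<integral>\<^sup>+u\<in>unit_disc. ennreal ((1 - cmod u) powr (-1/2) / cmod u) \<partial>lborel) = ennreal weight_mass"
proof -
  have "(\<integral>\<^sup>+u\<in>unit_disc. ennreal ((1 - cmod u) powr (-1/2) / cmod u) \<partial>lborel)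
    \<le> (\<integral>\<^sup>+u. (ennreal 2 * (ennreal ((1 - cmod u) powr (-1/2)) * indicator unit_disc u)
          + ennreal 2 * (ennreal (1 / cmod u) * indicator unit_disc u)) \<partial>lborel)"
  proof (rule nn_integral_mono)
    fix u :: complex
    have "(1 - cmod u) powr (-1/2) / cmod u \<le> 2 * (1 - cmod u) powr (-1/2) + 2 * (1 / cmod u)" if "cmod u < 1"
    proof (cases "cmod u \<ge> 1/2")
      case True
      then have "u \<noteq> 0" by auto
      with True have "1 / cmod u \<le> 2" by (simp add: field_simps)
      from mult_left_mono[OF this, of "(1 - cmod u) powr (-1/2)"]
      have "(1 - cmod u) powr (-1/2) / cmod u \<le> 2 * (1 - cmod u) powr (-1/2)" by (simp add: mult.commute)
      then show ?thesis by (simp add: add_increasing2)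
    next
      case False
      then have "(1 - cmod u) powr (-1/2) \<le> (1/2) powr (-1/2)" by (intro powr_mono2') auto
      also have "\<dots> = sqrt 2" by (simp add: powr_minus_divide powr_divide powr_half_sqrt)
      also have "\<dots> \<le> 2" by (rule real_le_lsqrt) auto
      finally have "(1 - cmod u) powr (-1/2) / cmod u \<le> 2 / cmod u" by (intro divide_right_mono) auto
      then show ?thesis by (simp add: add_increasing)
    qed
    then have "ennreal ((1 - cmod u) powr (-1/2) / cmod u)
      \<le> ennreal 2 * ennreal ((1 - cmod u) powr (-1/2)) + ennreal 2 * ennreal (1 / cmod u)" if "cmod u < 1"
    proof -
      have "ennreal ((1 - cmod u) powr (-1/2) / cmod u)
          \<le> ennreal (2 * (1 - cmod u) powr (-1/2) + 2 * (1 / cmod u))"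
        using \<open>cmod u < 1 \<Longrightarrow> _\<close> that by (intro ennreal_leI) blast
      also have "\<dots> = ennreal (2 * (1 - cmod u) powr (-1/2)) + ennreal (2 * (1 / cmod u))"
        by (rule ennreal_plus) auto
      also have "\<dots> = ennreal 2 * ennreal ((1 - cmod u) powr (-1/2)) + ennreal 2 * ennreal (1 / cmod u)"
        by (simp only: ennreal_mult'[OF zero_le_numeral])
      finally show ?thesis .
    qed
    then show "ennreal ((1 - cmod u) powr (-1/2) / cmod u) * indicator unit_disc u
      \<le> ennreal 2 * (ennreal ((1 - cmod u) powr (-1/2)) * indicator unit_disc u)
          + ennreal 2 * (ennreal (1 / cmod u) * indicator unit_disc u)"
      by (cases "cmod u < 1") (simp_all add: indicator_def)
  qed
  also have "\<dots> = ennreal 2 * (\<integral>\<^sup>+u\<in>unit_disc. ennreal ((1 - cmod u) powr (-1/2)) \<partial>lborel)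
      + ennreal 2 * (\<integral>\<^sup>+u\<in>unit_disc. ennreal (1 / cmod u) \<partial>lborel)"
    by (subst nn_integral_add) (auto simp: nn_integral_cmult)
  also have "\<dots> < \<infinity>"
    using nn_integral_inverse_cmod_finite nn_integral_boundary_weight_finite
    by (auto simp: ennreal_mult_less_top)
  finally show ?thesis unfolding weight_mass_def by (intro ennreal_enn2real[symmetric]) simp
qed

lemma weight_mass_nonneg: "0 \<le> weight_mass"
  by (simp add: weight_mass_def)

text \<open>Circular means of \<open>g(\<cdot>,b)\<^sup>p\<close> are controlled by concavity and Jensen's formula: the mean of
  \<open>g(\<cdot>,b)\<close> over \<open>|u| = r\<close> is \<open>log (1 / max r |b|)\<close>, which is comparable with \<open>1 - |b|\<close> unless both
  \<open>r\<close> and \<open>|b|\<close> are small.\<close>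

lemma circle_mean_green_powr:
  assumes p: "0 < p" "p \<le> 1" and u: "cmod u < 1" and b: "cmod b < 1" and ne: "cmod u \<noteq> cmod b" "u \<noteq> 0"
  shows "(\<integral>\<^sup>+t\<in>{0..1}. enn_powr (green (cis (2 * pi * t) * u) b) p \<partial>lborel)
      \<le> ennreal (4 * (1 - (cmod b)\<^sup>2) powr p / cmod u)"
proof -
  have [measurable]: "(\<lambda>t::real. cis (2 * pi * t)) \<in> borel_measurable borel"
    by (intro borel_measurable_continuous_onI continuous_intros)
  define m where "m = - ln (max (cmod u) (cmod b))"
  have m0: "0 \<le> m"
  proof -
    have "0 < max (cmod u) (cmod b)" "max (cmod u) (cmod b) < 1" using u b ne by (auto simp: less_max_iff_disj)
    then show ?thesis using ln_less_zero[of "max (cmod u) (cmod b)"] by (simp add: m_def)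
  qed
  have aff: "(\<integral>\<^sup>+t\<in>{0..1}. enn_powr (green (cis (2 * pi * t) * u) b) p \<partial>lborel)
      \<le> ennreal (T powr p + T powr (p - 1) * m)" if T: "0 < T" for T
  proof -
    have "(\<integral>\<^sup>+t\<in>{0..1}. enn_powr (green (cis (2 * pi * t) * u) b) p \<partial>lborel)
      \<le> (\<integral>\<^sup>+t. ennreal (T powr p) * indicator {0..1} t
          + ennreal (T powr (p - 1)) * (green (cis (2 * pi * t) * u) b * indicator {0..1} t) \<partial>lborel)"
      using enn_powr_le_affine[OF p T]
      by (intro nn_integral_mono) (auto simp: indicator_def)
    also have "\<dots> = ennreal (T powr p) + ennreal (T powr (p - 1)) * ennreal m"
      unfolding m_def circle_mean_green[OF u b ne(1), symmetric]
      by (subst nn_integral_add) (auto simp: nn_integral_cmult_indicator nn_integral_cmult)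
    also have "\<dots> = ennreal (T powr p + T powr (p - 1) * m)"
      using m0 by (simp add: ennreal_mult' ennreal_plus)
    finally show ?thesis .
  qed
  have pos: "0 < 1 - (cmod b)\<^sup>2" using b by (simp add: abs_square_less_1)
  show ?thesis
  proof (cases "cmod b \<ge> 1/2")
    case True
    define T where "T = - ln (cmod b)"
    have b0: "0 < cmod b" using True by linarith
    have T: "0 < T" unfolding T_def using ln_less_zero[OF b0 b] by simp
    have mT: "m \<le> T" unfolding T_def m_def neg_le_iff_le using b0 by (intro iffD2[OF ln_le_cancel_iff]) (auto simp: less_max_iff_disj)
    have "T = ln (1 / cmod b)" using True by (simp add: T_def ln_div)
    also have "\<dots> \<le> 1 / cmod b - 1" using True by (intro ln_le_minus_one) auto
    also have "\<dots> \<le> 2 * (1 - cmod b)"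
    proof -
      have "b \<noteq> 0" using True by auto
      then have "1 / cmod b - 1 = (1 - cmod b) * (1 / cmod b)" by (simp add: field_simps)
      also have "\<dots> \<le> (1 - cmod b) * 2"
        using True b \<open>b \<noteq> 0\<close> by (intro mult_left_mono) (auto simp: field_simps)
      finally show ?thesis by simp
    qed
    also have "\<dots> \<le> 2 * (1 - (cmod b)\<^sup>2)" using b by (simp add: power2_eq_square mult_left_le)
    finally have Tb: "T \<le> 2 * (1 - (cmod b)\<^sup>2)" .
    have "T powr (p - 1) * m \<le> T powr (p - 1) * T" using mT by (intro mult_left_mono) auto
    also have "\<dots> = T powr p" using T by (simp add: powr_diff)
    finally have "T powr p + T powr (p - 1) * m \<le> 2 * T powr p" by simp
    also have "\<dots> \<le> 2 * (2 * (1 - (cmod b)\<^sup>2)) powr p" using T Tb p by (simp add: powr_mono2)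
    also have "\<dots> = 2 * 2 powr p * (1 - (cmod b)\<^sup>2) powr p" using pos by (subst powr_mult) auto
    also have "\<dots> \<le> 4 * (1 - (cmod b)\<^sup>2) powr p"
      using powr_mono[of p 1 2] p by (intro mult_right_mono) auto
    also have "\<dots> \<le> 4 * (1 - (cmod b)\<^sup>2) powr p / cmod u"
    proof -
      have "1 \<le> 1 / cmod u" using u ne(2) by (simp add: field_simps)
      from mult_left_mono[OF this, of "4 * (1 - (cmod b)\<^sup>2) powr p"] show ?thesis by simp
    qed
    finally show ?thesis using aff[OF T] by (meson ennreal_leI order_trans)
  next
    case False
    have "m \<le> - ln (cmod u)" unfolding m_def neg_le_iff_le using ne(2) by (intro iffD2[OF ln_le_cancel_iff]) (auto simp: less_max_iff_disj)
    also have "\<dots> = ln (1 / cmod u)" using ne(2) by (simp add: ln_div)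
    also have "\<dots> \<le> 1 / cmod u - 1" using ne(2) by (intro ln_le_minus_one) auto
    finally have "1 + m \<le> 1 / cmod u" by simp
    moreover have "1 \<le> 4 * (1 - (cmod b)\<^sup>2) powr p"
    proof -
      have "(cmod b)\<^sup>2 \<le> (1/2)\<^sup>2" using False by (intro power_mono) auto
      then have "3/4 \<le> 1 - (cmod b)\<^sup>2" by (simp add: power2_eq_square)
      also have "\<dots> = (1 - (cmod b)\<^sup>2) powr 1" using pos by simp
      also have "\<dots> \<le> (1 - (cmod b)\<^sup>2) powr p" using pos p by (intro powr_mono') auto
      finally show ?thesis by simp
    qed
    from mult_right_mono[OF this, of "1 / cmod u"]
    have "1 / cmod u \<le> 4 * (1 - (cmod b)\<^sup>2) powr p / cmod u" by simp
    ultimately have "1 powr p + 1 powr (p - 1) * m \<le> 4 * (1 - (cmod b)\<^sup>2) powr p / cmod u" by simp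
    then show ?thesis using aff[of 1] by (meson ennreal_leI order_trans zero_less_one)
  qed
qed

lemma null_sets_sphere_complex: "sphere (0::complex) r \<in> null_sets lborel"
  using negligible_sphere[of 0 r] by (simp add: negligible_iff_null_sets null_sets_completion_iff)

text \<open>The weight is radial, hence only the circular means of \<open>g(\<cdot>,b)\<^sup>p\<close> enter.\<close>

lemma nn_integral_weighted_green:
  assumes p: "0 < p" "p \<le> 1" and b: "cmod b < 1"
  shows "(\<integral>\<^sup>+u\<in>unit_disc. (ennreal ((1 - cmod u) powr (-1/2)) * enn_powr (green u b) p) \<partial>lborel)
      \<le> ennreal (4 * weight_mass * (1 - (cmod b)\<^sup>2) powr p)"
proof -
  have [measurable]: "(\<lambda>t::real. cis (2 * pi * t)) \<in> borel_measurable borel"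
    by (intro borel_measurable_continuous_onI continuous_intros)
  let ?w = "\<lambda>u. ennreal ((1 - cmod u) powr (-1/2)) * indicator unit_disc u"
  let ?G = "\<lambda>u. ?w u * enn_powr (green u b) p"
  have "(\<integral>\<^sup>+u\<in>unit_disc. (ennreal ((1 - cmod u) powr (-1/2)) * enn_powr (green u b) p) \<partial>lborel)
    = (\<integral>\<^sup>+u. ?G u \<partial>lborel)"
    by (intro nn_integral_cong) (simp add: mult_ac)
  also have "\<dots> = (\<integral>\<^sup>+u. (\<integral>\<^sup>+t\<in>{0..1}. ?G (cis (2 * pi * t) * u) \<partial>lborel) \<partial>(lborel :: complex measure))"
    by (rule nn_integral_circular_mean) measurable
  also have "\<dots> \<le> (\<integral>\<^sup>+u. ennreal (4 * (1 - (cmod b)\<^sup>2) powr p)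
      * (ennreal ((1 - cmod u) powr (-1/2) / cmod u) * indicator unit_disc u) \<partial>lborel)"
  proof (rule nn_integral_mono_AE)
    have "AE u :: complex in lborel. u \<notin> sphere 0 (cmod b) \<union> {0}"
      using null_sets_sphere_complex[of "cmod b"] by (intro AE_not_in null_sets.Un) auto
    then show "AE u in lborel. (\<integral>\<^sup>+t\<in>{0..1}. ?G (cis (2 * pi * t) * u) \<partial>lborel)
        \<le> ennreal (4 * (1 - (cmod b)\<^sup>2) powr p)
          * (ennreal ((1 - cmod u) powr (-1/2) / cmod u) * indicator unit_disc u)"
    proof eventually_elim
      case (elim u)
      have w: "?w (cis (2 * pi * t) * u) = ?w u" for t by (simp add: norm_mult indicator_def)
      have "(\<integral>\<^sup>+t\<in>{0..1}. ?G (cis (2 * pi * t) * u) \<partial>lborel)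
          = ?w u * (\<integral>\<^sup>+t\<in>{0..1}. enn_powr (green (cis (2 * pi * t) * u) b) p \<partial>lborel)"
      proof -
        have [measurable]: "(\<lambda>t. enn_powr (green (cis (2 * pi * t) * u) b) p * indicator {0..1} t) \<in> borel_measurable borel"
          by measurable
        define W where "W = ?w u"
        show ?thesis unfolding w W_def[symmetric] mult.assoc[of W] by (rule nn_integral_cmult) simp
      qed
      also have "\<dots> \<le> ?w u * ennreal (4 * (1 - (cmod b)\<^sup>2) powr p / cmod u)"
      proof (cases "u \<in> unit_disc")
        case True
        then show ?thesis using elim b p by (intro mult_left_mono circle_mean_green_powr) auto
      qed simp
      also have "\<dots> = ennreal (4 * (1 - (cmod b)\<^sup>2) powr p)
          * (ennreal ((1 - cmod u) powr (-1/2) / cmod u) * indicator unit_disc u)"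
        by (simp add: indicator_def flip: ennreal_mult')
      finally show ?case .
    qed
  qed
  also have "\<dots> = ennreal (4 * (1 - (cmod b)\<^sup>2) powr p) * ennreal weight_mass"
    unfolding weight_mass[symmetric] by (rule nn_integral_cmult) measurable
  also have "\<dots> = ennreal (4 * weight_mass * (1 - (cmod b)\<^sup>2) powr p)"
    using weight_mass_nonneg by (simp add: mult_ac flip: ennreal_mult')
  finally show ?thesis .
qed


section \<open>A Moebius-invariant estimate\<close>

abbreviation kernel :: "complex \<Rightarrow> complex \<Rightarrow> real" where
  "kernel w z \<equiv> cmod (1 - cnj w * z)"

lemma kernel_commute: "kernel w z = kernel z w"
proof -
  have "1 - cnj w * z = cnj (1 - cnj z * w)" by simp
  then show ?thesis by (metis complex_mod_cnj)
qed

lemma kernel_ge: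
  assumes "cmod w < 1" "cmod z < 1"
  shows "1 - cmod w \<le> kernel w z" "1 - cmod z \<le> kernel w z" "0 < kernel w z" "1 - cmod w * cmod z \<le> kernel w z"
proof -
  have "1 - cmod (cnj w * z) \<le> kernel w z" using norm_triangle_ineq2[of 1 "cnj w * z"] by simp
  then show *: "1 - cmod w * cmod z \<le> kernel w z" by (simp add: norm_mult)
  have "cmod w * cmod z \<le> cmod w" "cmod w * cmod z \<le> cmod z"
    using assms by (simp_all add: mult_left_le mult_left_le_one_le)
  with * assms show "1 - cmod w \<le> kernel w z" "1 - cmod z \<le> kernel w z" "0 < kernel w z" by linarith+
qed

lemma kernel_le_2:
  assumes "cmod w < 1" "cmod z < 1" shows "kernel w z \<le> 2"
proof -
  have "kernel w z \<le> 1 + cmod (cnj w * z)" using norm_triangle_ineq4[of 1 "cnj w * z"] by simp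
  also have "cmod (cnj w * z) \<le> 1" using assms mult_mono[of "cmod w" 1 "cmod z" 1] by (simp add: norm_mult)
  finally show ?thesis by simp
qed

lemma kernel_perturb:
  assumes "cmod z \<le> 1" shows "kernel w z \<le> kernel v z + cmod (w - v)"
proof -
  have "1 - cnj w * z = (1 - cnj v * z) + cnj (v - w) * z" by (simp add: algebra_simps)
  then have "kernel w z \<le> kernel v z + cmod (cnj (v - w) * z)" by (metis norm_triangle_ineq)
  also have "cmod (cnj (v - w) * z) \<le> cmod (w - v)"
    using assms by (simp add: norm_mult norm_minus_commute mult_left_le flip: complex_cnj_diff)
  finally show ?thesis by simp
qed

lemma disc_aut_holomorphic: "cmod w < 1 \<Longrightarrow> disc_aut w holomorphic_on unit_disc"
  unfolding disc_aut_def using one_minus_mult_nonzero(1)[of "cnj w"]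
  by (intro holomorphic_intros) auto

lemma disc_aut_involution:
  assumes "cmod w < 1" "cmod u < 1" shows "disc_aut w (disc_aut w u) = u"
proof -
  have n: "1 - cnj w * u \<noteq> 0" "1 - cnj w * w \<noteq> 0"
    using one_minus_mult_nonzero(1)[of "cnj w"] assms by auto
  have "1 - cnj w * disc_aut w u = (1 - cnj w * w) / (1 - cnj w * u)"
    using n by (simp add: disc_aut_def divide_simps) (simp add: algebra_simps)
  moreover have "w - disc_aut w u = u * (1 - cnj w * w) / (1 - cnj w * u)"
    using n by (simp add: disc_aut_def divide_simps) (simp add: algebra_simps)
  ultimately show ?thesis using n unfolding disc_aut_def[of w "disc_aut w u"] by simp
qed

lemma disc_aut_bij:
  assumes w: "cmod w < 1"
  shows "inj_on (disc_aut w) unit_disc" "disc_aut w ` unit_disc = unit_disc"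
proof -
  show "inj_on (disc_aut w) unit_disc"
    using disc_aut_involution[OF w] by (metis inj_onI mem_ball_0)
  show "disc_aut w ` unit_disc = unit_disc"
  proof
    show "disc_aut w ` unit_disc \<subseteq> unit_disc" using disc_aut_cmod_less[OF w] by auto
    show "unit_disc \<subseteq> disc_aut w ` unit_disc"
    proof
      fix u assume "u \<in> unit_disc"
      then show "u \<in> disc_aut w ` unit_disc"
        using disc_aut_involution[OF w, of u] disc_aut_cmod_less[OF w, of u] by (intro image_eqI[of _ _ "disc_aut w u"]) auto
    qed
  qed
qed

lemma deriv_disc_aut:
  assumes "cmod w < 1" "cmod u < 1"
  shows "cmod (deriv (disc_aut w) u) = (1 - (cmod w)\<^sup>2) / (kernel w u)\<^sup>2"
proof -
  have n: "1 - cnj w * u \<noteq> 0" using one_minus_mult_nonzero(1)[of "cnj w"] assms by auto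
  have "((\<lambda>z. (w - z) / (1 - cnj w * z)) has_field_derivative
      (((- 1) * (1 - cnj w * u) - (w - u) * (- cnj w)) / ((1 - cnj w * u) * (1 - cnj w * u)))) (at u)"
    using n by (auto intro!: derivative_eq_intros)
  then have "deriv (disc_aut w) u = ((- 1) * (1 - cnj w * u) - (w - u) * (- cnj w)) / ((1 - cnj w * u) * (1 - cnj w * u))"
    unfolding disc_aut_def[abs_def] by (rule DERIV_imp_deriv)
  also have "(- 1) * (1 - cnj w * u) - (w - u) * (- cnj w) = - complex_of_real (1 - (cmod w)\<^sup>2)"
    by (simp add: algebra_simps complex_norm_square flip: of_real_power)
  finally show ?thesis using assms
    by (simp add: norm_divide norm_mult power2_eq_square abs_square_le_1 del: of_real_diff of_real_mult)
       (metis abs_of_nonneg diff_ge_0_iff_ge less_imp_le mult_le_one norm_ge_zero norm_of_real)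
qed

lemma green_disc_aut:
  assumes w: "cmod w < 1" and u: "cmod u < 1" and a: "cmod a < 1"
  shows "green (disc_aut w u) a = green u (disc_aut w a)"
proof -
  let ?b = "disc_aut w a"
  have b: "cmod ?b < 1" by (rule disc_aut_cmod_less[OF w a])
  have ab: "disc_aut w ?b = a" by (rule disc_aut_involution[OF w a])
  have n: "1 - cnj w * u \<noteq> 0" "1 - cnj w * ?b \<noteq> 0" "1 - w * cnj ?b \<noteq> 0" "1 - cnj w * w \<noteq> 0" "1 - cnj ?b * u \<noteq> 0"
    using one_minus_mult_nonzero(1)[of "cnj w"] one_minus_mult_nonzero(1)[of w "cnj ?b"]
      one_minus_mult_nonzero(1)[of "cnj ?b" u] w u b by auto
  have diff: "disc_aut w ?b - disc_aut w u = (u - ?b) * (1 - cnj w * w) / ((1 - cnj w * ?b) * (1 - cnj w * u))"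
    unfolding disc_aut_def[of w] using n by (simp add: divide_simps) (simp add: algebra_simps)
  have cn: "cnj (disc_aut w ?b) = (cnj w - cnj ?b) / (1 - w * cnj ?b)"
    unfolding disc_aut_def[of w ?b] by simp
  have den: "1 - cnj (disc_aut w ?b) * disc_aut w u
      = (1 - cnj w * w) * (1 - cnj ?b * u) / ((1 - w * cnj ?b) * (1 - cnj w * u))"
    unfolding cn disc_aut_def[of w u] using n by (simp add: divide_simps) (simp add: algebra_simps)
  have sw: "cmod (1 - w * cnj ?b) = cmod (1 - cnj w * ?b)"
    using complex_mod_cnj[of "1 - w * cnj ?b"] by simp
  have "cmod (disc_aut a (disc_aut w u)) = cmod (disc_aut ?b u)"
  proof -
    have "disc_aut a (disc_aut w u) = (disc_aut w ?b - disc_aut w u) / (1 - cnj (disc_aut w ?b) * disc_aut w u)"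
      by (simp add: ab disc_aut_def[of a])
    then show ?thesis
      unfolding diff den disc_aut_def[of ?b] using n sw
      by (simp add: norm_divide norm_mult norm_minus_commute)
  qed
  moreover have "disc_aut w u = a \<longleftrightarrow> u = ?b"
    using disc_aut_involution[OF w u] ab by metis
  ultimately show ?thesis by (simp add: green_def)
qed

text \<open>The substitution \<open>z = \<sigma>\<^sub>w(u)\<close> absorbs the kernel \<open>|1 - w\<^sup>* z|\<^sup>-\<^sup>4\<close>, which is why the fourth power is used
  throughout, and moves the pole of the Green function to \<open>\<sigma>\<^sub>w(a)\<close>.\<close>

lemma nn_integral_kernel_green:
  assumes p: "0 < p" "p \<le> 1" and w: "cmod w < 1" and a: "cmod a < 1"
  shows "(\<integral>\<^sup>+z\<in>unit_disc. (ennreal ((1 - cmod z) powr (-1/2) / kernel w z ^ 4) * enn_powr (green z a) p) \<partial>lborel)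
    \<le> ennreal (48 * weight_mass * (1 - cmod w) powr (-5/2) * ((1 - cmod a) * (1 - cmod w) / (kernel a w)\<^sup>2) powr p)"
proof -
  let ?b = "disc_aut w a"
  have b: "cmod ?b < 1" by (rule disc_aut_cmod_less[OF w a])
  let ?h = "\<lambda>z. ennreal ((1 - cmod z) powr (-1/2) / kernel w z ^ 4) * enn_powr (green z a) p"
  have W: "0 < 1 - (cmod w)\<^sup>2" "1 - cmod w \<le> 1 - (cmod w)\<^sup>2"
    using w abs_square_less_1[of "cmod w"] by (simp_all add: power2_eq_square mult_left_le)
  have pt: "?h (disc_aut w u) * ennreal ((cmod (deriv (disc_aut w) u))\<^sup>2)
      \<le> ennreal (3 * (1 - cmod w) powr (-5/2)) * (ennreal ((1 - cmod u) powr (-1/2)) * enn_powr (green u ?b) p)"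
    if u: "cmod u < 1" for u
  proof -
    have K: "0 < kernel w u" "kernel w u \<le> 2" using kernel_ge[OF w u] kernel_le_2[OF w u] by auto
    have n: "1 - cnj w * u \<noteq> 0" using K by auto
    let ?v = "disc_aut w u"
    have v: "cmod ?v < 1" by (rule disc_aut_cmod_less[OF w u])
    have "1 - cnj w * ?v = (1 - cnj w * w) / (1 - cnj w * u)"
      using n by (simp add: disc_aut_def divide_simps) (simp add: algebra_simps)
    also have "1 - cnj w * w = complex_of_real (1 - (cmod w)\<^sup>2)"
      by (simp add: mult.commute flip: complex_norm_square)
    finally have kv: "kernel w ?v = (1 - (cmod w)\<^sup>2) / kernel w u"
      using W(1) by (simp add: norm_divide del: of_real_diff)
    have "(1 - cmod w) * (1 - cmod u) / 8 \<le> 1 - cmod ?v"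
    proof -
      have "(1 - cmod w) * (1 - cmod u) / 8 = (1 - cmod w) * (1 - cmod u) / 4 / 2" by simp
      also have "\<dots> \<le> (1 - (cmod w)\<^sup>2) * (1 - (cmod u)\<^sup>2) / (kernel w u)\<^sup>2 / 2"
      proof (intro divide_right_mono frac_le mult_mono)
        show "(kernel w u)\<^sup>2 \<le> 4" using power_mono[OF K(2), of 2] by simp
        show "1 - cmod u \<le> 1 - (cmod u)\<^sup>2" using u by (simp add: power2_eq_square mult_left_le)
      qed (use W w u K in \<open>auto simp: abs_square_le_1\<close>)
      also have "\<dots> = (1 - (cmod ?v)\<^sup>2) / 2" by (simp add: disc_aut_cmod[OF w u])
      also have "\<dots> = (1 - cmod ?v) * (1 + cmod ?v) / 2" by (simp add: power2_eq_square algebra_simps)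
      also have "\<dots> \<le> (1 - cmod ?v) * 2 / 2" using v by (intro divide_right_mono mult_left_mono) auto
      also have "\<dots> = 1 - cmod ?v" by simp
      finally show ?thesis .
    qed
    then have "(1 - cmod ?v) powr (-1/2) \<le> ((1 - cmod w) * (1 - cmod u) / 8) powr (-1/2)"
      using w u by (intro powr_mono2') auto
    also have "\<dots> = 8 powr (1/2) * ((1 - cmod w) powr (-1/2) * (1 - cmod u) powr (-1/2))"
    proof -
      have "(A * B / 8) powr (-1/2) = 8 powr (1/2) * (A powr (-1/2) * B powr (-1/2))" if "0 < A" "0 < B" for A B :: real
        using that by (simp add: powr_mult powr_divide powr_minus field_simps)
      then show ?thesis using w u by simp
    qed
    also have "\<dots> \<le> 3 * ((1 - cmod w) powr (-1/2) * (1 - cmod u) powr (-1/2))"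
      by (intro mult_right_mono) (auto simp: powr_half_sqrt intro!: real_le_lsqrt)
    finally have A: "(1 - cmod ?v) powr (-1/2) \<le> 3 * ((1 - cmod w) powr (-1/2) * (1 - cmod u) powr (-1/2))" .
    have B: "(cmod (deriv (disc_aut w) u))\<^sup>2 / kernel w ?v ^ 4 \<le> (1 - cmod w) powr (-2)"
    proof -
      have "(cmod (deriv (disc_aut w) u))\<^sup>2 / kernel w ?v ^ 4 = 1 / (1 - (cmod w)\<^sup>2)\<^sup>2"
        unfolding kv deriv_disc_aut[OF w u] using W K
        by (simp add: power_divide field_simps flip: power_mult power_add)
      also have "\<dots> \<le> 1 / (1 - cmod w)\<^sup>2"
        using W w by (intro divide_left_mono power_mono) auto
      also have "\<dots> = (1 - cmod w) powr (-2)" using w by (simp add: powr_minus_divide)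
      finally show ?thesis .
    qed
    have "(1 - cmod ?v) powr (-1/2) / kernel w ?v ^ 4 * (cmod (deriv (disc_aut w) u))\<^sup>2
        = (1 - cmod ?v) powr (-1/2) * ((cmod (deriv (disc_aut w) u))\<^sup>2 / kernel w ?v ^ 4)" by simp
    also have "\<dots> \<le> 3 * ((1 - cmod w) powr (-1/2) * (1 - cmod u) powr (-1/2)) * (1 - cmod w) powr (-2)"
      using A B by (intro mult_mono) auto
    also have "\<dots> = 3 * ((1 - cmod w) powr (-2) * (1 - cmod w) powr (-1/2)) * (1 - cmod u) powr (-1/2)"
      by (simp add: mult_ac)
    also have "(1 - cmod w) powr (-2) * (1 - cmod w) powr (-1/2) = (1 - cmod w) powr (-5/2)"
      by (simp flip: powr_add)
    finally have fin: "(1 - cmod ?v) powr (-1/2) / kernel w ?v ^ 4 * (cmod (deriv (disc_aut w) u))\<^sup>2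
      \<le> 3 * (1 - cmod w) powr (-5/2) * (1 - cmod u) powr (-1/2)" .
    have "?h ?v * ennreal ((cmod (deriv (disc_aut w) u))\<^sup>2)
        = ennreal ((1 - cmod ?v) powr (-1/2) / kernel w ?v ^ 4 * (cmod (deriv (disc_aut w) u))\<^sup>2) * enn_powr (green u ?b) p"
      unfolding green_disc_aut[OF w u a] by (subst ennreal_mult) (auto simp: mult_ac)
    also have "\<dots> \<le> ennreal (3 * (1 - cmod w) powr (-5/2) * (1 - cmod u) powr (-1/2)) * enn_powr (green u ?b) p"
      using fin by (intro mult_right_mono ennreal_leI) auto
    also have "\<dots> = ennreal (3 * (1 - cmod w) powr (-5/2)) * (ennreal ((1 - cmod u) powr (-1/2)) * enn_powr (green u ?b) p)"
      by (subst ennreal_mult) (auto simp: mult_ac)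
    finally show ?thesis .
  qed
  have "(\<integral>\<^sup>+z\<in>unit_disc. ?h z \<partial>lborel) = (\<integral>\<^sup>+z\<in>disc_aut w ` unit_disc. ?h z \<partial>lborel)"
    by (simp only: disc_aut_bij(2)[OF w])
  also have "\<dots> = (\<integral>\<^sup>+u\<in>unit_disc. (?h (disc_aut w u) * ennreal ((cmod (deriv (disc_aut w) u))\<^sup>2)) \<partial>lborel)"
    by (rule nn_integral_inj_holomorphic[OF disc_aut_holomorphic[OF w] open_ball disc_aut_bij(1)[OF w], symmetric]) measurable
  also have "\<dots> \<le> (\<integral>\<^sup>+u. ennreal (3 * (1 - cmod w) powr (-5/2))
      * (ennreal ((1 - cmod u) powr (-1/2)) * enn_powr (green u ?b) p * indicator unit_disc u) \<partial>lborel)"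
    using pt by (intro nn_integral_mono) (auto simp: indicator_def)
  also have "\<dots> = ennreal (3 * (1 - cmod w) powr (-5/2))
      * (\<integral>\<^sup>+u\<in>unit_disc. (ennreal ((1 - cmod u) powr (-1/2)) * enn_powr (green u ?b) p) \<partial>lborel)"
    by (rule nn_integral_cmult) measurable
  also have "\<dots> \<le> ennreal (3 * (1 - cmod w) powr (-5/2)) * ennreal (4 * weight_mass * (1 - (cmod ?b)\<^sup>2) powr p)"
    by (intro mult_left_mono nn_integral_weighted_green p b) simp
  also have "\<dots> = ennreal (12 * weight_mass * (1 - cmod w) powr (-5/2) * (1 - (cmod ?b)\<^sup>2) powr p)"
    using weight_mass_nonneg by (simp add: mult_ac flip: ennreal_mult')
  also have "\<dots> \<le> ennreal (12 * weight_mass * (1 - cmod w) powr (-5/2) * (4 * ((1 - cmod a) * (1 - cmod w) / (kernel a w)\<^sup>2) powr p))"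
  proof (intro ennreal_leI mult_left_mono)
    have two: "1 - x\<^sup>2 \<le> 2 * (1 - x)" for x :: real using zero_le_power2[of "1 - x"] by (simp add: power2_eq_square algebra_simps)
    have "1 - (cmod ?b)\<^sup>2 = (1 - (cmod w)\<^sup>2) * (1 - (cmod a)\<^sup>2) / (kernel w a)\<^sup>2" by (rule disc_aut_cmod[OF w a])
    also have "\<dots> \<le> (2 * (1 - cmod w)) * (2 * (1 - cmod a)) / (kernel w a)\<^sup>2"
      using two w a W by (intro divide_right_mono mult_mono) (auto simp: abs_square_le_1)
    also have "\<dots> = 4 * ((1 - cmod a) * (1 - cmod w) / (kernel a w)\<^sup>2)"
      unfolding kernel_commute[of w a] by (simp add: algebra_simps)
    finally have "(1 - (cmod ?b)\<^sup>2) powr p \<le> (4 * ((1 - cmod a) * (1 - cmod w) / (kernel a w)\<^sup>2)) powr p"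
      using b p by (intro powr_mono2) (auto simp: abs_square_le_1)
    also have "\<dots> = 4 powr p * ((1 - cmod a) * (1 - cmod w) / (kernel a w)\<^sup>2) powr p"
      by (rule powr_mult)
    also have "\<dots> \<le> 4 * ((1 - cmod a) * (1 - cmod w) / (kernel a w)\<^sup>2) powr p"
      using powr_mono[of p 1 4] p by (intro mult_right_mono) auto
    finally show "(1 - (cmod ?b)\<^sup>2) powr p \<le> 4 * ((1 - cmod a) * (1 - cmod w) / (kernel a w)\<^sup>2) powr p" .
  qed (use weight_mass_nonneg in auto)
  finally show ?thesis by (simp add: mult_ac)
qed


section \<open>Dyadic arcs\<close>

lemma cis_diff_le: "cmod (cis s - cis t) \<le> \<bar>s - t\<bar>"
proof -
  have "cis s - cis t = cis t * (cis (s - t) - 1)" by (simp add: algebra_simps cis_mult)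
  then have "cmod (cis s - cis t) = cmod (cis (s - t) - 1)" by (simp add: norm_mult)
  also have "cmod (cis (s - t) - 1) = 2 * \<bar>sin ((s - t) / 2)\<bar>"
    unfolding cis_conv_exp by (metis dist_exp_i_1 dist_norm)
  also have "\<dots> \<le> 2 * \<bar>(s - t) / 2\<bar>" by (intro mult_left_mono abs_sin_le_one abs_sin_x_le_abs_x) auto
  finally show ?thesis by simp
qed

lemma borel_half_open_arc:
  assumes "half_open_arc I" shows "I \<in> sets borel"
proof -
  obtain \<alpha> \<beta> where "I = cis ` {\<alpha>..<\<beta>} \<or> I = cis ` {\<alpha><..\<beta>}"
    using assms unfolding half_open_arc_def by auto
  moreover have "cis ` {\<alpha>..<\<beta>} \<in> sets borel"
  proof -
    have "{\<alpha>..<\<beta>} = (\<Union>n. {\<alpha>..\<beta> - 1 / real (Suc n)})"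
    proof (intro subset_antisym subsetI)
      fix t assume "t \<in> {\<alpha>..<\<beta>}"
      then obtain n where "1 / real (Suc n) < \<beta> - t"
        using nat_approx_posE[of "\<beta> - t"] by (auto simp: inverse_eq_divide)
      then show "t \<in> (\<Union>n. {\<alpha>..\<beta> - 1 / real (Suc n)})" using \<open>t \<in> _\<close> by (intro UN_I[of n]) auto
    next
      fix t assume "t \<in> (\<Union>n. {\<alpha>..\<beta> - 1 / real (Suc n)})"
      then obtain n where "\<alpha> \<le> t" "t \<le> \<beta> - 1 / real (Suc n)" by auto
      moreover have "1 / real (Suc n) > 0" by simp
      ultimately have "t < \<beta>" by linarith
      then show "t \<in> {\<alpha>..<\<beta>}" using \<open>\<alpha> \<le> t\<close> by simp
    qed
    then have "cis ` {\<alpha>..<\<beta>} = (\<Union>n. cis ` {\<alpha>..\<beta> - 1 / real (Suc n)})" by (simp only: image_UN)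
    moreover have "cis ` {\<alpha>..\<beta> - 1 / real (Suc n)} \<in> sets borel" for n
      by (intro borel_closed compact_imp_closed compact_continuous_image continuous_intros) auto
    ultimately show ?thesis by auto
  qed
  moreover have "cis ` {\<alpha><..\<beta>} \<in> sets borel"
  proof -
    have "{\<alpha><..\<beta>} = (\<Union>n. {\<alpha> + 1 / real (Suc n)..\<beta>})"
    proof (intro subset_antisym subsetI)
      fix t assume "t \<in> {\<alpha><..\<beta>}"
      then obtain n where "1 / real (Suc n) < t - \<alpha>"
        using nat_approx_posE[of "t - \<alpha>"] by (auto simp: inverse_eq_divide)
      then show "t \<in> (\<Union>n. {\<alpha> + 1 / real (Suc n)..\<beta>})" using \<open>t \<in> _\<close> by (intro UN_I[of n]) auto
    next
      fix t assume "t \<in> (\<Union>n. {\<alpha> + 1 / real (Suc n)..\<beta>})"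
      then obtain n where "t \<le> \<beta>" "\<alpha> + 1 / real (Suc n) \<le> t" by auto
      moreover have "1 / real (Suc n) > 0" by simp
      ultimately have "\<alpha> < t" by linarith
      then show "t \<in> {\<alpha><..\<beta>}" using \<open>t \<le> \<beta>\<close> by simp
    qed
    then have "cis ` {\<alpha><..\<beta>} = (\<Union>n. cis ` {\<alpha> + 1 / real (Suc n)..\<beta>})" by (simp only: image_UN)
    moreover have "cis ` {\<alpha> + 1 / real (Suc n)..\<beta>} \<in> sets borel" for n
      by (intro borel_closed compact_imp_closed compact_continuous_image continuous_intros) auto
    ultimately show ?thesis by auto
  qed
  ultimately show ?thesis by auto
qed

text \<open>The parameter set whose Lebesgue measure is the normalized arc length.\<close>

definition arc_params :: "complex set \<Rightarrow> real set" where
  "arc_params I = {t \<in> {0..<1}. cis (2 * pi * t) \<in> I}"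

lemma arc_params_borel: "I \<in> sets borel \<Longrightarrow> arc_params I \<in> sets borel"
proof -
  assume I: "I \<in> sets borel"
  have [measurable]: "(\<lambda>t::real. cis (2 * pi * t)) \<in> borel_measurable borel"
    by (intro borel_measurable_continuous_onI continuous_intros)
  have "(\<lambda>t::real. cis (2 * pi * t)) -` I \<inter> {0..<1} \<in> sets borel"
    using measurable_sets[OF \<open>(\<lambda>t::real. cis (2 * pi * t)) \<in> borel_measurable borel\<close> I] by auto
  then show ?thesis by (simp add: arc_params_def vimage_def Int_def conj_commute)
qed

lemma emeasure_arc_params:
  assumes "I \<in> sets borel" shows "emeasure lborel (arc_params I) = ennreal (arc_length I)"
proof -
  have "emeasure lborel (arc_params I) \<le> emeasure lborel {0..<1::real}"
    using arc_params_borel[OF assms] by (intro emeasure_mono) (auto simp: arc_params_def)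
  also have "\<dots> < top" by simp
  finally have "emeasure lborel (arc_params I) \<noteq> top" by simp
  then show ?thesis unfolding arc_length_def arc_params_def[symmetric]
    by (rule emeasure_eq_ennreal_measure)
qed

text \<open>Normalized arc length is measured with parameters in one fixed period, so that an arc crossing the
  base point is cut in two; the open parameter interval makes the bound apply to both half-open orientations.\<close>

lemma arc_width_le:
  assumes ab: "\<alpha> < \<beta>" "\<beta> \<le> \<alpha> + 2 * pi" and sub: "cis ` {\<alpha><..<\<beta>} \<subseteq> I" and I: "I \<in> sets borel"
  shows "\<beta> - \<alpha> \<le> 2 * pi * arc_length I"
proof -
  define n where "n = \<lfloor>\<alpha> / (2 * pi)\<rfloor>"
  define a where "a = \<alpha> / (2 * pi) - n"
  define b where "b = \<beta> / (2 * pi) - n"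
  have a: "0 \<le> a" "a < 1" unfolding a_def n_def by linarith+
  have b: "a < b" "b \<le> a + 1" using ab by (auto simp: a_def b_def field_simps)
  have mem: "cis (2 * pi * t) \<in> I" if "a < t + of_int m" "t + of_int m < b" for t :: real and m :: int
  proof -
    have "2 * pi * (t + of_int m + of_int n) \<in> {\<alpha><..<\<beta>}"
      using that by (auto simp: a_def b_def field_simps)
    then have "cis (2 * pi * (t + of_int m + of_int n)) \<in> I" using sub by blast
    moreover have "cis (2 * pi * (t + of_int m + of_int n)) = cis (2 * pi * t) * cis (2 * pi * of_int (m + n))"
      by (simp add: cis_mult algebra_simps)
    moreover have "cis (2 * pi * of_int (m + n)) = 1" by (rule cis_multiple_2pi) simp
    ultimately show ?thesis by simp
  qed
  have "{a<..<min b 1} \<union> {0..<b - 1} \<subseteq> arc_params I"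
  proof
    fix t assume "t \<in> {a<..<min b 1} \<union> {0..<b - 1}"
    then consider "a < t" "t < b" "t < 1" | "0 \<le> t" "t < b - 1" by auto
    then show "t \<in> arc_params I"
    proof cases
      case 1 then show ?thesis using mem[of t 0] a by (auto simp: arc_params_def)
    next
      case 2 then show ?thesis using mem[of t 1] a b by (auto simp: arc_params_def)
    qed
  qed
  then have "emeasure lborel ({a<..<min b 1} \<union> {0..<b - 1}) \<le> emeasure lborel (arc_params I)"
    using arc_params_borel[OF I] by (intro emeasure_mono) auto
  moreover have "emeasure lborel ({a<..<min b 1} \<union> {0..<b - 1}) = ennreal (min b 1 - a) + ennreal (max 0 (b - 1))"
    using a b by (subst plus_emeasure[symmetric]) (auto simp: max_def)
  moreover have "\<dots> = ennreal (b - a)"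
    using a b by (subst ennreal_plus[symmetric]) (auto simp: min_def max_def simp del: ennreal_plus)
  ultimately have "ennreal (b - a) \<le> ennreal (arc_length I)" by (simp add: emeasure_arc_params[OF I])
  then have "b - a \<le> arc_length I" by (subst (asm) ennreal_le_iff) (auto simp: arc_length_def)
  then show ?thesis by (simp add: a_def b_def field_simps)
qed

lemma half_open_arc_diameter:
  assumes "half_open_arc I" "v \<in> I" "w \<in> I"
  shows "cmod (v - w) \<le> 8 * arc_length I"
proof -
  obtain \<alpha> \<beta> where ab: "\<alpha> < \<beta>" "\<beta> \<le> \<alpha> + 2 * pi" and I: "I = cis ` {\<alpha>..<\<beta>} \<or> I = cis ` {\<alpha><..\<beta>}"
    using assms(1) unfolding half_open_arc_def by auto
  have "cis ` {\<alpha><..<\<beta>} \<subseteq> I" using I by auto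
  then have le: "\<beta> - \<alpha> \<le> 2 * pi * arc_length I" by (rule arc_width_le[OF ab _ borel_half_open_arc[OF assms(1)]])
  obtain s t where "v = cis s" "w = cis t" "s \<in> {\<alpha>..\<beta>}" "t \<in> {\<alpha>..\<beta>}"
    using I assms(2,3) by fastforce
  then have "cmod (v - w) \<le> \<beta> - \<alpha>" using cis_diff_le[of s t] by auto
  also note le
  also have "2 * pi * arc_length I \<le> 8 * arc_length I"
  proof (rule mult_right_mono)
    show "2 * pi \<le> 8" using pi_less_4 by linarith
  qed (simp add: arc_length_def)
  finally show ?thesis .
qed

lemma half_open_arc_nonempty: "half_open_arc I \<Longrightarrow> I \<noteq> {}"
  unfolding half_open_arc_def by auto

lemma half_open_arc_subset: "half_open_arc I \<Longrightarrow> I \<subseteq> unit_circle"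
  unfolding half_open_arc_def by auto

definition arc_point :: "complex set \<Rightarrow> complex" where
  "arc_point I = (SOME w. w \<in> I)"

text \<open>The point \<open>z\<^sub>I\<close> at height \<open>|I| / 2\<close> over \<open>I\<close>.\<close>

definition box_center :: "complex set \<Rightarrow> complex" where
  "box_center I = of_real (1 - arc_length I / 2) * arc_point I"

text \<open>A dyadic system with its generations exhibited.\<close>

locale dyadic_tree =
  fixes level :: "nat \<Rightarrow> complex set set"
  assumes level_0: "level 0 = {unit_circle}"
    and level_partition: "\<And>k. partition_on unit_circle (level k)"
    and level_card: "\<And>k. card (level k) = 2 ^ k"
    and level_arc: "\<And>k I. I \<in> level k \<Longrightarrow> half_open_arc I"
    and level_length: "\<And>k I. I \<in> level k \<Longrightarrow> arc_length I = 1 / 2 ^ k"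
    and level_parent: "\<And>k I. I \<in> level (Suc k) \<Longrightarrow> \<exists>J\<in>level k. I \<subseteq> J"
begin

definition arcs :: "complex set set" where "arcs = (\<Union>k. level k)"

lemma level_in_arcs: "I \<in> level k \<Longrightarrow> I \<in> arcs"
  by (auto simp: arcs_def)

lemma finite_level: "finite (level k)"
  using level_card[of k] by (intro card_ge_0_finite) simp

lemma countable_arcs: "countable arcs"
  unfolding arcs_def by (rule countable_UN) (simp_all add: countable_finite finite_level)

lemma arcs_arc: "I \<in> arcs \<Longrightarrow> half_open_arc I"
  by (auto simp: arcs_def level_arc)

lemma arcs_borel: "I \<in> arcs \<Longrightarrow> I \<in> sets borel"
  by (intro borel_half_open_arc arcs_arc)

lemma arcs_nonempty: "I \<in> arcs \<Longrightarrow> I \<noteq> {}"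
  by (intro half_open_arc_nonempty arcs_arc)

lemma arcs_length:
  assumes "I \<in> arcs" shows "0 < arc_length I" "arc_length I \<le> 1"
  using assms by (auto simp: arcs_def level_length divide_le_eq)

lemma level_unique: "I \<in> level j \<Longrightarrow> I \<in> level k \<Longrightarrow> j = k"
  using level_length[of I j] level_length[of I k] by simp

lemma level_disjoint_arcs: "I \<in> level k \<Longrightarrow> J \<in> level k \<Longrightarrow> I \<noteq> J \<Longrightarrow> I \<inter> J = {}"
  using level_partition[of k] by (auto simp: partition_on_def disjoint_def)

lemma level_cover: "w \<in> unit_circle \<Longrightarrow> \<exists>I\<in>level k. w \<in> I"
  using level_partition[of k] by (auto simp: partition_on_def)

lemma level_ancestor:
  assumes "I \<in> level k" "j \<le> k" shows "\<exists>J\<in>level j. I \<subseteq> J"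
  using assms(2,1)
proof (induction k arbitrary: I rule: dec_induct)
  case base then show ?case by auto
next
  case (step n)
  then obtain J where "J \<in> level n" "I \<subseteq> J" using level_parent by blast
  then show ?case using step.IH by (meson order_trans)
qed

lemma level_nested:
  assumes "I \<in> level k" "J \<in> level j" "j \<le> k" shows "I \<subseteq> J \<or> I \<inter> J = {}"
proof -
  obtain J' where "J' \<in> level j" "I \<subseteq> J'" using level_ancestor[OF assms(1,3)] by blast
  then show ?thesis using level_disjoint_arcs[OF assms(2), of J'] by (cases "J' = J") auto
qed

lemma arcs_nested: "I \<in> arcs \<Longrightarrow> J \<in> arcs \<Longrightarrow> I \<subseteq> J \<or> J \<subseteq> I \<or> I \<inter> J = {}"
  unfolding arcs_def by (metis UN_E level_nested nat_le_linear inf_commute)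

lemma level_mono:
  assumes "I \<in> level k" "J \<in> level j" "I \<subseteq> J" shows "j \<le> k"
proof (rule ccontr)
  assume "\<not> j \<le> k"
  then have "J \<subseteq> I \<or> J \<inter> I = {}" using level_nested[OF assms(2,1)] by simp
  then have "I = J" using assms arcs_nonempty[OF level_in_arcs[OF assms(1)]] by auto
  then show False using level_unique assms \<open>\<not> j \<le> k\<close> by auto
qed

lemma arc_length_mono:
  assumes "I \<in> arcs" "J \<in> arcs" "I \<subseteq> J" shows "arc_length I \<le> arc_length J"
proof -
  obtain j k where jk: "I \<in> level k" "J \<in> level j" using assms by (auto simp: arcs_def)
  then have "j \<le> k" using assms(3) level_mono by blast
  then show ?thesis using jk by (simp add: level_length frac_le power_increasing)
qed

lemma finite_ancestors: "I \<in> arcs \<Longrightarrow> finite {J \<in> arcs. I \<subseteq> J}"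
proof -
  assume "I \<in> arcs"
  then obtain k where k: "I \<in> level k" by (auto simp: arcs_def)
  have "{J \<in> arcs. I \<subseteq> J} \<subseteq> (\<Union>j\<le>k. level j)"
    using level_mono[OF k] by (auto simp: arcs_def)
  then show ?thesis by (rule finite_subset) (auto simp: finite_level)
qed

lemma arc_point_in: "I \<in> arcs \<Longrightarrow> arc_point I \<in> I"
  unfolding arc_point_def using arcs_nonempty by (metis ex_in_conv someI_ex)

lemma cmod_arc_point: "I \<in> arcs \<Longrightarrow> cmod (arc_point I) = 1"
  using arc_point_in half_open_arc_subset[OF arcs_arc] by fastforce

lemma cmod_box_center: "I \<in> arcs \<Longrightarrow> cmod (box_center I) = 1 - arc_length I / 2"
  using arcs_length[of I] cmod_arc_point[of I]
  by (simp add: box_center_def norm_mult del: of_real_diff)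

lemma box_center_in_disc: "I \<in> arcs \<Longrightarrow> cmod (box_center I) < 1"
  using arcs_length[of I] by (simp add: cmod_box_center)

text \<open>This applies to the centers over the arcs inside \<open>J\<close> as well as to the points of the box over \<open>J\<close>.\<close>

lemma box_center_dist:
  assumes "J \<in> arcs" "w \<in> J" "0 \<le> t" "t \<le> arc_length J"
  shows "cmod (of_real (1 - t) * w - box_center J) \<le> 10 * arc_length J"
proof -
  have w: "cmod w = 1" using half_open_arc_subset[OF arcs_arc[OF assms(1)]] assms(2) by auto
  have "of_real (1 - t) * w - box_center J
      = (w - arc_point J) + (of_real (arc_length J / 2) * arc_point J - of_real t * w)"
    by (simp add: box_center_def algebra_simps)
  then have "cmod (of_real (1 - t) * w - box_center J)
    \<le> cmod (w - arc_point J) + (cmod (of_real (arc_length J / 2) * arc_point J) + cmod (of_real t * w))"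
    using norm_triangle_ineq[of "w - arc_point J" "of_real (arc_length J / 2) * arc_point J - of_real t * w"]
      norm_triangle_ineq4[of "of_real (arc_length J / 2) * arc_point J" "of_real t * w"] by (simp only:)
  moreover have "cmod (of_real (arc_length J / 2) * arc_point J) = arc_length J / 2"
    using cmod_arc_point[OF assms(1)] arcs_length[OF assms(1)] by (simp add: norm_mult)
  moreover have "cmod (of_real t * w) = t" using w assms(3) by (simp add: norm_mult)
  moreover have "cmod (w - arc_point J) \<le> 8 * arc_length J"
    using assms by (intro half_open_arc_diameter arcs_arc arc_point_in)
  ultimately show ?thesis using assms arcs_length[OF assms(1)] by linarith
qed

lemma box_center_dist_arcs:
  assumes "I \<in> arcs" "J \<in> arcs" "I \<subseteq> J"
  shows "cmod (box_center I - box_center J) \<le> 10 * arc_length J"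
  unfolding box_center_def[of I]
  using assms arc_point_in[OF assms(1)] arcs_length[OF assms(1)] arc_length_mono[OF assms]
  by (intro box_center_dist) auto

lemma kernel_box_center:
  assumes "I \<in> arcs" "cmod z < 1"
  shows "arc_length I / 2 \<le> kernel (box_center I) z" "0 < kernel (box_center I) z"
  using kernel_ge[OF box_center_in_disc[OF assms(1)] assms(2)] cmod_box_center[OF assms(1)] by auto

text \<open>On each level the sum is a Riemann sum of the Poisson kernel.\<close>

lemma level_kernel_sum:
  assumes z: "cmod z < 1"
  shows "(\<Sum>I\<in>level k. (1 / 2 ^ k) / (kernel (box_center I) z)\<^sup>2) \<le> 289 / (1 - (1 - 1 / 2 ^ k / 2) * cmod z)"
proof -
  define l :: real where "l = 1 / 2 ^ k"
  have l: "0 < l" "l \<le> 1" by (auto simp: l_def divide_le_eq)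
  define c where "c = of_real (1 - l / 2) * cnj z"
  let ?e = "\<lambda>t::real. cis (2 * pi * t)"
  have [measurable]: "?e \<in> borel_measurable borel"
    by (intro borel_measurable_continuous_onI continuous_intros)
  have cmodc: "cmod c = (1 - l / 2) * cmod z" using l by (simp add: c_def norm_mult del: of_real_diff)
  have cz: "cmod c \<le> cmod z" unfolding cmodc using l by (intro mult_left_le_one_le) auto
  have c1: "cmod c < 1" using cz z by simp
  have kc: "cmod (1 - c * ?e t) = kernel (of_real (1 - l / 2) * ?e t) z" for t
  proof -
    have "1 - c * ?e t = cnj (1 - cnj (of_real (1 - l / 2) * ?e t) * z)"
      by (simp add: c_def mult_ac)
    then show ?thesis by (metis complex_mod_cnj)
  qed
  have one: "ennreal (l / (kernel (box_center I) z)\<^sup>2)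
      \<le> (\<integral>\<^sup>+t\<in>arc_params I. ennreal (289 / (cmod (1 - c * ?e t))\<^sup>2) \<partial>lborel)" if I: "I \<in> level k" for I
  proof -
    have Ia: "I \<in> arcs" using I by (rule level_in_arcs)
    have len: "arc_length I = l" using level_length[OF I] by (simp add: l_def)
    let ?K = "kernel (box_center I) z"
    have K: "l / 2 \<le> ?K" "0 < ?K" using kernel_box_center[OF Ia z] len by auto
    have "ennreal (1 / ?K\<^sup>2) \<le> ennreal (289 / (cmod (1 - c * ?e t))\<^sup>2)" if t: "t \<in> arc_params I" for t
    proof (rule ennreal_leI)
      have "cmod (1 - c * ?e t) \<le> ?K + cmod (of_real (1 - l / 2) * ?e t - box_center I)"
        unfolding kc using z by (intro kernel_perturb) simp
      also have "of_real (1 - l / 2) * ?e t - box_center I = of_real (1 - l / 2) * (?e t - arc_point I)"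
        by (simp add: box_center_def len algebra_simps)
      also have "cmod \<dots> \<le> 1 * cmod (?e t - arc_point I)"
        using l by (simp only: norm_mult norm_of_real) (intro mult_right_mono, auto)
      also have "cmod (?e t - arc_point I) \<le> 8 * l"
        using half_open_arc_diameter[OF arcs_arc[OF Ia] _ arc_point_in[OF Ia], of "?e t"] t len
        by (simp add: arc_params_def)
      finally have "cmod (1 - c * ?e t) \<le> 17 * ?K" using K by simp
      then have "(cmod (1 - c * ?e t))\<^sup>2 \<le> (17 * ?K)\<^sup>2" by (intro power_mono) auto
      moreover have "0 < cmod (1 - c * ?e t)" using one_minus_mult_nonzero(1)[OF c1, of "?e t"] by simp
      ultimately show "1 / ?K\<^sup>2 \<le> 289 / (cmod (1 - c * ?e t))\<^sup>2"
        using K by (simp add: field_simps power_mult_distrib)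
    qed
    then have "(\<integral>\<^sup>+t\<in>arc_params I. ennreal (1 / ?K\<^sup>2) \<partial>lborel)
        \<le> (\<integral>\<^sup>+t\<in>arc_params I. ennreal (289 / (cmod (1 - c * ?e t))\<^sup>2) \<partial>lborel)"
      by (intro nn_integral_mono) (auto simp: indicator_def)
    moreover have "(\<integral>\<^sup>+t\<in>arc_params I. ennreal (1 / ?K\<^sup>2) \<partial>lborel) = ennreal (l / ?K\<^sup>2)"
      using l arcs_borel[OF Ia]
      by (simp add: nn_integral_cmult_indicator arc_params_borel emeasure_arc_params len flip: ennreal_mult')
    ultimately show ?thesis by simp
  qed
  have "ennreal (\<Sum>I\<in>level k. l / (kernel (box_center I) z)\<^sup>2)
      = (\<Sum>I\<in>level k. ennreal (l / (kernel (box_center I) z)\<^sup>2))"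
    using l by (intro sum_ennreal[symmetric]) auto
  also have "\<dots> \<le> (\<Sum>I\<in>level k. \<integral>\<^sup>+t\<in>arc_params I. ennreal (289 / (cmod (1 - c * ?e t))\<^sup>2) \<partial>lborel)"
    by (intro sum_mono one)
  also have "\<dots> = (\<integral>\<^sup>+t. (\<Sum>I\<in>level k. ennreal (289 / (cmod (1 - c * ?e t))\<^sup>2) * indicator (arc_params I) t) \<partial>lborel)"
  proof (rule nn_integral_sum[symmetric])
    fix I assume "I \<in> level k"
    then have [measurable]: "arc_params I \<in> sets borel" by (intro arc_params_borel arcs_borel level_in_arcs)
    show "(\<lambda>t. ennreal (289 / (cmod (1 - c * ?e t))\<^sup>2) * indicator (arc_params I) t) \<in> borel_measurable lborel"
      by measurable
  qed
  also have "\<dots> \<le> (\<integral>\<^sup>+t. ennreal 289 * (ennreal (1 / (cmod (1 - c * ?e t))\<^sup>2) * indicator {0..1} t) \<partial>lborel)"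
  proof (rule nn_integral_mono)
    fix t :: real
    show "(\<Sum>I\<in>level k. ennreal (289 / (cmod (1 - c * ?e t))\<^sup>2) * indicator (arc_params I) t)
      \<le> ennreal 289 * (ennreal (1 / (cmod (1 - c * ?e t))\<^sup>2) * indicator {0..1} t)"
    proof (cases "\<exists>I\<in>level k. t \<in> arc_params I")
      case False
      then have "(\<Sum>I\<in>level k. ennreal (289 / (cmod (1 - c * ?e t))\<^sup>2) * indicator (arc_params I) t) = 0"
        by (intro sum.neutral) auto
      then show ?thesis by (metis zero_le)
    next
      case True
      then obtain I where I: "I \<in> level k" "t \<in> arc_params I" by blast
      have "(\<Sum>J\<in>level k. ennreal (289 / (cmod (1 - c * ?e t))\<^sup>2) * indicator (arc_params J) t)
         = (\<Sum>J\<in>{I}. ennreal (289 / (cmod (1 - c * ?e t))\<^sup>2) * indicator (arc_params J) t)"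
      proof (rule sum.mono_neutral_right[OF finite_level])
        show "{I} \<subseteq> level k" using I by simp
        show "\<forall>J\<in>level k - {I}. ennreal (289 / (cmod (1 - c * ?e t))\<^sup>2) * indicator (arc_params J) t = 0"
          using level_disjoint_arcs[of I k] I by (fastforce simp: arc_params_def indicator_def)
      qed
      also have "\<dots> = ennreal 289 * (ennreal (1 / (cmod (1 - c * ?e t))\<^sup>2) * indicator {0..1} t)"
      proof -
        have "ennreal (289 / (cmod (1 - c * ?e t))\<^sup>2) = ennreal 289 * ennreal (1 / (cmod (1 - c * ?e t))\<^sup>2)"
          by (subst ennreal_mult'[symmetric]) auto
        moreover have "t \<in> {0..1}" using I(2) by (simp add: arc_params_def)
        ultimately show ?thesis using I(2) by simp
      qed
      finally show ?thesis by simp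
    qed
  qed
  also have "\<dots> = ennreal 289 * ennreal (1 / (1 - (cmod c)\<^sup>2))"
    unfolding circle_mean_inverse_sq[OF c1, symmetric] by (rule nn_integral_cmult) measurable
  also have "\<dots> = ennreal (289 / (1 - (cmod c)\<^sup>2))"
    by (subst ennreal_mult'[symmetric]) auto
  also have "\<dots> \<le> ennreal (289 / (1 - cmod c))"
  proof (intro ennreal_leI divide_left_mono)
    show "1 - cmod c \<le> 1 - (cmod c)\<^sup>2" using c1 by (simp add: power2_eq_square mult_left_le)
    show "0 < (1 - (cmod c)\<^sup>2) * (1 - cmod c)"
      using c1 abs_square_less_1[of "cmod c"] by (intro mult_pos_pos) auto
  qed auto
  finally have "(\<Sum>I\<in>level k. l / (kernel (box_center I) z)\<^sup>2) \<le> 289 / (1 - cmod c)"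
    using c1 by (subst (asm) ennreal_le_iff) auto
  then show ?thesis unfolding cmodc l_def .
qed

lemma geometric_sum_le:
  fixes q :: real
  assumes "0 \<le> q" "q < 1" "finite A" "inj_on g A" shows "(\<Sum>k\<in>A. q ^ g k) \<le> 1 / (1 - q)"
proof -
  have "(\<Sum>k\<in>A. q ^ g k) = (\<Sum>j\<in>g ` A. q ^ j)" using assms by (simp add: sum.reindex)
  also have "\<dots> \<le> (\<Sum>j. q ^ j)" using assms by (intro sum_le_suminf summable_geometric) auto
  also have "\<dots> = 1 / (1 - q)" using assms by (intro suminf_geometric) auto
  finally show ?thesis .
qed

lemma sum_dyadic_min_le:
  fixes x s :: real
  assumes x: "0 < x" "x \<le> 1" and s: "0 < s"
  shows "(\<Sum>k<n. min ((2 ^ k * x) powr s) ((2 ^ k * x) powr (- s))) \<le> 2 / (1 - 2 powr (- s))"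
proof -
  let ?q = "2 powr (- s) :: real"
  have q: "0 \<le> ?q" "?q < 1" using s by (auto simp: powr_less_one)
  have qp: "?q ^ j = (2 ^ j) powr (- s)" for j
    by (simp add: powr_power powr_powr powr_realpow[symmetric] mult.commute)
  obtain m :: nat where m: "1 / 2 ^ Suc m < x" "x \<le> 1 / 2 ^ m" using dyadic_bracket[OF x] by blast
  let ?f = "\<lambda>k. min ((2 ^ k * x) powr s) ((2 ^ k * x) powr (- s))"
  have "?f k \<le> ?q ^ (m - k)" if "k \<le> m" for k
  proof -
    have "2 ^ k * x \<le> 2 ^ k * (1 / 2 ^ m)" using m(2) by (intro mult_left_mono) auto
    also have "\<dots> = 1 / 2 ^ (m - k)" using that by (simp add: power_diff)
    finally have "(2 ^ k * x) powr s \<le> (1 / 2 ^ (m - k)) powr s" using x s by (intro powr_mono2) auto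
    also have "\<dots> = ?q ^ (m - k)" unfolding qp by (simp add: powr_divide powr_minus_divide)
    finally show ?thesis by simp
  qed
  then have A: "(\<Sum>k\<in>{..<n} \<inter> {..m}. ?f k) \<le> (\<Sum>k\<in>{..<n} \<inter> {..m}. ?q ^ (m - k))"
    by (intro sum_mono) auto
  have "?f k \<le> ?q ^ (k - Suc m)" if "m < k" for k
  proof -
    have "2 ^ (k - Suc m) = 2 ^ k * (1 / 2 ^ Suc m :: real)" using that by (simp add: power_diff)
    also have "\<dots> \<le> 2 ^ k * x" using m(1) by (intro mult_left_mono) auto
    finally have "(2 ^ k * x) powr (- s) \<le> (2 ^ (k - Suc m)) powr (- s)" using s by (intro powr_mono2') auto
    then show ?thesis unfolding qp by simp
  qed
  then have B: "(\<Sum>k\<in>{..<n} - {..m}. ?f k) \<le> (\<Sum>k\<in>{..<n} - {..m}. ?q ^ (k - Suc m))"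
    by (intro sum_mono) auto
  have "(\<Sum>k<n. ?f k) = (\<Sum>k\<in>{..<n} \<inter> {..m}. ?f k) + (\<Sum>k\<in>{..<n} - {..m}. ?f k)"
    by (rule sum.Int_Diff) simp
  also have "\<dots> \<le> 1 / (1 - ?q) + 1 / (1 - ?q)"
    by (intro add_mono order_trans[OF A] order_trans[OF B] geometric_sum_le q)
       (auto simp: inj_on_def)
  finally show ?thesis by simp
qed

lemma sum_arcs_le_levels:
  fixes f :: "complex set \<Rightarrow> real"
  assumes "finite F" "F \<subseteq> arcs" "\<And>I. I \<in> arcs \<Longrightarrow> 0 \<le> f I"
  shows "\<exists>n. sum f F \<le> (\<Sum>k<n. sum f (level k))"
proof -
  have "\<forall>I\<in>F. \<exists>k. I \<in> level k" using assms(2) by (auto simp: arcs_def)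
  then obtain \<kappa> where \<kappa>: "\<And>I. I \<in> F \<Longrightarrow> I \<in> level (\<kappa> I)" by metis
  define n where "n = Suc (Max (insert 0 (\<kappa> ` F)))"
  have "\<kappa> I < n" if "I \<in> F" for I
    unfolding n_def using that assms(1) by (intro le_imp_less_Suc Max_ge) auto
  then have sub: "F \<subseteq> (\<Union>k\<in>{..<n}. level k)" using \<kappa> by blast
  have "sum f F \<le> sum f (\<Union>k\<in>{..<n}. level k)"
    by (rule sum_mono2) (use sub assms(3) in \<open>auto simp: finite_level intro: level_in_arcs\<close>)
  also have "\<dots> = (\<Sum>k<n. sum f (level k))"
    by (rule sum.UNION_disjoint) (auto simp: finite_level dest: level_unique)
  finally show ?thesis by blast
qed

end

definition schur_const :: "real \<Rightarrow> real" where
  "schur_const s = 4624 / (1 - 2 powr (- s))"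

lemma schur_const_nonneg: "0 < s \<Longrightarrow> 0 \<le> schur_const s"
  unfolding schur_const_def using powr_less_one[of 2 "- s"] by (intro divide_nonneg_nonneg) auto

context dyadic_tree
begin

text \<open>Arcs shorter than \<open>1 - |z|\<close> contribute a geometric series since \<open>4 - s > 1\<close>, longer ones since
  \<open>s > 0\<close>; the arcs of length about \<open>1 - |z|\<close> near \<open>z\<close> dominate.\<close>

lemma schur_sum:
  assumes s: "0 < s" "s \<le> 1" and F: "finite F" "F \<subseteq> arcs" and z: "cmod z < 1"
  shows "(\<Sum>I\<in>F. arc_length I powr (4 - s) / kernel (box_center I) z ^ 4) \<le> schur_const s * (1 - cmod z) powr (- s)"
proof -
  let ?f = "\<lambda>I. arc_length I powr (4 - s) / kernel (box_center I) z ^ 4"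
  define \<delta> where "\<delta> = 1 - cmod z"
  have \<delta>: "0 < \<delta>" "\<delta> \<le> 1" using z by (auto simp: \<delta>_def)
  have lev: "sum ?f (level k) \<le> 2312 * \<delta> powr (- s) * min ((2 ^ k * \<delta>) powr s) ((2 ^ k * \<delta>) powr (- s))" for k
  proof -
    define l :: real where "l = 1 / 2 ^ k"
    have l: "0 < l" "l \<le> 1" by (auto simp: l_def divide_le_eq)
    define d where "d = 1 - (1 - l / 2) * cmod z"
    have "(1 - l / 2) * cmod z \<le> cmod z" using l by (intro mult_left_le_one_le) auto
    then have d1: "\<delta> \<le> d" by (simp add: \<delta>_def d_def)
    have "(1 - l / 2) * cmod z \<le> 1 - l / 2" using z l by (intro mult_left_le) auto
    then have d2: "l / 2 \<le> d" by (simp add: d_def)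
    have d: "0 < d" using d1 \<delta> by simp
    have "?f I \<le> l powr (3 - s) / d\<^sup>2 * (l / (kernel (box_center I) z)\<^sup>2)" if I: "I \<in> level k" for I
    proof -
      have Ia: "I \<in> arcs" using I by (rule level_in_arcs)
      have len: "arc_length I = l" using level_length[OF I] by (simp add: l_def)
      let ?K = "kernel (box_center I) z"
      have K: "d \<le> ?K"
        using kernel_ge(4)[OF box_center_in_disc[OF Ia] z] cmod_box_center[OF Ia] by (simp add: d_def len)
      have "?f I = l powr (3 - s) * l / (?K\<^sup>2 * ?K\<^sup>2)"
        using l powr_add[of l "3 - s" 1] by (simp add: len flip: power_add)
      also have "\<dots> \<le> l powr (3 - s) * l / (d\<^sup>2 * ?K\<^sup>2)"
        using K d l by (intro divide_left_mono mult_right_mono power_mono mult_pos_pos) auto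
      finally show ?thesis by simp
    qed
    then have "sum ?f (level k) \<le> (\<Sum>I\<in>level k. l powr (3 - s) / d\<^sup>2 * (l / (kernel (box_center I) z)\<^sup>2))"
      by (rule sum_mono)
    also have "\<dots> = l powr (3 - s) / d\<^sup>2 * (\<Sum>I\<in>level k. l / (kernel (box_center I) z)\<^sup>2)"
      by (simp add: sum_distrib_left)
    also have "\<dots> \<le> l powr (3 - s) / d\<^sup>2 * (289 / d)"
      using level_kernel_sum[OF z, of k] d by (intro mult_left_mono) (auto simp: l_def d_def)
    also have "\<dots> = 289 * l powr (3 - s) / d ^ 3" by (simp add: power2_eq_square power3_eq_cube)
    finally have main: "sum ?f (level k) \<le> 289 * l powr (3 - s) / d ^ 3" .
    have x: "2 ^ k * \<delta> = \<delta> / l" by (simp add: l_def)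
    have "289 * l powr (3 - s) / d ^ 3 \<le> 289 * l powr (3 - s) / (l / 2) ^ 3"
      using d2 d l by (intro divide_left_mono power_mono mult_pos_pos zero_less_power) auto
    also have "\<dots> = 2312 * (l powr (3 - s) / l powr 3)" using l by (simp add: power_divide)
    also have "l powr (3 - s) / l powr 3 = l powr (- s)" by (simp flip: powr_diff)
    also have "l powr (- s) = \<delta> powr (- s) * (\<delta> / l) powr s"
      using l \<delta> by (simp add: powr_divide powr_minus field_simps)
    finally have b1: "289 * l powr (3 - s) / d ^ 3 \<le> 2312 * \<delta> powr (- s) * (\<delta> / l) powr s" by simp
    have b2: "289 * l powr (3 - s) / d ^ 3 \<le> 2312 * \<delta> powr (- s) * (\<delta> / l) powr (- s)"
    proof (cases "\<delta> \<le> l")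
      case True
      then have "(\<delta> / l) powr s \<le> (\<delta> / l) powr (- s)" using s \<delta> l by (intro powr_mono') auto
      then have "2312 * \<delta> powr (- s) * (\<delta> / l) powr s \<le> 2312 * \<delta> powr (- s) * (\<delta> / l) powr (- s)"
        by (intro mult_left_mono) auto
      with b1 show ?thesis by linarith
    next
      case False
      have "289 * l powr (3 - s) / d ^ 3 \<le> 289 * l powr (3 - s) / \<delta> ^ 3"
        using d1 d \<delta> by (intro divide_left_mono power_mono mult_pos_pos zero_less_power) auto
      also have "\<dots> = 289 * (\<delta> powr (- s) * (\<delta> / l) powr (- (3 - s)))"
      proof -
        have eq1: "(\<delta> / l) powr (- (3 - s)) = \<delta> powr (- (3 - s)) * l powr (3 - s)"
          unfolding powr_minus[of "\<delta> / l"] powr_minus[of \<delta>] using l \<delta> by (simp add: powr_divide field_simps)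
        have eq2: "\<delta> powr (- s) * \<delta> powr (- (3 - s)) = 1 / \<delta> ^ 3"
        proof -
          have "\<delta> powr (- s) * \<delta> powr (- (3 - s)) = \<delta> powr (- 3)" by (simp flip: powr_add)
          also have "\<dots> = 1 / \<delta> ^ 3" using \<delta> by (simp add: powr_minus_divide)
          finally show ?thesis .
        qed
        have "\<delta> powr (- s) * (\<delta> / l) powr (- (3 - s)) = 1 / \<delta> ^ 3 * l powr (3 - s)"
          by (simp only: eq1 eq2[symmetric] mult.assoc)
        then show ?thesis by (simp only:) simp
      qed
      also have "\<dots> \<le> 289 * (\<delta> powr (- s) * (\<delta> / l) powr (- s))"
        using False l s by (intro mult_left_mono powr_mono) auto
      also have "\<dots> \<le> 2312 * \<delta> powr (- s) * (\<delta> / l) powr (- s)" by simp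
      finally show ?thesis .
    qed
    show ?thesis using main b1 b2 unfolding x by (simp add: min_def)
  qed
  have pos: "0 < 1 - 2 powr (- s)" using s by (simp add: powr_less_one)
  obtain n where "sum ?f F \<le> (\<Sum>k<n. sum ?f (level k))"
    using sum_arcs_le_levels[OF F, of ?f] by auto
  also have "\<dots> \<le> (\<Sum>k<n. 2312 * \<delta> powr (- s) * min ((2 ^ k * \<delta>) powr s) ((2 ^ k * \<delta>) powr (- s)))"
    by (intro sum_mono lev)
  also have "\<dots> = 2312 * \<delta> powr (- s) * (\<Sum>k<n. min ((2 ^ k * \<delta>) powr s) ((2 ^ k * \<delta>) powr (- s)))"
    by (simp add: sum_distrib_left)
  also have "\<dots> \<le> 2312 * \<delta> powr (- s) * (2 / (1 - 2 powr (- s)))"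
    by (intro mult_left_mono sum_dyadic_min_le \<delta> s) auto
  finally show ?thesis by (simp add: schur_const_def \<delta>_def)
qed

text \<open>An ancestor \<open>J\<close> of \<open>I\<close> whose box lies at hyperbolically bounded distance from the geodesic that
  joins \<open>a\<close> to the boundary, and beyond which \<open>|1 - a\<^sup>* z|\<close> is about constant.\<close>

lemma balanced_ancestor:
  assumes I: "I \<in> arcs" and a: "cmod a < 1"
  obtains J where "J \<in> arcs" "I \<subseteq> J" "kernel a (box_center J) \<le> 12 * arc_length J"
    "arc_length J \<le> 2 * kernel a (box_center I)"
proof -
  obtain k where k: "I \<in> level k" using I by (auto simp: arcs_def)
  let ?d = "kernel a (box_center I)"
  have d: "arc_length I / 2 \<le> ?d" "0 < ?d" "?d \<le> 2"
    using kernel_box_center[OF I a] kernel_le_2[OF a box_center_in_disc[OF I]] kernel_commute[of a] by auto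
  obtain j where j: "j \<le> k" "?d / 2 \<le> 1 / 2 ^ j" "1 / 2 ^ j \<le> 2 * ?d"
  proof (cases "?d / 2 \<le> 1 / 2 ^ k")
    case True
    then show thesis using d(1) level_length[OF k] by (intro that[of k]) auto
  next
    case False
    obtain j :: nat where j: "1 / 2 ^ Suc j < ?d / 2" "?d / 2 \<le> 1 / 2 ^ j"
      using dyadic_bracket[of "?d / 2"] d by auto
    have "\<not> k < j"
    proof
      assume "k < j"
      then have "(1::real) / 2 ^ j \<le> 1 / 2 ^ k" by (intro divide_left_mono power_increasing) auto
      with j False show False by linarith
    qed
    then show thesis using j d by (intro that[of j]) auto
  qed
  obtain J where J: "J \<in> level j" "I \<subseteq> J" using level_ancestor[OF k j(1)] by blast
  have Ja: "J \<in> arcs" using J by (auto intro: level_in_arcs)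
  have "kernel a (box_center J) = kernel (box_center J) a" by (rule kernel_commute)
  also have "\<dots> \<le> kernel (box_center I) a + cmod (box_center J - box_center I)" using a by (intro kernel_perturb) simp
  also have "cmod (box_center J - box_center I) \<le> 10 * arc_length J"
    using box_center_dist_arcs[OF I Ja J(2)] by (simp add: norm_minus_commute)
  finally have "kernel a (box_center J) \<le> 12 * arc_length J"
    using j(2) level_length[OF J(1)] kernel_commute[of a "box_center I"] by simp
  then show thesis using that[OF Ja J(2)] j(3) level_length[OF J(1)] by simp
qed

definition carleson :: "real \<Rightarrow> complex set set \<Rightarrow> (complex set \<Rightarrow> real) \<Rightarrow> bool" where
  "carleson p F x \<longleftrightarrow> finite F \<and> F \<subseteq> arcs \<and> (\<forall>I\<in>F. 0 \<le> x I) \<and>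
     (\<forall>J\<in>arcs. (\<Sum>I\<in>{I \<in> F. I \<subseteq> J}. x I) \<le> arc_length J powr p)"

text \<open>The dyadic Carleson condition implies its conformally invariant form.\<close>

lemma carleson_invariant:
  assumes p: "0 < p" "p \<le> 1" and x: "carleson p F x" and a: "cmod a < 1"
  shows "(\<Sum>I\<in>F. x I * ((1 - cmod a) / (kernel a (box_center I))\<^sup>2) powr p) \<le> 82944 * schur_const p"
proof -
  have F: "finite F" "F \<subseteq> arcs" and x0: "\<And>I. I \<in> F \<Longrightarrow> 0 \<le> x I"
    and xJ: "\<And>J. J \<in> arcs \<Longrightarrow> (\<Sum>I\<in>{I \<in> F. I \<subseteq> J}. x I) \<le> arc_length J powr p"
    using x by (auto simp: carleson_def)
  let ?P = "\<lambda>I J. J \<in> arcs \<and> I \<subseteq> J \<and> kernel a (box_center J) \<le> 12 * arc_length J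
      \<and> arc_length J \<le> 2 * kernel a (box_center I)"
  have "\<forall>I\<in>F. \<exists>J. ?P I J"
  proof
    fix I assume "I \<in> F"
    then have "I \<in> arcs" using F(2) by blast
    then show "\<exists>J. ?P I J" by (rule balanced_ancestor[OF _ a]) blast
  qed
  from bchoice[OF this] obtain g where "\<forall>I\<in>F. ?P I (g I)" by blast
  then have g: "\<And>I. I \<in> F \<Longrightarrow> g I \<in> arcs" "\<And>I. I \<in> F \<Longrightarrow> I \<subseteq> g I"
    "\<And>I. I \<in> F \<Longrightarrow> kernel a (box_center (g I)) \<le> 12 * arc_length (g I)"
    "\<And>I. I \<in> F \<Longrightarrow> arc_length (g I) \<le> 2 * kernel a (box_center I)" by auto
  let ?\<delta> = "(1 - cmod a) powr p"
  have one: "x I * ((1 - cmod a) / (kernel a (box_center I))\<^sup>2) powr p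
      \<le> x I * (4 * ?\<delta> * arc_length (g I) powr (- 2 * p))" if I: "I \<in> F" for I
  proof (intro mult_left_mono x0 I)
    let ?K = "kernel a (box_center I)" and ?L = "arc_length (g I)"
    have L: "0 < ?L" using arcs_length g(1)[OF I] by auto
    have K: "0 < ?K" using g(4)[OF I] L by linarith
    have "?L\<^sup>2 \<le> (2 * ?K)\<^sup>2" using g(4)[OF I] L by (intro power_mono) auto
    then have "4 * (1 - cmod a) / (4 * ?K\<^sup>2) \<le> 4 * (1 - cmod a) / ?L\<^sup>2"
      using K L a by (intro divide_left_mono) (auto simp: power_mult_distrib)
    moreover have "4 * (1 - cmod a) / (4 * ?K\<^sup>2) = (1 - cmod a) / ?K\<^sup>2"
      by (rule mult_divide_mult_cancel_left) simp
    ultimately have "(1 - cmod a) / ?K\<^sup>2 \<le> 4 * (1 - cmod a) / ?L\<^sup>2" by simp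
    then have "((1 - cmod a) / ?K\<^sup>2) powr p \<le> (4 * (1 - cmod a) / ?L\<^sup>2) powr p"
      using p a by (intro powr_mono2) auto
    also have "\<dots> = 4 powr p * ?\<delta> * ?L powr (- 2 * p)"
    proof -
      have "(?L\<^sup>2) powr p = ?L powr (2 * p)"
        using L by (simp add: powr_powr flip: powr_numeral)
      moreover have "(4 * (1 - cmod a)) powr p = 4 powr p * ?\<delta>" by (rule powr_mult)
      ultimately show ?thesis unfolding powr_divide by (simp add: powr_minus_divide)
    qed
    also have "\<dots> \<le> 4 * ?\<delta> * ?L powr (- 2 * p)"
      using powr_mono[of p 1 4] p by (intro mult_right_mono) auto
    finally show "((1 - cmod a) / ?K\<^sup>2) powr p \<le> 4 * ?\<delta> * ?L powr (- 2 * p)" .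
  qed
  have gF: "finite (g ` F)" "g ` F \<subseteq> arcs" using F g(1) by auto
  have two: "(\<Sum>I\<in>{I \<in> F. g I = J}. x I * (4 * ?\<delta> * arc_length (g I) powr (- 2 * p)))
      \<le> 4 * 20736 * ?\<delta> * (arc_length J powr (4 - p) / kernel (box_center J) a ^ 4)" if J: "J \<in> g ` F" for J
  proof -
    let ?L = "arc_length J" and ?K = "kernel (box_center J) a"
    have Ja: "J \<in> arcs" using J gF by auto
    have L: "0 < ?L" using arcs_length Ja by auto
    have K: "0 < ?K" using kernel_box_center[OF Ja a] by simp
    have KL: "?K \<le> 12 * ?L" using J g(3) kernel_commute by (metis imageE)
    have "(\<Sum>I\<in>{I \<in> F. g I = J}. x I * (4 * ?\<delta> * arc_length (g I) powr (- 2 * p)))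
        = (\<Sum>I\<in>{I \<in> F. g I = J}. x I) * (4 * ?\<delta> * ?L powr (- 2 * p))"
      by (subst sum_distrib_right) (auto intro!: sum.cong)
    also have "\<dots> \<le> ?L powr p * (4 * ?\<delta> * ?L powr (- 2 * p))"
    proof (rule mult_right_mono)
      have "(\<Sum>I\<in>{I \<in> F. g I = J}. x I) \<le> (\<Sum>I\<in>{I \<in> F. I \<subseteq> J}. x I)"
        using F x0 g(2) by (intro sum_mono2) auto
      also have "\<dots> \<le> ?L powr p" by (rule xJ[OF Ja])
      finally show "(\<Sum>I\<in>{I \<in> F. g I = J}. x I) \<le> ?L powr p" .
    qed simp
    also have "?L powr p * (4 * ?\<delta> * ?L powr (- 2 * p)) = 4 * ?\<delta> * ?L powr (- p)"
      by (simp flip: powr_add)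
    also have "\<dots> \<le> 4 * ?\<delta> * (?L powr (- p) * (20736 * ?L ^ 4 / ?K ^ 4))"
    proof -
      have "?K ^ 4 \<le> (12 * ?L) ^ 4" using KL K by (intro power_mono) auto
      then have "1 \<le> 20736 * ?L ^ 4 / ?K ^ 4" using K by (simp add: power_mult_distrib field_simps)
      from mult_left_mono[OF this, of "?L powr (- p)"] show ?thesis by (intro mult_left_mono) auto
    qed
    also have "?L powr (- p) * (20736 * ?L ^ 4 / ?K ^ 4) = 20736 * (?L powr (4 - p) / ?K ^ 4)"
    proof -
      have "?L powr (- p) * ?L ^ 4 = ?L powr (4 - p)"
      proof -
        have "?L ^ 4 = ?L powr 4" using L by simp
        then have "?L powr (- p) * ?L ^ 4 = ?L powr (- p + 4)" by (simp only: powr_add)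
        then show ?thesis by simp
      qed
      then show ?thesis by (simp add: mult.left_commute)
    qed
    finally show ?thesis by (simp add: mult_ac)
  qed
  have "(\<Sum>I\<in>F. x I * ((1 - cmod a) / (kernel a (box_center I))\<^sup>2) powr p)
    \<le> (\<Sum>I\<in>F. x I * (4 * ?\<delta> * arc_length (g I) powr (- 2 * p)))" by (rule sum_mono[OF one])
  also have "\<dots> = (\<Sum>J\<in>g ` F. \<Sum>I\<in>{I \<in> F. g I = J}. x I * (4 * ?\<delta> * arc_length (g I) powr (- 2 * p)))"
    by (rule sum.image_gen[OF F(1)])
  also have "\<dots> \<le> (\<Sum>J\<in>g ` F. 4 * 20736 * ?\<delta> * (arc_length J powr (4 - p) / kernel (box_center J) a ^ 4))"
    by (rule sum_mono[OF two])
  also have "\<dots> = 4 * 20736 * ?\<delta> * (\<Sum>J\<in>g ` F. arc_length J powr (4 - p) / kernel (box_center J) a ^ 4)"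
    by (simp add: sum_distrib_left)
  also have "\<dots> \<le> 4 * 20736 * ?\<delta> * (schur_const p * (1 - cmod a) powr (- p))"
    by (intro mult_left_mono schur_sum p gF a) auto
  also have "\<dots> = 82944 * schur_const p"
    using a by (simp add: powr_minus)
  finally show ?thesis .
qed

end

lemma dyadic_system_tree:
  assumes "dyadic_system \<D>"
  obtains level where "dyadic_tree level" "\<D> = dyadic_tree.arcs level"
proof -
  obtain level :: "nat \<Rightarrow> complex set set" where L: "\<D> = (\<Union>k. level k)" "level 0 = {unit_circle}"
     "\<And>k. partition_on unit_circle (level k) \<and> card (level k) = 2 ^ k \<and>
             (\<forall>I\<in>level k. half_open_arc I \<and> arc_length I = 1 / 2 ^ k) \<and>
             (\<forall>I\<in>level (Suc k). \<exists>J\<in>level k. I \<subseteq> J)"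
    using assms unfolding dyadic_system_def by blast
  have t: "dyadic_tree level" by unfold_locales (use L in auto)
  then show thesis using L(1) by (intro that[OF t]) (simp add: dyadic_tree.arcs_def)
qed


section \<open>Duality for the capacity gauge\<close>

context dyadic_tree
begin

lemma carleson_nonneg: "carleson p F x \<Longrightarrow> I \<in> F \<Longrightarrow> 0 \<le> x I"
  by (simp add: carleson_def)

lemma carleson_single:
  assumes "I \<in> arcs" "0 \<le> p" shows "carleson p {I} (\<lambda>_. arc_length I powr p)"
proof -
  have "(\<Sum>I'\<in>{I' \<in> {I}. I' \<subseteq> J}. arc_length I powr p) \<le> arc_length J powr p" if "J \<in> arcs" for J
  proof (cases "I \<subseteq> J")
    case True
    then have "{I' \<in> {I}. I' \<subseteq> J} = {I}" by auto
    moreover have "arc_length I powr p \<le> arc_length J powr p"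
      using arc_length_mono[OF assms(1) that True] arcs_length[OF assms(1)] assms(2) by (intro powr_mono2) auto
    ultimately show ?thesis by simp
  next
    case False
    then have "{I' \<in> {I}. I' \<subseteq> J} = {}" by auto
    then show ?thesis by (simp only: sum.empty) simp
  qed
  then show ?thesis using assms by (simp add: carleson_def)
qed

text \<open>The certificate of optimality: disjoint arcs over \<open>F\<close> at which the Carleson condition is an equality.\<close>

definition tight_cover :: "real \<Rightarrow> complex set set \<Rightarrow> (complex set \<Rightarrow> real) \<Rightarrow> complex set set \<Rightarrow> bool" where
  "tight_cover p F x M \<longleftrightarrow> finite M \<and> M \<subseteq> arcs \<and> disjoint M \<and> (\<forall>I\<in>F. \<exists>J\<in>M. I \<subseteq> J) \<and>
     (\<forall>J\<in>M. (\<Sum>I\<in>{I \<in> F. I \<subseteq> J}. x I) = arc_length J powr p)"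

lemma load_insert:
  assumes "finite F" "I0 \<notin> F"
  shows "(\<Sum>I\<in>{I \<in> insert I0 F. I \<subseteq> J}. (x(I0 := t)) I)
    = (if I0 \<subseteq> J then t else 0) + (\<Sum>I\<in>{I \<in> F. I \<subseteq> J}. x I)"
proof -
  have rest: "(\<Sum>I\<in>{I \<in> F. I \<subseteq> J}. (x(I0 := t)) I) = (\<Sum>I\<in>{I \<in> F. I \<subseteq> J}. x I)"
    using assms by (intro sum.cong) auto
  show ?thesis
  proof (cases "I0 \<subseteq> J")
    case True
    then have "{I \<in> insert I0 F. I \<subseteq> J} = insert I0 {I \<in> F. I \<subseteq> J}" by auto
    then show ?thesis using assms True rest by (simp del: fun_upd_apply) simp
  next
    case False
    then have "{I \<in> insert I0 F. I \<subseteq> J} = {I \<in> F. I \<subseteq> J}" by auto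
    then show ?thesis using False rest by (simp del: fun_upd_apply)
  qed
qed

text \<open>One step of the greedy algorithm: the new arc receives the smallest slack among its ancestors.\<close>

lemma greedy_step:
  assumes x: "carleson p F x" and M: "tight_cover p F x M" and I0: "I0 \<in> arcs" "I0 \<notin> F"
  obtains t M' where "carleson p (insert I0 F) (x(I0 := t))" "tight_cover p (insert I0 F) (x(I0 := t)) M'"
proof -
  let ?A = "{J \<in> arcs. I0 \<subseteq> J}"
  let ?load = "\<lambda>J. \<Sum>I\<in>{I \<in> F. I \<subseteq> J}. x I"
  define slack where "slack J = arc_length J powr p - ?load J" for J
  have F: "finite F" "F \<subseteq> arcs" "\<And>I. I \<in> F \<Longrightarrow> 0 \<le> x I" and le: "\<And>J. J \<in> arcs \<Longrightarrow> 0 \<le> slack J"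
    using x by (auto simp: carleson_def slack_def)
  have finA: "finite (slack ` ?A)" "slack ` ?A \<noteq> {}" using finite_ancestors[OF I0(1)] I0(1) by auto
  define t where "t = Min (slack ` ?A)"
  obtain J0 where J0: "J0 \<in> ?A" "slack J0 = t" using Min_in[OF finA] unfolding t_def by auto
  have tle: "t \<le> slack J" if "J \<in> ?A" for J
    unfolding t_def using finA(1) that by (intro Min_le) auto
  have t0: "0 \<le> t" using J0 le by auto
  note load = load_insert[OF F(1) I0(2), where x = x and t = t]
  have car: "carleson p (insert I0 F) (x(I0 := t))"
    unfolding carleson_def
  proof (intro conjI ballI)
    fix J assume J: "J \<in> arcs"
    show "(\<Sum>I\<in>{I \<in> insert I0 F. I \<subseteq> J}. (x(I0 := t)) I) \<le> arc_length J powr p"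
      unfolding load using tle[of J] le[OF J] J by (auto simp: slack_def)
  qed (use F I0 t0 in auto)
  have M1: "finite M" "M \<subseteq> arcs" "disjoint M" "\<And>I. I \<in> F \<Longrightarrow> \<exists>J\<in>M. I \<subseteq> J" "\<And>J. J \<in> M \<Longrightarrow> slack J = 0"
    using M by (auto simp: tight_cover_def slack_def)
  show thesis
  proof (cases "\<exists>J\<in>M. I0 \<subseteq> J")
    case True
    then obtain J1 where J1: "J1 \<in> M" "I0 \<subseteq> J1" by blast
    then have "t \<le> 0" using tle[of J1] M1 by auto
    then have "t = 0" using t0 by simp
    then have "tight_cover p (insert I0 F) (x(I0 := t)) M"
      unfolding tight_cover_def load using M1 True by (auto simp: slack_def)
    with car show thesis by (rule that)
  next
    case False
    let ?M = "insert J0 {J \<in> M. \<not> J \<subseteq> J0}"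
    have d0: "J0 \<inter> J = {}" if J: "J \<in> M" "\<not> J \<subseteq> J0" for J
    proof -
      have "\<not> J0 \<subseteq> J" using False J0(1) J(1) by auto
      then show ?thesis using arcs_nested[of J0 J] J0(1) J M1(2) by auto
    qed
    have "disjoint ?M"
      using M1(3) d0 unfolding disjoint_def by (auto simp: Int_commute)
    moreover have "\<exists>J\<in>?M. I \<subseteq> J" if I: "I \<in> insert I0 F" for I
    proof (cases "I = I0")
      case True then show ?thesis using J0(1) by auto
    next
      case False
      then obtain J where "J \<in> M" "I \<subseteq> J" using I M1(4) by auto
      then show ?thesis by (cases "J \<subseteq> J0") auto
    qed
    moreover have "(\<Sum>I\<in>{I \<in> insert I0 F. I \<subseteq> J}. (x(I0 := t)) I) = arc_length J powr p" if J: "J \<in> ?M" for J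
    proof (cases "J = J0")
      case True then show ?thesis unfolding load using J0 by (auto simp: slack_def)
    next
      case False
      then have "J \<in> M" "\<not> I0 \<subseteq> J" using J \<open>\<not> (\<exists>J\<in>M. I0 \<subseteq> J)\<close> by auto
      then show ?thesis unfolding load using M1(5)[of J] by (simp add: slack_def)
    qed
    ultimately have "tight_cover p (insert I0 F) (x(I0 := t)) ?M"
      unfolding tight_cover_def using M1 J0(1) by auto
    with car show thesis by (rule that)
  qed
qed

definition covers :: "complex set set \<Rightarrow> (complex set \<Rightarrow> real) \<Rightarrow> complex set set \<Rightarrow> (complex set \<Rightarrow> real) \<Rightarrow> bool" where
  "covers F h S lam \<longleftrightarrow> finite S \<and> S \<subseteq> arcs \<and> (\<forall>J. 0 \<le> lam J) \<and> (\<forall>J. J \<notin> S \<longrightarrow> lam J = 0) \<and>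
     (\<forall>I\<in>F. h I \<le> (\<Sum>J\<in>{J \<in> arcs. I \<subseteq> J}. lam J))"

text \<open>Linear programming duality on a finite part of the tree. The arcs are inserted in the order of
  decreasing \<open>h\<close>; peeling off the smallest value \<open>m\<close> of \<open>h\<close>, the primal gains \<open>m\<close> on each arc of the
  tight cover, whose total weight is at most the total mass of \<open>x\<close>.\<close>

lemma finite_duality:
  assumes "finite F" "F \<subseteq> arcs" "\<And>I. I \<in> F \<Longrightarrow> 0 \<le> h I"
  shows "\<exists>x S lam. carleson p F x \<and> covers F h S lam \<and>
    (\<Sum>J\<in>S. lam J * arc_length J powr p) \<le> (\<Sum>I\<in>F. h I * x I)"
proof -
  let ?Q = "\<lambda>F c. \<exists>x M S lam. carleson p F x \<and> tight_cover p F x M \<and> covers F (\<lambda>I. h I - c) S lam \<and>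
    (\<Sum>J\<in>S. lam J * arc_length J powr p) \<le> (\<Sum>I\<in>F. (h I - c) * x I)"
  have "F \<subseteq> arcs \<longrightarrow> (\<forall>c. (\<forall>I\<in>F. c \<le> h I) \<longrightarrow> ?Q F c)"
    using assms(1)
  proof (induction F rule: finite_ranking_induct[where f = "\<lambda>I. - h I"])
    case empty
    have "carleson p {} (\<lambda>_. 0) \<and> tight_cover p {} (\<lambda>_. 0) {} \<and> covers {} (\<lambda>I. h I - c) {} (\<lambda>_. 0)" for c
      by (simp add: carleson_def tight_cover_def covers_def disjoint_def)
    then show ?case by fastforce
  next
    case (insert I0 F)
    show ?case
    proof (intro impI allI)
      fix c assume sub: "insert I0 F \<subseteq> arcs" and c: "\<forall>I\<in>insert I0 F. c \<le> h I"
      show "?Q (insert I0 F) c"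
      proof (cases "I0 \<in> F")
        case True
        then show ?thesis using insert.IH sub c by (simp add: insert_absorb)
      next
        case False
        define m where "m = h I0 - c"
        have m0: "0 \<le> m" using c by (simp add: m_def)
        have "\<forall>I\<in>F. h I0 \<le> h I" using insert.hyps by auto
        then obtain x M S lam where x: "carleson p F x" and M: "tight_cover p F x M"
          and lam: "covers F (\<lambda>I. h I - h I0) S lam"
          and cost: "(\<Sum>J\<in>S. lam J * arc_length J powr p) \<le> (\<Sum>I\<in>F. (h I - h I0) * x I)"
          using insert.IH sub by auto
        obtain t M' where x': "carleson p (insert I0 F) (x(I0 := t))" and M': "tight_cover p (insert I0 F) (x(I0 := t)) M'"
          using greedy_step[OF x M _ False] sub by auto
        define y where "y = x(I0 := t)"
        define lam' where "lam' J = lam J + (if J \<in> M' then m else 0)" for J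
        have M'1: "finite M'" "M' \<subseteq> arcs" "disjoint M'" using M' by (auto simp: tight_cover_def)
        have S: "finite S" "S \<subseteq> arcs" "\<And>J. 0 \<le> lam J" "\<And>J. J \<notin> S \<Longrightarrow> lam J = 0"
          using lam by (auto simp: covers_def)
        have cov: "covers (insert I0 F) (\<lambda>I. h I - c) (S \<union> M') lam'"
          unfolding covers_def
        proof (intro conjI ballI allI impI)
          fix I assume I: "I \<in> insert I0 F"
          then have Ia: "I \<in> arcs" using sub by auto
          let ?A = "{J \<in> arcs. I \<subseteq> J}"
          have fA: "finite ?A" by (rule finite_ancestors[OF Ia])
          obtain J1 where J1: "J1 \<in> M'" "I \<subseteq> J1" using M' I by (auto simp: tight_cover_def)
          have "m = (\<Sum>J\<in>{J1}. if J \<in> M' then m else 0)" using J1 by simp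
          also have "\<dots> \<le> (\<Sum>J\<in>?A. if J \<in> M' then m else 0)"
            using J1 M'1 fA m0 by (intro sum_mono2) auto
          finally have a: "m \<le> (\<Sum>J\<in>?A. if J \<in> M' then m else 0)" .
          have b: "h I - h I0 \<le> (\<Sum>J\<in>?A. lam J)"
          proof (cases "I = I0")
            case True then show ?thesis using S(3) by (simp add: sum_nonneg)
          next
            case False then show ?thesis using I lam by (auto simp: covers_def)
          qed
          show "h I - c \<le> (\<Sum>J\<in>?A. lam' J)"
            using a b unfolding lam'_def sum.distrib m_def by linarith
        qed (use S M'1 m0 in \<open>auto simp: lam'_def\<close>)
        have tight: "(\<Sum>J\<in>M'. arc_length J powr p) \<le> (\<Sum>I\<in>insert I0 F. y I)"
        proof -
          have fin: "finite (insert I0 F)" using insert.hyps by simp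
          have "(\<Sum>J\<in>M'. arc_length J powr p) = (\<Sum>J\<in>M'. \<Sum>I\<in>{I \<in> insert I0 F. I \<subseteq> J}. y I)"
            using M' by (intro sum.cong) (auto simp: tight_cover_def y_def)
          also have "\<dots> = sum y (\<Union>J\<in>M'. {I \<in> insert I0 F. I \<subseteq> J})"
          proof (rule sum.UNION_disjoint[symmetric])
            show "\<forall>J\<in>M'. \<forall>K\<in>M'. J \<noteq> K \<longrightarrow> {I \<in> insert I0 F. I \<subseteq> J} \<inter> {I \<in> insert I0 F. I \<subseteq> K} = {}"
            proof (intro ballI impI equals0I)
              fix J K I assume "J \<in> M'" "K \<in> M'" "J \<noteq> K" and I: "I \<in> {I \<in> insert I0 F. I \<subseteq> J} \<inter> {I \<in> insert I0 F. I \<subseteq> K}"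
              then have "J \<inter> K = {}" using M'1(3) by (auto simp: disjoint_def)
              moreover have "I \<noteq> {}" using I sub arcs_nonempty by auto
              ultimately show False using I by auto
            qed
          qed (use M'1 fin in auto)
          also have "\<dots> \<le> sum y (insert I0 F)"
          proof (rule sum_mono2[OF fin])
            show "(\<Union>J\<in>M'. {I \<in> insert I0 F. I \<subseteq> J}) \<subseteq> insert I0 F" by blast
            show "0 \<le> y I" if "I \<in> insert I0 F - (\<Union>J\<in>M'. {I \<in> insert I0 F. I \<subseteq> J})" for I
              unfolding y_def using that by (intro carleson_nonneg[OF x']) blast
          qed
          finally show ?thesis .
        qed
        have "(\<Sum>J\<in>S \<union> M'. lam' J * arc_length J powr p)
            = (\<Sum>J\<in>S \<union> M'. lam J * arc_length J powr p) + (\<Sum>J\<in>S \<union> M'. (if J \<in> M' then m else 0) * arc_length J powr p)"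
          by (simp add: lam'_def distrib_right sum.distrib)
        also have "(\<Sum>J\<in>S \<union> M'. lam J * arc_length J powr p) = (\<Sum>J\<in>S. lam J * arc_length J powr p)"
          using S M'1 by (intro sum.mono_neutral_right) auto
        also have "(\<Sum>J\<in>S \<union> M'. (if J \<in> M' then m else 0) * arc_length J powr p) = (\<Sum>J\<in>M'. m * arc_length J powr p)"
          using S M'1 by (intro sum.mono_neutral_cong_right) auto
        also have "(\<Sum>J\<in>M'. m * arc_length J powr p) = m * (\<Sum>J\<in>M'. arc_length J powr p)"
          by (simp add: sum_distrib_left)
        finally have "(\<Sum>J\<in>S \<union> M'. lam' J * arc_length J powr p)
            \<le> (\<Sum>I\<in>F. (h I - h I0) * x I) + m * (\<Sum>I\<in>insert I0 F. y I)"
          using cost mult_left_mono[OF tight m0] by linarith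
        also have "\<dots> = (\<Sum>I\<in>insert I0 F. (h I - c) * y I)"
        proof -
          have e: "(\<Sum>I\<in>F. (h I - h I0) * x I) = (\<Sum>I\<in>F. (h I - h I0) * y I)"
            using False by (intro sum.cong) (auto simp: y_def)
          show ?thesis unfolding e using insert.hyps False
            by (simp add: m_def sum_distrib_left algebra_simps sum.distrib sum_subtractf)
        qed
        finally show ?thesis using x' M' cov unfolding y_def by blast
      qed
    qed
  qed
  then have "\<forall>c. (\<forall>I\<in>F. c \<le> h I) \<longrightarrow> ?Q F c" using assms(2) by (rule mp)
  from spec[OF this, of 0] have "(\<forall>I\<in>F. 0 \<le> h I) \<longrightarrow> ?Q F 0" .
  moreover have "\<forall>I\<in>F. 0 \<le> h I" using assms(3) by blast
  ultimately have "?Q F 0" by (rule mp)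
  then show ?thesis unfolding diff_0_right by blast
qed

lemma infsum_ennreal_le:
  fixes f :: "'a \<Rightarrow> ennreal"
  assumes "\<And>G. finite G \<Longrightarrow> G \<subseteq> A \<Longrightarrow> sum f G \<le> K" shows "infsum f A \<le> K"
  by (subst nonneg_infsum_complete) (auto intro!: SUP_least assms)

text \<open>The finite covers have bounded cost, so that a subsequence of them converges arc by arc.\<close>

theorem gauge_Bp_le_dual:
  assumes p: "0 \<le> p" and K: "0 \<le> K"
    and dual: "\<And>F x. carleson p F x \<Longrightarrow> (\<Sum>I\<in>F. h I * ennreal (x I)) \<le> ennreal K"
  shows "gauge_Bp p arcs h \<le> ennreal K"
proof -
  have hfin: "h I < top" if I: "I \<in> arcs" for I
  proof (rule ccontr)
    assume "\<not> h I < top"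
    then have "h I = top" by (simp add: not_less top_unique)
    moreover have "h I * ennreal (arc_length I powr p) \<le> ennreal K"
      using dual[OF carleson_single[OF I p]] by simp
    ultimately show False using arcs_length[OF I] by (simp add: ennreal_top_mult top_unique)
  qed
  define h' where "h' I = enn2real (h I)" for I
  have hh: "h I = ennreal (h' I)" if "I \<in> arcs" for I using hfin[OF that] by (simp add: h'_def)
  have h0: "0 \<le> h' I" for I by (simp add: h'_def)
  define F where "F n = (\<Union>k\<in>{..<n}. level k)" for n :: nat
  have F: "finite (F n)" "F n \<subseteq> arcs" for n by (auto simp: F_def finite_level intro: level_in_arcs)
  have "\<exists>S lam. covers (F n) h' S lam \<and> (\<Sum>J\<in>S. lam J * arc_length J powr p) \<le> K" for n
  proof -
    obtain x S lam where x: "carleson p (F n) x" and S: "covers (F n) h' S lam"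
      "(\<Sum>J\<in>S. lam J * arc_length J powr p) \<le> (\<Sum>I\<in>F n. h' I * x I)"
      using finite_duality[OF F, of n h' p] h0 by blast
    have "ennreal (\<Sum>I\<in>F n. h' I * x I) = (\<Sum>I\<in>F n. h I * ennreal (x I))"
      using F(2)[of n] h0 carleson_nonneg[OF x]
      by (subst sum_ennreal[symmetric]) (auto simp: ennreal_mult hh intro!: sum.cong)
    also have "\<dots> \<le> ennreal K" by (rule dual[OF x])
    finally have "(\<Sum>I\<in>F n. h' I * x I) \<le> K" using K by (simp add: ennreal_le_iff)
    with S show ?thesis by fastforce
  qed
  then obtain S lam where cov: "\<And>n. covers (F n) h' (S n) (lam n)"
    and cost: "\<And>n. (\<Sum>J\<in>S n. lam n J * arc_length J powr p) \<le> K" by metis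
  have lam0: "0 \<le> lam n J" for n J using cov[of n] by (auto simp: covers_def)
  have costG: "(\<Sum>J\<in>G. lam n J * arc_length J powr p) \<le> K" if G: "finite G" for G n
  proof -
    have Sn: "finite (S n)" "\<And>J. J \<notin> S n \<Longrightarrow> lam n J = 0" using cov[of n] by (auto simp: covers_def)
    have "(\<Sum>J\<in>G. lam n J * arc_length J powr p) \<le> (\<Sum>J\<in>G \<union> S n. lam n J * arc_length J powr p)"
      using G Sn lam0 by (intro sum_mono2) auto
    also have "\<dots> = (\<Sum>J\<in>S n. lam n J * arc_length J powr p)"
      using G Sn by (intro sum.mono_neutral_right) auto
    finally show ?thesis using cost[of n] by simp
  qed
  obtain k where k: "strict_mono (k :: nat \<Rightarrow> nat)"
    "\<And>J. J \<in> arcs \<Longrightarrow> \<exists>l. (\<lambda>n. lam (k n) J * arc_length J powr p) \<longlonglongrightarrow> l"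
  proof (rule function_convergent_subsequence[OF countable_arcs, of "\<lambda>n J. lam n J * arc_length J powr p" K])
    fix n J show "norm (lam n J * arc_length J powr p) \<le> K" using costG[of "{J}" n] lam0[of n J] by simp
  qed blast
  then obtain l where l: "\<And>J. J \<in> arcs \<Longrightarrow> (\<lambda>n. lam (k n) J * arc_length J powr p) \<longlonglongrightarrow> l J" by metis
  define L where "L J = l J / arc_length J powr p" for J
  have len: "0 < arc_length J powr p" if "J \<in> arcs" for J using arcs_length[OF that] by simp
  have L: "(\<lambda>n. lam (k n) J) \<longlonglongrightarrow> L J" if "J \<in> arcs" for J
    using tendsto_divide[OF l[OF that] tendsto_const[of "arc_length J powr p"]] len[OF that] by (simp add: L_def)
  have Lp: "L J * arc_length J powr p = l J" if "J \<in> arcs" for J using len[OF that] by (simp add: L_def)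
  have L0: "0 \<le> L J" if "J \<in> arcs" for J
    using L[OF that] lam0 by (intro LIMSEQ_le_const) auto
  have cover: "h I \<le> (\<Sum>\<^sub>\<infinity>J\<in>{J\<in>arcs. I \<subseteq> J}. ennreal (L J))" if I: "I \<in> arcs" for I
  proof -
    let ?A = "{J \<in> arcs. I \<subseteq> J}"
    have fA: "finite ?A" by (rule finite_ancestors[OF I])
    obtain j where j: "I \<in> level j" using I by (auto simp: arcs_def)
    have "h' I \<le> (\<Sum>J\<in>?A. L J)"
    proof (rule LIMSEQ_le_const)
      show "(\<lambda>n. \<Sum>J\<in>?A. lam (k n) J) \<longlonglongrightarrow> (\<Sum>J\<in>?A. L J)" by (intro tendsto_sum L) auto
      show "\<exists>N. \<forall>n\<ge>N. h' I \<le> (\<Sum>J\<in>?A. lam (k n) J)"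
      proof (intro exI allI impI)
        fix n assume "Suc j \<le> n"
        then have "j < k n" using strict_mono_imp_increasing[OF k(1), of n] by simp
        then have "I \<in> F (k n)" using j by (auto simp: F_def)
        then show "h' I \<le> (\<Sum>J\<in>?A. lam (k n) J)" using cov[of "k n"] by (auto simp: covers_def)
      qed
    qed
    then have "h I \<le> ennreal (\<Sum>J\<in>?A. L J)" unfolding hh[OF I] by (rule ennreal_leI)
    also have "\<dots> = (\<Sum>J\<in>?A. ennreal (L J))" using L0 by (intro sum_ennreal[symmetric]) auto
    also have "\<dots> = (\<Sum>\<^sub>\<infinity>J\<in>?A. ennreal (L J))" using fA by simp
    finally show ?thesis .
  qed
  have total: "(\<Sum>\<^sub>\<infinity>J\<in>arcs. ennreal (L J * arc_length J powr p)) \<le> ennreal K"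
  proof (rule infsum_ennreal_le)
    fix G assume G: "finite G" "G \<subseteq> arcs"
    have "(\<Sum>J\<in>G. l J) \<le> K"
    proof (rule LIMSEQ_le_const2)
      show "(\<lambda>n. \<Sum>J\<in>G. lam (k n) J * arc_length J powr p) \<longlonglongrightarrow> (\<Sum>J\<in>G. l J)"
        using G by (intro tendsto_sum l) auto
      show "\<exists>N. \<forall>n\<ge>N. (\<Sum>J\<in>G. lam (k n) J * arc_length J powr p) \<le> K"
        using costG[OF G(1)] by blast
    qed
    moreover have "(\<Sum>J\<in>G. ennreal (L J * arc_length J powr p)) = ennreal (\<Sum>J\<in>G. l J)"
    proof -
      have "(\<Sum>J\<in>G. ennreal (L J * arc_length J powr p)) = ennreal (\<Sum>J\<in>G. L J * arc_length J powr p)"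
        using G L0 by (intro sum_ennreal) (auto intro!: mult_nonneg_nonneg)
      also have "(\<Sum>J\<in>G. L J * arc_length J powr p) = (\<Sum>J\<in>G. l J)" using G Lp by (intro sum.cong) auto
      finally show ?thesis .
    qed
    ultimately show "(\<Sum>J\<in>G. ennreal (L J * arc_length J powr p)) \<le> ennreal K" by (simp add: ennreal_leI)
  qed
  have "gauge_Bp p arcs h \<le> (\<Sum>\<^sub>\<infinity>J\<in>arcs. ennreal (L J * arc_length J powr p))"
    unfolding gauge_Bp_def using L0 cover by (intro Inf_lower) blast
  then show ?thesis using total by (rule order_trans)
qed

end


section \<open>Test functions\<close>

definition energy :: "real \<Rightarrow> (complex \<Rightarrow> complex) \<Rightarrow> complex \<Rightarrow> ennreal" where
  "energy p f a = (\<integral>\<^sup>+z\<in>unit_disc. (ennreal ((cmod (deriv f z))\<^sup>2) * enn_powr (green z a) p) \<partial>area)"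

lemma energy_lborel:
  assumes "f holomorphic_on unit_disc"
  shows "energy p f a = ennreal (1 / pi) *
    (\<integral>\<^sup>+z. ennreal (indicator unit_disc z * (cmod (deriv f z))\<^sup>2) * enn_powr (green z a) p \<partial>lborel)"
proof -
  let ?d = "\<lambda>z. ennreal (indicator unit_disc z * (cmod (deriv f z))\<^sup>2)"
  have [measurable]: "?d \<in> borel_measurable borel" using measurable_deriv_sq[OF assms] by simp
  have "energy p f a = (\<integral>\<^sup>+z. ?d z * enn_powr (green z a) p \<partial>area)"
    unfolding energy_def by (intro nn_integral_cong) (simp add: indicator_def)
  also have "\<dots> = ennreal (1 / pi) * (\<integral>\<^sup>+z. ?d z * enn_powr (green z a) p * indicator unit_disc z \<partial>lborel)"
    by (rule nn_integral_area) measurable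
  also have "(\<lambda>z. ?d z * enn_powr (green z a) p * indicator unit_disc z) = (\<lambda>z. ?d z * enn_powr (green z a) p)"
    by (auto simp: indicator_def)
  finally show ?thesis .
qed

lemma energy_comp:
  assumes f: "f holomorphic_on unit_disc" and \<phi>: "\<phi> holomorphic_on unit_disc" "\<phi> ` unit_disc \<subseteq> unit_disc"
  shows "energy p (f \<circ> \<phi>) a = (\<integral>\<^sup>+z\<in>unit_disc. (ennreal ((cmod (deriv f (\<phi> z)))\<^sup>2)
      * (ennreal ((cmod (deriv \<phi> z))\<^sup>2) * enn_powr (green z a) p)) \<partial>area)"
  unfolding energy_def
proof (rule nn_integral_cong)
  fix z
  show "ennreal ((cmod (deriv (f \<circ> \<phi>) z))\<^sup>2) * enn_powr (green z a) p * indicator unit_disc z =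
     ennreal ((cmod (deriv f (\<phi> z)))\<^sup>2) * (ennreal ((cmod (deriv \<phi> z))\<^sup>2) * enn_powr (green z a) p) * indicator unit_disc z"
  proof (cases "z \<in> unit_disc")
    case True
    then have "\<phi> z \<in> unit_disc" using \<phi>(2) by blast
    then have "deriv (f \<circ> \<phi>) z = deriv f (\<phi> z) * deriv \<phi> z"
      using True f \<phi>(1) by (intro deriv_chain holomorphic_on_imp_differentiable_at[OF _ open_ball])
    then show ?thesis by (simp add: norm_mult power_mult_distrib ennreal_mult' mult_ac)
  qed simp
qed

lemma sum_mult_sq_le:
  fixes a b :: "'a \<Rightarrow> real"
  shows "(\<Sum>i\<in>A. a i * b i)\<^sup>2 \<le> (\<Sum>i\<in>A. (a i)\<^sup>2) * (\<Sum>i\<in>A. (b i)\<^sup>2)"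
  by (rule Cauchy_Schwarz_ineq_sum)

context dyadic_tree
begin

text \<open>The summands of the derivative of a test function, without their signs.\<close>

definition bump :: "real \<Rightarrow> (complex set \<Rightarrow> real) \<Rightarrow> complex set \<Rightarrow> complex \<Rightarrow> complex" where
  "bump p x I z = of_real (sqrt (x I) * arc_length I powr (3 - p / 2)) / (1 - cnj (box_center I) * z) ^ 4"

end

definition test_const :: "real \<Rightarrow> real" where
  "test_const p = schur_const (1/2) * (288 * weight_mass) * (82944 * schur_const p)"

lemma test_const_nonneg: "0 < p \<Longrightarrow> 0 \<le> test_const p"
  unfolding test_const_def by (intro mult_nonneg_nonneg schur_const_nonneg weight_mass_nonneg) auto

context dyadic_tree
begin

lemma cmod_bump:
  assumes "0 \<le> x I"
  shows "cmod (bump p x I z) = sqrt (x I) * arc_length I powr (3 - p / 2) / kernel (box_center I) z ^ 4"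
  using assms by (simp add: bump_def norm_divide norm_mult norm_power)

lemma bump_holomorphic:
  assumes "I \<in> arcs" shows "bump p x I holomorphic_on unit_disc"
  unfolding bump_def
proof (intro holomorphic_intros)
  fix z assume "z \<in> unit_disc"
  then have "1 - cnj (box_center I) * z \<noteq> 0"
    using one_minus_mult_nonzero(1)[of "cnj (box_center I)" z] box_center_in_disc[OF assms] by auto
  then show "(1 - cnj (box_center I) * z) ^ 4 \<noteq> 0" by simp
qed

text \<open>Cauchy--Schwarz with weights chosen such that the second factor is the sum of the Schur test with
  \<open>s = 1/2\<close>; the signs are lost here, which is why the bound is uniform in them.\<close>

lemma bump_sum_sq_le:
  assumes x: "carleson p F x" and eps: "\<And>I. I \<in> F \<Longrightarrow> \<bar>eps I\<bar> \<le> (1::real)" and z: "cmod z < 1"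
  shows "(cmod (\<Sum>I\<in>F. of_real (eps I) * bump p x I z))\<^sup>2
    \<le> schur_const (1/2) * (1 - cmod z) powr (-1/2)
      * (\<Sum>I\<in>F. x I * arc_length I powr (5/2 - p) / kernel (box_center I) z ^ 4)"
proof -
  have F: "finite F" "F \<subseteq> arcs" and x0: "\<And>I. I \<in> F \<Longrightarrow> 0 \<le> x I" using x by (auto simp: carleson_def)
  let ?K = "\<lambda>I. kernel (box_center I) z"
  let ?a = "\<lambda>I. sqrt (x I) * arc_length I powr (5/4 - p / 2) / (?K I)\<^sup>2"
  let ?b = "\<lambda>I. arc_length I powr (7/4) / (?K I)\<^sup>2"
  have one: "cmod (of_real (eps I) * bump p x I z) \<le> ?a I * ?b I" if I: "I \<in> F" for I
  proof -
    have Ia: "I \<in> arcs" using F I by auto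
    have "cmod (of_real (eps I) * bump p x I z) \<le> 1 * cmod (bump p x I z)"
      unfolding norm_mult using eps[OF I] by (intro mult_right_mono) auto
    also have "\<dots> = sqrt (x I) * arc_length I powr (3 - p / 2) / ?K I ^ 4"
      using x0[OF I] by (simp add: cmod_bump[of x I])
    also have "arc_length I powr (3 - p / 2) = arc_length I powr (5/4 - p / 2) * arc_length I powr (7/4)"
      by (simp flip: powr_add)
    also have "sqrt (x I) * (arc_length I powr (5/4 - p / 2) * arc_length I powr (7/4)) / ?K I ^ 4 = ?a I * ?b I"
      by (simp flip: power_add)
    finally show ?thesis .
  qed
  have a2: "(?a I)\<^sup>2 = x I * arc_length I powr (5/2 - p) / ?K I ^ 4" if I: "I \<in> F" for I
  proof -
    have "(arc_length I powr (5/4 - p / 2))\<^sup>2 = arc_length I powr (5/2 - p)"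
      by (simp add: power2_eq_square flip: powr_add)
    then show ?thesis using x0[OF I] by (simp add: power_divide power_mult_distrib flip: power_mult)
  qed
  have b2: "(?b I)\<^sup>2 = arc_length I powr (4 - 1/2) / ?K I ^ 4" for I
  proof -
    have "(arc_length I powr (7/4))\<^sup>2 = arc_length I powr (4 - 1/2)"
      by (simp add: power2_eq_square flip: powr_add)
    then show ?thesis by (simp only: power_divide flip: power_mult) simp
  qed
  have "cmod (\<Sum>I\<in>F. of_real (eps I) * bump p x I z) \<le> (\<Sum>I\<in>F. ?a I * ?b I)"
    using one by (rule sum_norm_le)
  then have "(cmod (\<Sum>I\<in>F. of_real (eps I) * bump p x I z))\<^sup>2 \<le> (\<Sum>I\<in>F. ?a I * ?b I)\<^sup>2"
    by (intro power_mono) auto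
  also have "\<dots> \<le> (\<Sum>I\<in>F. (?a I)\<^sup>2) * (\<Sum>I\<in>F. (?b I)\<^sup>2)" by (rule sum_mult_sq_le)
  also have "(\<Sum>I\<in>F. (?a I)\<^sup>2) = (\<Sum>I\<in>F. x I * arc_length I powr (5/2 - p) / ?K I ^ 4)"
    using a2 by (rule sum.cong[OF refl])
  also have "(\<Sum>I\<in>F. (?b I)\<^sup>2) = (\<Sum>I\<in>F. arc_length I powr (4 - 1/2) / ?K I ^ 4)"
    using b2 by (rule sum.cong[OF refl])
  also have "(\<Sum>I\<in>F. x I * arc_length I powr (5/2 - p) / ?K I ^ 4) * (\<Sum>I\<in>F. arc_length I powr (4 - 1/2) / ?K I ^ 4)
    \<le> (\<Sum>I\<in>F. x I * arc_length I powr (5/2 - p) / ?K I ^ 4) * (schur_const (1/2) * (1 - cmod z) powr (- (1/2)))"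
    using x0 by (intro mult_left_mono schur_sum F z sum_nonneg divide_nonneg_nonneg mult_nonneg_nonneg) auto
  finally show ?thesis by (simp add: mult_ac)
qed

text \<open>Integrating the previous bound term by term against the Green function leaves the conformally
  invariant Carleson sum.\<close>

lemma bump_energy:
  assumes p: "0 < p" "p \<le> 1" and x: "carleson p F x" and eps: "\<And>I. I \<in> F \<Longrightarrow> \<bar>eps I\<bar> \<le> (1::real)"
    and f: "f holomorphic_on unit_disc" "\<And>z. z \<in> unit_disc \<Longrightarrow> deriv f z = (\<Sum>I\<in>F. of_real (eps I) * bump p x I z)"
    and a: "cmod a < 1"
  shows "energy p f a \<le> ennreal (test_const p)"
proof -
  have F: "finite F" "F \<subseteq> arcs" and x0: "\<And>I. I \<in> F \<Longrightarrow> 0 \<le> x I" using x by (auto simp: carleson_def)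
  let ?g = "\<lambda>z. enn_powr (green z a) p"
  let ?S = "schur_const (1/2)"
  have S0: "0 \<le> ?S" by (rule schur_const_nonneg) simp
  let ?w = "\<lambda>I. x I * arc_length I powr (5/2 - p)"
  let ?h = "\<lambda>I z. ennreal ((1 - cmod z) powr (-1/2) / kernel (box_center I) z ^ 4) * ?g z * indicator unit_disc z"
  have w0: "0 \<le> ?w I" if "I \<in> F" for I using x0[OF that] by simp
  have [measurable]: "?h I \<in> borel_measurable borel" for I by measurable
  have pt: "ennreal (indicator unit_disc z * (cmod (deriv f z))\<^sup>2) * ?g z
      \<le> (\<Sum>I\<in>F. ennreal (?S * ?w I) * ?h I z)" for z
  proof (cases "z \<in> unit_disc")
    case True
    have "(cmod (deriv f z))\<^sup>2 \<le> ?S * (1 - cmod z) powr (-1/2) * (\<Sum>I\<in>F. ?w I / kernel (box_center I) z ^ 4)"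
      using bump_sum_sq_le[where z = z, OF x eps] f(2)[OF True] True by simp
    also have "\<dots> = (\<Sum>I\<in>F. ?S * ?w I * ((1 - cmod z) powr (-1/2) / kernel (box_center I) z ^ 4))"
      by (simp add: sum_distrib_left mult_ac)
    finally have "ennreal ((cmod (deriv f z))\<^sup>2)
        \<le> ennreal (\<Sum>I\<in>F. ?S * ?w I * ((1 - cmod z) powr (-1/2) / kernel (box_center I) z ^ 4))"
      by (rule ennreal_leI)
    also have "\<dots> = (\<Sum>I\<in>F. ennreal (?S * ?w I * ((1 - cmod z) powr (-1/2) / kernel (box_center I) z ^ 4)))"
      using S0 x0 by (intro sum_ennreal[symmetric] mult_nonneg_nonneg) auto
    also have "\<dots> = (\<Sum>I\<in>F. ennreal (?S * ?w I) * ennreal ((1 - cmod z) powr (-1/2) / kernel (box_center I) z ^ 4))"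
      using S0 x0 by (intro sum.cong refl ennreal_mult mult_nonneg_nonneg) auto
    finally have "ennreal ((cmod (deriv f z))\<^sup>2) * ?g z
        \<le> (\<Sum>I\<in>F. ennreal (?S * ?w I) * ennreal ((1 - cmod z) powr (-1/2) / kernel (box_center I) z ^ 4)) * ?g z"
      by (rule mult_right_mono) simp
    then show ?thesis using True by (simp add: sum_distrib_right mult.assoc)
  qed simp
  have each: "(\<integral>\<^sup>+z. ?h I z \<partial>lborel) \<le> ennreal (288 * weight_mass * (arc_length I powr (p - 5/2) * ((1 - cmod a) / (kernel a (box_center I))\<^sup>2) powr p))"
    if I: "I \<in> F" for I
  proof -
    have Ia: "I \<in> arcs" using I F by auto
    let ?l = "arc_length I"
    have l: "0 < ?l" using arcs_length[OF Ia] by simp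
    have c: "1 - cmod (box_center I) = ?l / 2" using cmod_box_center[OF Ia] by simp
    have "(\<integral>\<^sup>+z. ?h I z \<partial>lborel) \<le> ennreal (48 * weight_mass * (?l / 2) powr (-5/2)
        * ((1 - cmod a) * (?l / 2) / (kernel a (box_center I))\<^sup>2) powr p)"
      using nn_integral_kernel_green[OF p box_center_in_disc[OF Ia] a] unfolding c by simp
    also have "\<dots> \<le> ennreal (48 * weight_mass * (6 * ?l powr (-5/2)) * (?l powr p * ((1 - cmod a) / (kernel a (box_center I))\<^sup>2) powr p))"
    proof (intro ennreal_leI mult_mono mult_nonneg_nonneg order_refl)
      have "2 powr (5/2) = 4 * sqrt (2::real)"
        using powr_add[of 2 2 "1/2 :: real"] by (simp add: powr_half_sqrt)
      moreover have "sqrt 2 \<le> (3/2::real)" by (rule real_le_lsqrt) (auto simp: power2_eq_square)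
      ultimately have "2 powr (5/2) \<le> (6::real)" by simp
      from mult_right_mono[OF this, of "?l powr (-5/2)"]
      show "(?l / 2) powr (-5/2) \<le> 6 * ?l powr (-5/2)"
        by (simp add: powr_divide powr_minus_divide)
      have "((1 - cmod a) * (?l / 2) / (kernel a (box_center I))\<^sup>2) powr p
          \<le> (?l * ((1 - cmod a) / (kernel a (box_center I))\<^sup>2)) powr p"
      proof (rule powr_mono2)
        have "(1 - cmod a) * (?l / 2) \<le> ?l * (1 - cmod a)" using a l by (simp add: mult.commute mult_left_mono)
        then have "(1 - cmod a) * (?l / 2) / (kernel a (box_center I))\<^sup>2 \<le> ?l * (1 - cmod a) / (kernel a (box_center I))\<^sup>2"
          by (rule divide_right_mono) simp
        then show "(1 - cmod a) * (?l / 2) / (kernel a (box_center I))\<^sup>2 \<le> ?l * ((1 - cmod a) / (kernel a (box_center I))\<^sup>2)"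
          by simp
      qed (use p a l in auto)
      also have "\<dots> = ?l powr p * ((1 - cmod a) / (kernel a (box_center I))\<^sup>2) powr p" by (rule powr_mult)
      finally show "((1 - cmod a) * (?l / 2) / (kernel a (box_center I))\<^sup>2) powr p
        \<le> ?l powr p * ((1 - cmod a) / (kernel a (box_center I))\<^sup>2) powr p" .
    qed (use weight_mass_nonneg in auto)
    also have "48 * weight_mass * (6 * ?l powr (-5/2)) * (?l powr p * ((1 - cmod a) / (kernel a (box_center I))\<^sup>2) powr p)
      = 288 * weight_mass * ((?l powr p * ?l powr (-5/2)) * ((1 - cmod a) / (kernel a (box_center I))\<^sup>2) powr p)"
      by (simp add: mult_ac)
    also have "?l powr p * ?l powr (-5/2) = ?l powr (p - 5/2)" by (simp flip: powr_add)
    finally show ?thesis .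
  qed
  have "(\<integral>\<^sup>+z. ennreal (indicator unit_disc z * (cmod (deriv f z))\<^sup>2) * ?g z \<partial>lborel)
    \<le> (\<integral>\<^sup>+z. (\<Sum>I\<in>F. ennreal (?S * ?w I) * ?h I z) \<partial>lborel)"
    using pt by (rule nn_integral_mono)
  also have "\<dots> = (\<Sum>I\<in>F. \<integral>\<^sup>+z. ennreal (?S * ?w I) * ?h I z \<partial>lborel)"
    by (rule nn_integral_sum) simp
  also have "\<dots> = (\<Sum>I\<in>F. ennreal (?S * ?w I) * (\<integral>\<^sup>+z. ?h I z \<partial>lborel))"
    by (intro sum.cong refl nn_integral_cmult) simp
  also have "\<dots> \<le> (\<Sum>I\<in>F. ennreal (?S * ?w I) * ennreal (288 * weight_mass * (arc_length I powr (p - 5/2) * ((1 - cmod a) / (kernel a (box_center I))\<^sup>2) powr p)))"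
    by (intro sum_mono mult_left_mono each) auto
  also have "\<dots> = (\<Sum>I\<in>F. ennreal (?S * (288 * weight_mass) * (x I * ((1 - cmod a) / (kernel a (box_center I))\<^sup>2) powr p)))"
  proof (rule sum.cong[OF refl])
    fix I assume I: "I \<in> F"
    have l: "0 < arc_length I" using I F arcs_length by auto
    let ?q = "((1 - cmod a) / (kernel a (box_center I))\<^sup>2) powr p"
    have "ennreal (?S * ?w I) * ennreal (288 * weight_mass * (arc_length I powr (p - 5/2) * ?q))
      = ennreal (?S * ?w I * (288 * weight_mass * (arc_length I powr (p - 5/2) * ?q)))"
      using S0 x0[OF I] weight_mass_nonneg by (intro ennreal_mult[symmetric] mult_nonneg_nonneg) auto
    also have "?S * ?w I * (288 * weight_mass * (arc_length I powr (p - 5/2) * ?q))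
      = ?S * (288 * weight_mass) * (x I * ?q) * (arc_length I powr (5/2 - p) * arc_length I powr (p - 5/2))"
      by (simp add: mult_ac)
    also have "arc_length I powr (5/2 - p) * arc_length I powr (p - 5/2) = 1"
      using l by (simp flip: powr_add)
    finally show "ennreal (?S * ?w I) * ennreal (288 * weight_mass * (arc_length I powr (p - 5/2) * ?q))
      = ennreal (?S * (288 * weight_mass) * (x I * ?q))" by simp
  qed
  also have "\<dots> = ennreal (?S * (288 * weight_mass) * (\<Sum>I\<in>F. x I * ((1 - cmod a) / (kernel a (box_center I))\<^sup>2) powr p))"
    using S0 x0 weight_mass_nonneg by (subst sum_ennreal) (auto simp: sum_distrib_left intro!: mult_nonneg_nonneg)
  also have "\<dots> \<le> ennreal (test_const p)"
    unfolding test_const_def using S0 weight_mass_nonneg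
    by (intro ennreal_leI mult_left_mono carleson_invariant p x a mult_nonneg_nonneg) auto
  finally have main: "(\<integral>\<^sup>+z. ennreal (indicator unit_disc z * (cmod (deriv f z))\<^sup>2) * ?g z \<partial>lborel) \<le> ennreal (test_const p)" .
  have "energy p f a \<le> ennreal 1 * ennreal (test_const p)"
    unfolding energy_lborel[OF f(1)]
    using pi_gt3 by (intro mult_mono main ennreal_leI) auto
  then show ?thesis by simp
qed

lemma test_function:
  assumes F: "F \<subseteq> arcs"
  obtains f where "f holomorphic_on unit_disc"
    "\<And>z. z \<in> unit_disc \<Longrightarrow> deriv f z = (\<Sum>I\<in>F. of_real (eps I) * bump p x I z)"
proof -
  let ?h = "\<lambda>z. \<Sum>I\<in>F. of_real (eps I) * bump p x I z"
  have h: "?h holomorphic_on unit_disc" using F by (intro holomorphic_intros bump_holomorphic) auto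
  obtain f where f': "\<And>z. z \<in> unit_disc \<Longrightarrow> (f has_field_derivative ?h z) (at z within unit_disc)"
    by (rule holomorphic_convex_primitive'[OF convex_ball open_ball h]) (rule that)
  have f: "(f has_field_derivative ?h z) (at z)" if "z \<in> unit_disc" for z
    using f'[OF that] unfolding at_within_open[OF that open_ball] .
  show thesis
  proof (rule that)
    show "f holomorphic_on unit_disc" unfolding holomorphic_on_open[OF open_ball]
    proof
      fix z assume "z \<in> unit_disc"
      then show "\<exists>f'. (f has_field_derivative f') (at z)" by (intro exI) (rule f)
    qed
    show "deriv f z = ?h z" if "z \<in> unit_disc" for z using f[OF that] by (rule DERIV_imp_deriv)
  qed
qed

end

text \<open>Signs are chosen one after the other; by the parallelogram law one of the two choices does not
  decrease the quadratic form below the sum of the diagonal terms.\<close>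

lemma exists_signs:
  fixes u :: "'i \<Rightarrow> 'a \<Rightarrow> complex"
  assumes "finite F" and u: "\<And>i. i \<in> F \<Longrightarrow> u i \<in> borel_measurable M" and W [measurable]: "W \<in> borel_measurable M"
  shows "\<exists>eps. (\<forall>i. \<bar>eps i\<bar> = (1::real)) \<and>
    (\<Sum>i\<in>F. \<integral>\<^sup>+z. ennreal ((cmod (u i z))\<^sup>2) * W z \<partial>M)
      \<le> (\<integral>\<^sup>+z. ennreal ((cmod (\<Sum>i\<in>F. of_real (eps i) * u i z))\<^sup>2) * W z \<partial>M)"
  using assms(1) u
proof (induction F)
  case empty
  show ?case by (intro exI[of _ "\<lambda>_. 1"]) simp
next
  case (insert j F)
  have [measurable]: "u i \<in> borel_measurable M" if "i \<in> insert j F" for i using insert.prems that by blast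
  have uj [measurable]: "u j \<in> borel_measurable M" using insert.prems by blast
  obtain eps where eps: "\<And>i. \<bar>eps i\<bar> = (1::real)"
    "(\<Sum>i\<in>F. \<integral>\<^sup>+z. ennreal ((cmod (u i z))\<^sup>2) * W z \<partial>M)
      \<le> (\<integral>\<^sup>+z. ennreal ((cmod (\<Sum>i\<in>F. of_real (eps i) * u i z))\<^sup>2) * W z \<partial>M)"
    using insert.IH insert.prems by auto
  define S where "S z = (\<Sum>i\<in>F. of_real (eps i) * u i z)" for z
  have [measurable]: "S \<in> borel_measurable M"
    unfolding S_def using insert.prems by (intro borel_measurable_sum borel_measurable_times) auto
  let ?q = "\<lambda>v. \<integral>\<^sup>+z. ennreal ((cmod (v z))\<^sup>2) * W z \<partial>M"
  have "?q (\<lambda>z. u j z + S z) + ?q (\<lambda>z. - u j z + S z)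
    = (\<integral>\<^sup>+z. (ennreal ((cmod (u j z))\<^sup>2) * W z + ennreal ((cmod (S z))\<^sup>2) * W z)
        + (ennreal ((cmod (u j z))\<^sup>2) * W z + ennreal ((cmod (S z))\<^sup>2) * W z) \<partial>M)"
  proof (subst nn_integral_add[symmetric])
    have "ennreal ((cmod (b + c))\<^sup>2) + ennreal ((cmod (- b + c))\<^sup>2)
      = (ennreal ((cmod b)\<^sup>2) + ennreal ((cmod c)\<^sup>2)) + (ennreal ((cmod b)\<^sup>2) + ennreal ((cmod c)\<^sup>2))" for b c
    proof -
      have "(cmod (b + c))\<^sup>2 + (cmod (- b + c))\<^sup>2 = ((cmod b)\<^sup>2 + (cmod c)\<^sup>2) + ((cmod b)\<^sup>2 + (cmod c)\<^sup>2)"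
        unfolding cmod_power2 by (simp add: power2_eq_square algebra_simps)
      then show ?thesis by (simp flip: ennreal_plus)
    qed
    then show "(\<integral>\<^sup>+z. ennreal ((cmod (u j z + S z))\<^sup>2) * W z + ennreal ((cmod (- u j z + S z))\<^sup>2) * W z \<partial>M)
      = (\<integral>\<^sup>+z. (ennreal ((cmod (u j z))\<^sup>2) * W z + ennreal ((cmod (S z))\<^sup>2) * W z)
        + (ennreal ((cmod (u j z))\<^sup>2) * W z + ennreal ((cmod (S z))\<^sup>2) * W z) \<partial>M)"
      unfolding distrib_right[symmetric] by simp
  qed measurable
  also have "\<dots> = (?q (u j) + ?q S) + (?q (u j) + ?q S)"
    by (simp add: nn_integral_add)
  finally have par: "?q (\<lambda>z. u j z + S z) + ?q (\<lambda>z. - u j z + S z) = (?q (u j) + ?q S) + (?q (u j) + ?q S)" .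
  have "?q (u j) + ?q S \<le> ?q (\<lambda>z. u j z + S z) \<or> ?q (u j) + ?q S \<le> ?q (\<lambda>z. - u j z + S z)"
  proof (rule ccontr)
    assume "\<not> ?thesis"
    then have "?q (\<lambda>z. u j z + S z) < ?q (u j) + ?q S" "?q (\<lambda>z. - u j z + S z) < ?q (u j) + ?q S"
      by (auto simp: not_le)
    then have "?q (\<lambda>z. u j z + S z) + ?q (\<lambda>z. - u j z + S z) < (?q (u j) + ?q S) + (?q (u j) + ?q S)"
      by (rule add_strict_mono)
    with par show False by simp
  qed
  then obtain s :: real where s: "\<bar>s\<bar> = 1" "?q (u j) + ?q S \<le> ?q (\<lambda>z. of_real s * u j z + S z)"
  proof
    assume "?q (u j) + ?q S \<le> ?q (\<lambda>z. u j z + S z)" then show thesis by (intro that[of 1]) auto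
  next
    assume "?q (u j) + ?q S \<le> ?q (\<lambda>z. - u j z + S z)" then show thesis by (intro that[of "-1"]) auto
  qed
  let ?e = "eps(j := s)"
  have "(\<Sum>i\<in>insert j F. of_real (?e i) * u i z) = of_real s * u j z + S z" for z
  proof -
    have "(\<Sum>i\<in>F. of_real (?e i) * u i z) = S z"
      unfolding S_def using insert.hyps by (intro sum.cong) auto
    then show ?thesis using insert.hyps by (simp del: fun_upd_apply) simp
  qed
  then have "?q (u j) + ?q S \<le> ?q (\<lambda>z. \<Sum>i\<in>insert j F. of_real (?e i) * u i z)" using s(2) by simp
  moreover have "(\<Sum>i\<in>F. ?q (u i)) \<le> ?q S" using eps(2) by (simp add: S_def)
  ultimately have "(\<Sum>i\<in>insert j F. ?q (u i)) \<le> ?q (\<lambda>z. \<Sum>i\<in>insert j F. of_real (?e i) * u i z)"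
    using insert.hyps by (simp del: fun_upd_apply) (meson add_left_mono order_trans)
  moreover have "\<forall>i. \<bar>?e i\<bar> = 1" using eps(1) s(1) by simp
  ultimately show ?case by blast
qed


section \<open>The seminorm and the energies\<close>

lemma enn_powr_half_sq: "(enn_powr x (1/2))\<^sup>2 = x"
proof (cases x)
  case (real r)
  then show ?thesis by (simp add: ennreal_power powr_half_sqrt)
next
  case top then show ?thesis by (simp add: power2_eq_square)
qed

lemma enn_powr_sq_half: "enn_powr (x\<^sup>2) (1/2) = x"
proof (cases x)
  case (real r)
  then show ?thesis by (simp add: ennreal_power powr_half_sqrt)
next
  case top then show ?thesis by (simp add: power2_eq_square)
qed

lemma ennreal_sq_le_iff: "(x :: ennreal) \<le> enn_powr K (1/2) \<longleftrightarrow> x\<^sup>2 \<le> K"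
proof
  assume "x \<le> enn_powr K (1/2)"
  then have "x\<^sup>2 \<le> (enn_powr K (1/2))\<^sup>2" by (rule power_mono) simp
  then show "x\<^sup>2 \<le> K" by (simp add: enn_powr_half_sq)
next
  assume "x\<^sup>2 \<le> K"
  then have *: "enn_powr (x\<^sup>2) (1/2) \<le> enn_powr K (1/2)" by (intro enn_powr_mono) auto
  then show "x \<le> enn_powr K (1/2)" unfolding enn_powr_sq_half .
qed

lemma Qp_seminorm_sq: "(Qp_seminorm p f)\<^sup>2 = (SUP a\<in>unit_disc. energy p f a)"
  unfolding Qp_seminorm_def energy_def by (rule enn_powr_half_sq)

lemma energy_le_seminorm: "a \<in> unit_disc \<Longrightarrow> energy p f a \<le> (Qp_seminorm p f)\<^sup>2"
  unfolding Qp_seminorm_sq by (rule SUP_upper)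

lemma Qp_seminorm_sq_leI: "(\<And>a. a \<in> unit_disc \<Longrightarrow> energy p f a \<le> K) \<Longrightarrow> (Qp_seminorm p f)\<^sup>2 \<le> K"
  unfolding Qp_seminorm_sq by (rule SUP_least)

lemma ennreal_sq_le_1_iff: "(x :: ennreal)\<^sup>2 \<le> 1 \<longleftrightarrow> x \<le> 1"
  using ennreal_sq_le_iff[of x 1] enn_powr_ennreal[of 1 "1/2"] by simp

lemma deriv_cmult_disc:
  assumes "f holomorphic_on unit_disc" "z \<in> unit_disc" shows "deriv (\<lambda>z. c * f z) z = c * deriv f z"
  using assms by (intro deriv_cmult holomorphic_on_imp_differentiable_at[OF _ open_ball])

lemma energy_cmult:
  assumes f: "f holomorphic_on unit_disc"
  shows "energy p (\<lambda>z. c * f z) a = ennreal ((cmod c)\<^sup>2) * energy p f a"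
proof -
  let ?d = "\<lambda>z. ennreal (indicator unit_disc z * (cmod (deriv f z))\<^sup>2)"
  have [measurable]: "?d \<in> borel_measurable borel" using measurable_deriv_sq[OF f] by simp
  have "energy p (\<lambda>z. c * f z) a = (\<integral>\<^sup>+z. ennreal ((cmod c)\<^sup>2) * (?d z * enn_powr (green z a) p) \<partial>area)"
    unfolding energy_def
  proof (rule nn_integral_cong)
    fix z
    show "ennreal ((cmod (deriv (\<lambda>z. c * f z) z))\<^sup>2) * enn_powr (green z a) p * indicator unit_disc z
      = ennreal ((cmod c)\<^sup>2) * (?d z * enn_powr (green z a) p)"
    proof (cases "z \<in> unit_disc")
      case True
      then show ?thesis using deriv_cmult_disc[OF f True, of c]
        by (simp add: norm_mult power_mult_distrib ennreal_mult' mult_ac)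
    qed simp
  qed
  also have "\<dots> = ennreal ((cmod c)\<^sup>2) * (\<integral>\<^sup>+z. ?d z * enn_powr (green z a) p \<partial>area)"
    by (rule nn_integral_cmult) measurable
  also have "(\<integral>\<^sup>+z. ?d z * enn_powr (green z a) p \<partial>area) = energy p f a"
    unfolding energy_def by (intro nn_integral_cong) (simp add: indicator_def)
  finally show ?thesis .
qed

lemma Qp_seminorm_cmult:
  assumes f: "f holomorphic_on unit_disc"
  shows "Qp_seminorm p (\<lambda>z. c * f z) = ennreal (cmod c) * Qp_seminorm p f"
proof -
  have "(Qp_seminorm p (\<lambda>z. c * f z))\<^sup>2 = (ennreal (cmod c) * Qp_seminorm p f)\<^sup>2"
    unfolding power_mult_distrib Qp_seminorm_sq energy_cmult[OF f]
    by (simp add: SUP_mult_left_ennreal ennreal_power)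
  then have "enn_powr ((Qp_seminorm p (\<lambda>z. c * f z))\<^sup>2) (1/2) = enn_powr ((ennreal (cmod c) * Qp_seminorm p f)\<^sup>2) (1/2)"
    by (rule arg_cong)
  then show ?thesis unfolding enn_powr_sq_half .
qed

lemma Qp_seminorm_diff_const:
  assumes f: "f holomorphic_on unit_disc"
  shows "Qp_seminorm p (\<lambda>z. f z - c) = Qp_seminorm p f"
proof -
  have "deriv (\<lambda>z. f z - c) z = deriv f z" if "z \<in> unit_disc" for z
    using holomorphic_on_imp_differentiable_at[OF f open_ball that] by simp
  then have "energy p (\<lambda>z. f z - c) a = energy p f a" for a
    unfolding energy_def by (intro nn_integral_cong) (auto simp: indicator_def)
  then show ?thesis unfolding Qp_seminorm_def energy_def by simp
qed

text \<open>From \<open>log (1/s) \<ge> (1 - s\<^sup>2) / 2\<close> for \<open>s = |\<sigma>\<^sub>b(z)|\<close>.\<close>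

lemma green_ge:
  assumes "cmod b < 1" "cmod z < 1"
  shows "ennreal ((1 - cmod b) * (1 - cmod z) / (2 * (kernel b z)\<^sup>2)) \<le> green z b"
proof (cases "z = b")
  case False
  let ?s = "cmod (disc_aut b z)"
  have s: "?s < 1" by (rule disc_aut_cmod_less[OF assms])
  have "disc_aut b z \<noteq> 0" using False kernel_ge(3)[OF assms] by (auto simp: disc_aut_def)
  then have s0: "0 < ?s" by simp
  have K: "0 < kernel b z" by (rule kernel_ge(3)[OF assms])
  have le: "1 - x \<le> 1 - x\<^sup>2" if "0 \<le> x" "x < 1" for x :: real using that by (simp add: power2_eq_square mult_left_le)
  have "(1 - cmod b) * (1 - cmod z) / (kernel b z)\<^sup>2 \<le> (1 - (cmod b)\<^sup>2) * (1 - (cmod z)\<^sup>2) / (kernel b z)\<^sup>2"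
    using assms le by (intro divide_right_mono mult_mono) (auto simp: abs_square_le_1)
  also have "\<dots> = 1 - ?s\<^sup>2" by (rule disc_aut_cmod[OF assms, symmetric])
  also have "\<dots> \<le> - ln (?s\<^sup>2)" using ln_le_minus_one[of "?s\<^sup>2"] s0 by simp
  also have "\<dots> = 2 * ln (1 / ?s)" using s0 by (simp add: ln_div ln_realpow)
  finally have "(1 - cmod b) * (1 - cmod z) / (2 * (kernel b z)\<^sup>2) \<le> ln (1 / ?s)" by (simp add: field_simps)
  then show ?thesis using False by (simp add: green_def ennreal_leI)
qed (simp add: green_def)

section \<open>Lower bound for the operator norm\<close>

lemma seminorm_comp_le_opnorm:
  assumes "f holomorphic_on unit_disc" "\<And>a. a \<in> unit_disc \<Longrightarrow> energy p f a \<le> 1" "a \<in> unit_disc"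
  shows "energy p (f \<circ> \<phi>) a \<le> (comp_seminorm_opnorm p \<phi>)\<^sup>2"
proof -
  have le: "Qp_seminorm p f \<le> 1"
    using Qp_seminorm_sq_leI[of p f 1] assms(2) by (simp add: ennreal_sq_le_1_iff)
  then have "f \<in> Qp p" using assms(1) by (auto simp: Qp_def le_less_trans)
  then have "Qp_seminorm p (f \<circ> \<phi>) \<le> comp_seminorm_opnorm p \<phi>"
    unfolding comp_seminorm_opnorm_def using le by (intro SUP_upper) auto
  then have "(Qp_seminorm p (f \<circ> \<phi>))\<^sup>2 \<le> (comp_seminorm_opnorm p \<phi>)\<^sup>2" by (rule power_mono) simp
  then show ?thesis using energy_le_seminorm[OF assms(3), of p "f \<circ> \<phi>"] by (rule order_trans[rotated])
qed

context dyadic_tree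
begin

lemma upper_box_eq:
  assumes "I \<in> arcs"
  shows "upper_box I = {z. 1 - arc_length I \<le> cmod z \<and> cmod z < 1 - arc_length I / 2 \<and> (z = 0 \<or> z / of_real (cmod z) \<in> I)}"
    (is "_ = ?R")
proof (intro subset_antisym subsetI)
  have l: "0 < arc_length I" "arc_length I \<le> 1" using arcs_length[OF assms] by auto
  have I1: "\<And>w. w \<in> I \<Longrightarrow> cmod w = 1" using half_open_arc_subset[OF arcs_arc[OF assms]] by auto
  {
    fix z assume "z \<in> upper_box I"
    then obtain r w where z: "z = of_real r * w" "w \<in> I" "1 - arc_length I \<le> r" "r < 1 - arc_length I / 2"
      unfolding upper_box_def by auto
    have r: "0 \<le> r" using z(3) l by simp
    have c: "cmod z = r" using z r I1 by (simp add: norm_mult)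
    have "z / of_real (cmod z) \<in> I" if "z \<noteq> 0"
    proof -
      have "r \<noteq> 0" using that z(1) by auto
      then have "z / of_real r = w" unfolding z(1) by simp
      then show ?thesis using z(2) c by simp
    qed
    then show "z \<in> ?R" using c z by auto
  next
    fix z assume z: "z \<in> ?R"
    show "z \<in> upper_box I"
    proof (cases "z = 0")
      case True
      then have "arc_length I = 1" using z l by simp
      moreover have "z = of_real 0 * arc_point I" using True by simp
      ultimately show ?thesis unfolding upper_box_def using arc_point_in[OF assms] by force
    next
      case False
      then have "z = of_real (cmod z) * (z / of_real (cmod z))" by simp
      then show ?thesis unfolding upper_box_def using z False by blast
    qed
  }
qed

lemma upper_box_borel: "I \<in> arcs \<Longrightarrow> upper_box I \<in> sets borel"
proof -
  assume I: "I \<in> arcs"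
  have [measurable]: "I \<in> sets borel" using I by (rule arcs_borel)
  show ?thesis unfolding upper_box_eq[OF I] by measurable
qed

lemma upper_box_in_disc:
  assumes "I \<in> arcs" "z \<in> upper_box I" shows "cmod z < 1" "1 - cmod z \<le> arc_length I" "arc_length I / 2 < 1 - cmod z"
  using assms arcs_length[OF assms(1)] by (auto simp: upper_box_eq)

lemma upper_box_dist:
  assumes "I \<in> arcs" "z \<in> upper_box I" shows "cmod (z - box_center I) \<le> 10 * arc_length I"
proof -
  obtain r w where z: "z = of_real r * w" "w \<in> I" "1 - arc_length I \<le> r" "r < 1 - arc_length I / 2"
    using assms(2) unfolding upper_box_def by auto
  then have "cmod (of_real (1 - (1 - r)) * w - box_center I) \<le> 10 * arc_length I"
    using arcs_length[OF assms(1)] by (intro box_center_dist assms) auto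
  then show ?thesis using z(1) by simp
qed

lemma kernel_box_le:
  assumes I: "I \<in> arcs" and z: "cmod z < 1" and d: "cmod (z - box_center I) \<le> c * arc_length I"
  shows "kernel (box_center I) z \<le> (c + 1) * arc_length I"
proof -
  let ?w = "box_center I"
  have w: "cmod ?w < 1" by (rule box_center_in_disc[OF I])
  have "kernel ?w z = kernel z ?w" by (rule kernel_commute)
  also have "\<dots> \<le> kernel ?w ?w + cmod (z - ?w)" using w by (intro kernel_perturb) simp
  also have "kernel ?w ?w \<le> arc_length I"
  proof -
    have "1 - cnj ?w * ?w = of_real (1 - (cmod ?w)\<^sup>2)" by (simp add: mult.commute flip: complex_norm_square)
    then have "kernel ?w ?w = 1 - (cmod ?w)\<^sup>2" using w by (simp add: abs_square_le_1 del: of_real_diff)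
    also have "\<dots> \<le> 2 * (1 - cmod ?w)"
      using zero_le_power2[of "1 - cmod ?w"] by (simp add: power2_eq_square algebra_simps)
    finally show ?thesis using cmod_box_center[OF I] by simp
  qed
  finally show ?thesis using d by (simp add: algebra_simps)
qed

text \<open>On the box over \<open>I\<close> the modulus of \<open>1 - z\<^sub>I\<^sup>* z\<close> is at most \<open>11 |I|\<close>.\<close>

lemma bump_lower:
  assumes I: "I \<in> arcs" "0 \<le> x I" and z: "z \<in> upper_box I"
  shows "x I * arc_length I powr (- p - 2) \<le> 11 ^ 8 * (cmod (bump p x I z))\<^sup>2"
proof -
  let ?l = "arc_length I" and ?K = "kernel (box_center I) z"
  have l: "0 < ?l" using arcs_length[OF I(1)] by simp
  have z1: "cmod z < 1" by (rule upper_box_in_disc[OF I(1) z])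
  have K: "0 < ?K" by (rule kernel_box_center[OF I(1) z1])
  have "?K \<le> 11 * ?l" using kernel_box_le[OF I(1) z1 upper_box_dist[OF I(1) z]] by simp
  then have le: "?K ^ 8 \<le> (11 * ?l) ^ 8" using K by (intro power_mono) auto
  have "0 < (11 * ?l) ^ 8 * ?K ^ 8" using K l by (intro mult_pos_pos zero_less_power) auto
  then have "11 ^ 8 / (11 * ?l) ^ 8 \<le> 11 ^ 8 / ?K ^ 8" by (intro divide_left_mono[OF le]) simp_all
  moreover have "0 \<le> x I * ?l powr (6 - p)" using I(2) by simp
  ultimately have "x I * ?l powr (6 - p) * (11 ^ 8 / (11 * ?l) ^ 8) \<le> x I * ?l powr (6 - p) * (11 ^ 8 / ?K ^ 8)"
    by (rule mult_left_mono)
  also have "x I * ?l powr (6 - p) * (11 ^ 8 / (11 * ?l) ^ 8) = x I * (?l powr (6 - p) / ?l powr 8)"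
    using l by (simp add: power_mult_distrib)
  also have "?l powr (6 - p) / ?l powr 8 = ?l powr (- p - 2)"
    unfolding powr_diff[symmetric] by (rule arg_cong[where f = "\<lambda>e. ?l powr e"]) simp
  also have "x I * ?l powr (6 - p) * (11 ^ 8 / ?K ^ 8) = 11 ^ 8 * (cmod (bump p x I z))\<^sup>2"
  proof -
    have "(?l powr (3 - p / 2))\<^sup>2 = ?l powr (6 - p)" by (simp add: power2_eq_square flip: powr_add)
    then show ?thesis using I(2)
      by (simp add: cmod_bump[of x I] power_divide power_mult_distrib flip: power_mult)
  qed
  finally show ?thesis .
qed

end

definition lower_const :: "real \<Rightarrow> real" where
  "lower_const p = 11 ^ 8 * (1 + test_const p)"

context dyadic_tree
begin

text \<open>The test function attached to \<open>x\<close>, normalized, with signs that suit the push-forward measure.\<close>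

lemma carleson_sum_le_opnorm:
  assumes p: "0 < p" "p \<le> 1" and \<phi>: "\<phi> holomorphic_on unit_disc" "\<phi> ` unit_disc \<subseteq> unit_disc"
    and a: "a \<in> unit_disc" and x: "carleson p F x"
  shows "(\<Sum>I\<in>F. box_average p \<phi> a I * ennreal (x I)) \<le> ennreal (lower_const p) * (comp_seminorm_opnorm p \<phi>)\<^sup>2"
proof -
  have F: "finite F" "F \<subseteq> arcs" and x0: "\<And>I. I \<in> F \<Longrightarrow> 0 \<le> x I" using x by (auto simp: carleson_def)
  define \<phi>' where "\<phi>' = (\<lambda>z. if z \<in> unit_disc then \<phi> z else 0)"
  have [measurable]: "\<phi>' \<in> borel_measurable borel"
    unfolding \<phi>'_def using \<phi>(1)
    by (intro borel_measurable_continuous_on_if) (auto intro: holomorphic_on_imp_continuous_on)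
  define W where "W z = ennreal (indicator unit_disc z * (cmod (deriv \<phi> z))\<^sup>2) * enn_powr (green z a) p" for z
  have [measurable]: "(\<lambda>z. ennreal (indicator unit_disc z * (cmod (deriv \<phi> z))\<^sup>2)) \<in> borel_measurable borel"
    using measurable_deriv_sq[OF \<phi>(1)] by simp
  have W [measurable]: "W \<in> borel_measurable area" unfolding W_def by measurable
  have [measurable]: "bump p x I \<in> borel_measurable borel" for I unfolding bump_def by measurable
  define u where "u I z = bump p x I (\<phi>' z)" for I z
  have [measurable]: "u I \<in> borel_measurable area" for I unfolding u_def by measurable
  obtain eps where eps: "\<And>I. \<bar>eps I\<bar> = (1::real)"
    and signs: "(\<Sum>I\<in>F. \<integral>\<^sup>+z. ennreal ((cmod (u I z))\<^sup>2) * W z \<partial>area)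
      \<le> (\<integral>\<^sup>+z. ennreal ((cmod (\<Sum>I\<in>F. of_real (eps I) * u I z))\<^sup>2) * W z \<partial>area)"
    using exists_signs[OF F(1), of u area W] by auto
  obtain f where f: "f holomorphic_on unit_disc"
    "\<And>z. z \<in> unit_disc \<Longrightarrow> deriv f z = (\<Sum>I\<in>F. of_real (eps I) * bump p x I z)"
    using test_function[OF F(2)] by blast
  have T: "0 \<le> test_const p" by (rule test_const_nonneg[OF p(1)])
  define c where "c = 1 / sqrt (1 + test_const p)"
  have c2: "c\<^sup>2 = 1 / (1 + test_const p)" using T by (simp add: c_def power_divide)
  have E: "energy p (\<lambda>z. of_real c * f z) b \<le> 1" if "b \<in> unit_disc" for b
  proof -
    have "energy p (\<lambda>z. of_real c * f z) b = ennreal (1 / (1 + test_const p)) * energy p f b"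
      by (simp add: energy_cmult[OF f(1)] c2)
    also have "\<dots> \<le> ennreal (1 / (1 + test_const p)) * ennreal (test_const p)"
      using that eps by (intro mult_left_mono bump_energy[OF p x _ f]) auto
    also have "\<dots> = ennreal (test_const p / (1 + test_const p))" using T by (simp flip: ennreal_mult)
    also have "\<dots> \<le> 1" using T by (simp add: ennreal_le_1)
    finally show ?thesis .
  qed
  have fc: "(\<lambda>z. of_real c * f z) holomorphic_on unit_disc" using f(1) by (intro holomorphic_intros)
  have comp: "energy p ((\<lambda>z. of_real c * f z) \<circ> \<phi>) a \<le> (comp_seminorm_opnorm p \<phi>)\<^sup>2"
    by (rule seminorm_comp_le_opnorm[OF fc E a])
  have ef: "energy p ((\<lambda>z. of_real c * f z) \<circ> \<phi>) a
      = ennreal (c\<^sup>2) * (\<integral>\<^sup>+z. ennreal ((cmod (\<Sum>I\<in>F. of_real (eps I) * u I z))\<^sup>2) * W z \<partial>area)"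
  proof -
    have fphi: "f \<circ> \<phi> holomorphic_on unit_disc" using f(1) \<phi> by (intro holomorphic_on_compose_gen[of \<phi> unit_disc f unit_disc])
    have "(\<lambda>z. of_real c * f z) \<circ> \<phi> = (\<lambda>z. of_real c * (f \<circ> \<phi>) z)" by auto
    then have "energy p ((\<lambda>z. of_real c * f z) \<circ> \<phi>) a = ennreal (c\<^sup>2) * energy p (f \<circ> \<phi>) a"
      using energy_cmult[OF fphi, of p "of_real c" a] by simp
    also have "energy p (f \<circ> \<phi>) a = (\<integral>\<^sup>+z. ennreal ((cmod (\<Sum>I\<in>F. of_real (eps I) * u I z))\<^sup>2) * W z \<partial>area)"
      unfolding energy_comp[OF f(1) \<phi>]
    proof (rule nn_integral_cong)
      fix z
      show "ennreal ((cmod (deriv f (\<phi> z)))\<^sup>2) * (ennreal ((cmod (deriv \<phi> z))\<^sup>2) * enn_powr (green z a) p) * indicator unit_disc z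
        = ennreal ((cmod (\<Sum>I\<in>F. of_real (eps I) * u I z))\<^sup>2) * W z"
      proof (cases "z \<in> unit_disc")
        case True
        then have "\<phi> z \<in> unit_disc" using \<phi>(2) by blast
        then show ?thesis using True f(2)[of "\<phi> z"] by (simp add: W_def u_def \<phi>'_def)
      qed (simp add: W_def)
    qed
    finally show ?thesis .
  qed
  have each: "box_average p \<phi> a I * ennreal (x I) \<le> ennreal (11 ^ 8) * (\<integral>\<^sup>+z. ennreal ((cmod (u I z))\<^sup>2) * W z \<partial>area)"
    if I: "I \<in> F" for I
  proof -
    have Ia: "I \<in> arcs" using I F by auto
    let ?l = "arc_length I"
    have l: "0 < ?l" using arcs_length[OF Ia] by simp
    have [measurable]: "upper_box I \<in> sets borel" by (rule upper_box_borel[OF Ia])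
    have pm: "pullback_mass p \<phi> a (upper_box I) = (\<integral>\<^sup>+z. indicator (upper_box I) (\<phi>' z) * W z \<partial>area)"
      unfolding pullback_mass_def
      by (intro nn_integral_cong) (auto simp: W_def \<phi>'_def indicator_def)
    have "box_average p \<phi> a I * ennreal (x I) = ennreal (1 / ?l powr (p + 2)) * ennreal (x I) * (\<integral>\<^sup>+z. indicator (upper_box I) (\<phi>' z) * W z \<partial>area)"
      unfolding box_average_def counting_fun_integral[OF \<phi> upper_box_borel[OF Ia]] pm by (simp add: mult_ac)
    also have "ennreal (1 / ?l powr (p + 2)) * ennreal (x I) = ennreal (x I * ?l powr (- p - 2))"
    proof -
      have "1 / ?l powr (p + 2) = ?l powr (- (p + 2))" by (simp only: powr_minus_divide)
      also have "- (p + 2) = - p - 2" by simp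
      finally show ?thesis using x0[OF I] by (simp add: mult.commute flip: ennreal_mult)
    qed
    also have "ennreal (x I * ?l powr (- p - 2)) * (\<integral>\<^sup>+z. indicator (upper_box I) (\<phi>' z) * W z \<partial>area)
        = (\<integral>\<^sup>+z. ennreal (x I * ?l powr (- p - 2)) * (indicator (upper_box I) (\<phi>' z) * W z) \<partial>area)"
      by (rule nn_integral_cmult[symmetric]) measurable
    also have "\<dots> \<le> (\<integral>\<^sup>+z. ennreal (11 ^ 8) * (ennreal ((cmod (u I z))\<^sup>2) * W z) \<partial>area)"
    proof (rule nn_integral_mono)
      fix z
      show "ennreal (x I * ?l powr (- p - 2)) * (indicator (upper_box I) (\<phi>' z) * W z)
        \<le> ennreal (11 ^ 8) * (ennreal ((cmod (u I z))\<^sup>2) * W z)"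
      proof (cases "\<phi>' z \<in> upper_box I")
        case True
        have "ennreal (x I * ?l powr (- p - 2)) \<le> ennreal (11 ^ 8 * (cmod (u I z))\<^sup>2)"
          unfolding u_def by (intro ennreal_leI bump_lower Ia x0 I True)
        also have "\<dots> = ennreal (11 ^ 8) * ennreal ((cmod (u I z))\<^sup>2)" by (rule ennreal_mult') simp
        finally have "ennreal (x I * ?l powr (- p - 2)) * W z \<le> ennreal (11 ^ 8) * ennreal ((cmod (u I z))\<^sup>2) * W z"
          by (rule mult_right_mono) simp
        then show ?thesis using True by (simp add: mult.assoc)
      qed simp
    qed
    also have "\<dots> = ennreal (11 ^ 8) * (\<integral>\<^sup>+z. ennreal ((cmod (u I z))\<^sup>2) * W z \<partial>area)"
      by (rule nn_integral_cmult) measurable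
    finally show ?thesis .
  qed
  have "(\<Sum>I\<in>F. box_average p \<phi> a I * ennreal (x I))
      \<le> (\<Sum>I\<in>F. ennreal (11 ^ 8) * (\<integral>\<^sup>+z. ennreal ((cmod (u I z))\<^sup>2) * W z \<partial>area))"
    by (rule sum_mono[OF each])
  also have "\<dots> \<le> ennreal (11 ^ 8) * (\<integral>\<^sup>+z. ennreal ((cmod (\<Sum>I\<in>F. of_real (eps I) * u I z))\<^sup>2) * W z \<partial>area)"
    unfolding sum_distrib_left[symmetric] by (intro mult_left_mono signs) simp
  also have "\<dots> = ennreal (lower_const p) * energy p ((\<lambda>z. of_real c * f z) \<circ> \<phi>) a"
  proof -
    have "ennreal (lower_const p) * ennreal (c\<^sup>2) = ennreal (lower_const p * c\<^sup>2)"
      using T by (intro ennreal_mult[symmetric]) (auto simp: lower_const_def)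
    also have "lower_const p * c\<^sup>2 = 11 ^ 8"
    proof -
      have "11 ^ 8 * D * (1 / D) = 11 ^ 8" if "D \<noteq> 0" for D :: real using that by simp
      from this[of "1 + test_const p"] show ?thesis unfolding c2 lower_const_def using T by simp
    qed
    finally have "ennreal (lower_const p) * ennreal (c\<^sup>2) = ennreal (11 ^ 8)" .
    then show ?thesis unfolding ef mult.assoc[symmetric] by simp
  qed
  also have "\<dots> \<le> ennreal (lower_const p) * (comp_seminorm_opnorm p \<phi>)\<^sup>2"
    by (intro mult_left_mono comp) simp
  finally show ?thesis .
qed

theorem sup_gauge_le_opnorm:
  assumes p: "0 < p" "p \<le> 1" and \<phi>: "\<phi> holomorphic_on unit_disc" "\<phi> ` unit_disc \<subseteq> unit_disc"
  shows "sup_gauge p \<phi> arcs \<le> ennreal (lower_const p) * (comp_seminorm_opnorm p \<phi>)\<^sup>2"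
  unfolding sup_gauge_def
proof (rule SUP_least)
  fix a assume a: "a \<in> unit_disc"
  have C: "0 < lower_const p" using test_const_nonneg[of p] p by (simp add: lower_const_def)
  show "gauge_Bp p arcs (box_average p \<phi> a) \<le> ennreal (lower_const p) * (comp_seminorm_opnorm p \<phi>)\<^sup>2"
  proof (cases "ennreal (lower_const p) * (comp_seminorm_opnorm p \<phi>)\<^sup>2")
    case (real K)
    show ?thesis unfolding real(2)
    proof (rule gauge_Bp_le_dual)
      fix F x assume "carleson p F x"
      from carleson_sum_le_opnorm[OF p \<phi> a this] real(2)
      show "(\<Sum>I\<in>F. box_average p \<phi> a I * ennreal (x I)) \<le> ennreal K" by simp
    qed (use p real(1) in auto)
  qed simp
qed

end


section \<open>Upper bound for the operator norm\<close>

context dyadic_tree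
begin

text \<open>A hyperbolic neighbourhood of the box over \<open>I\<close>.\<close>

definition box_nbhd :: "complex set \<Rightarrow> complex set" where
  "box_nbhd I = {z \<in> unit_disc. arc_length I / 4 \<le> 1 - cmod z \<and> cmod (z - box_center I) \<le> 11 * arc_length I}"

lemma box_nbhd_borel [measurable]: "box_nbhd I \<in> sets borel"
proof -
  have "box_nbhd I = unit_disc \<inter> {z. arc_length I / 4 \<le> 1 - cmod z \<and> cmod (z - box_center I) \<le> 11 * arc_length I}"
    by (auto simp: box_nbhd_def)
  also have "\<dots> \<in> sets borel" by measurable
  finally show ?thesis .
qed

text \<open>The disc of radius \<open>|I| / 4\<close> around a point of the box lies in the neighbourhood.\<close>

lemma deriv_sq_le_box:
  assumes I: "I \<in> arcs" and \<zeta>: "\<zeta> \<in> upper_box I" and F: "F holomorphic_on unit_disc"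
  shows "ennreal ((cmod (F \<zeta>))\<^sup>2)
    \<le> ennreal (16 / (pi * (arc_length I)\<^sup>2)) * (\<integral>\<^sup>+z\<in>box_nbhd I. ennreal ((cmod (F z))\<^sup>2) \<partial>lborel)"
proof -
  let ?l = "arc_length I"
  have l: "0 < ?l" "?l \<le> 1" using arcs_length[OF I] by auto
  note z = upper_box_in_disc[OF I \<zeta>]
  have sub: "ball \<zeta> (?l / 4) \<subseteq> box_nbhd I"
  proof
    fix v assume "v \<in> ball \<zeta> (?l / 4)"
    then have d: "cmod (v - \<zeta>) < ?l / 4" by (simp add: dist_norm norm_minus_commute)
    have "cmod v \<le> cmod \<zeta> + cmod (v - \<zeta>)" using norm_triangle_ineq[of \<zeta> "v - \<zeta>"] by simp
    then have "?l / 4 \<le> 1 - cmod v" using d z(3) by simp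
    moreover have "cmod (v - box_center I) \<le> cmod (v - \<zeta>) + cmod (\<zeta> - box_center I)"
      using norm_triangle_ineq[of "v - \<zeta>" "\<zeta> - box_center I"] by simp
    ultimately show "v \<in> box_nbhd I"
      using d l upper_box_dist[OF I \<zeta>] by (simp add: box_nbhd_def)
  qed
  have "ball \<zeta> (?l / 4) \<subseteq> unit_disc" using sub by (auto simp: box_nbhd_def)
  then have "ennreal (pi * (?l / 4)\<^sup>2 * (cmod (F \<zeta>))\<^sup>2) \<le> (\<integral>\<^sup>+z\<in>ball \<zeta> (?l / 4). ennreal ((cmod (F z))\<^sup>2) \<partial>lborel)"
    using l by (intro disc_sub_mean_sq holomorphic_on_subset[OF F]) auto
  also have "\<dots> \<le> (\<integral>\<^sup>+z\<in>box_nbhd I. ennreal ((cmod (F z))\<^sup>2) \<partial>lborel)"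
    using sub by (intro nn_integral_mono) (auto simp: indicator_def)
  finally have "ennreal (16 / (pi * ?l\<^sup>2)) * ennreal (pi * (?l / 4)\<^sup>2 * (cmod (F \<zeta>))\<^sup>2)
      \<le> ennreal (16 / (pi * ?l\<^sup>2)) * (\<integral>\<^sup>+z\<in>box_nbhd I. ennreal ((cmod (F z))\<^sup>2) \<partial>lborel)"
    by (rule mult_left_mono) simp
  moreover have "ennreal (16 / (pi * ?l\<^sup>2)) * ennreal (pi * (?l / 4)\<^sup>2 * (cmod (F \<zeta>))\<^sup>2) = ennreal ((cmod (F \<zeta>))\<^sup>2)"
  proof -
    have "ennreal (16 / (pi * ?l\<^sup>2)) * ennreal (pi * (?l / 4)\<^sup>2 * (cmod (F \<zeta>))\<^sup>2)
      = ennreal (16 / (pi * ?l\<^sup>2) * (pi * (?l / 4)\<^sup>2 * (cmod (F \<zeta>))\<^sup>2))"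
      by (rule ennreal_mult[symmetric]) auto
    also have "16 / (pi * ?l\<^sup>2) * (pi * (?l / 4)\<^sup>2 * (cmod (F \<zeta>))\<^sup>2) = (cmod (F \<zeta>))\<^sup>2"
      using l by (simp add: power_divide)
    finally show ?thesis .
  qed
  ultimately show ?thesis by simp
qed

end

definition overlap_const :: real where
  "overlap_const = 82944 * schur_const 1"

lemma overlap_const_pos: "0 < overlap_const"
  unfolding overlap_const_def schur_const_def by (simp add: powr_less_one)

context dyadic_tree
begin

text \<open>The neighbourhoods have bounded overlap, which is again a consequence of the Schur test.\<close>

lemma box_nbhd_overlap:
  assumes F: "finite F" "F \<subseteq> arcs" and z: "cmod z < 1"
  shows "(\<Sum>I\<in>F. indicator (box_nbhd I) z) \<le> overlap_const"
proof -
  have "(\<Sum>I\<in>F. indicator (box_nbhd I) z :: real)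
    \<le> (\<Sum>I\<in>F. 82944 * (1 - cmod z) * (arc_length I powr (4 - 1) / kernel (box_center I) z ^ 4))"
  proof (rule sum_mono)
    fix I assume "I \<in> F"
    then have I: "I \<in> arcs" using F by auto
    let ?l = "arc_length I" and ?K = "kernel (box_center I) z"
    have l: "0 < ?l" using arcs_length[OF I] by simp
    have K: "0 < ?K" by (rule kernel_box_center[OF I z])
    show "indicator (box_nbhd I) z \<le> 82944 * (1 - cmod z) * (?l powr (4 - 1) / ?K ^ 4)"
    proof (cases "z \<in> box_nbhd I")
      case True
      then have n: "?l / 4 \<le> 1 - cmod z" "cmod (z - box_center I) \<le> 11 * ?l" by (auto simp: box_nbhd_def)
      have "?K \<le> 12 * ?l" using kernel_box_le[OF I z n(2)] by simp
      then have "?K ^ 4 \<le> (12 * ?l) ^ 4" using K by (intro power_mono) auto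
      also have "\<dots> = 82944 * (?l / 4) * ?l ^ 3" by (simp add: power_mult_distrib eval_nat_numeral)
      also have "\<dots> \<le> 82944 * (1 - cmod z) * ?l ^ 3"
        using n(1) l by (intro mult_right_mono mult_left_mono) auto
      finally have "1 \<le> 82944 * (1 - cmod z) * ?l ^ 3 / ?K ^ 4" using K by (simp add: field_simps)
      then show ?thesis using True l by simp
    next
      case False
      then show ?thesis using z by (simp add: divide_nonneg_nonneg)
    qed
  qed
  also have "\<dots> = 82944 * (1 - cmod z) * (\<Sum>I\<in>F. arc_length I powr (4 - 1) / kernel (box_center I) z ^ 4)"
    by (simp add: sum_distrib_left)
  also have "\<dots> \<le> 82944 * (1 - cmod z) * (schur_const 1 * (1 - cmod z) powr (- 1))"
    using z by (intro mult_left_mono schur_sum F) auto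
  also have "\<dots> = overlap_const"
  proof -
    have "(1 - cmod z) * (1 - cmod z) powr (- 1) = 1" using z by (simp add: powr_minus)
    moreover have "82944 * (1 - cmod z) * (schur_const 1 * (1 - cmod z) powr (- 1))
      = 82944 * schur_const 1 * ((1 - cmod z) * (1 - cmod z) powr (- 1))" by (simp only: mult_ac)
    ultimately show ?thesis by (simp add: overlap_const_def)
  qed
  finally show ?thesis .
qed

text \<open>Below \<open>J\<close> the Green function with pole at \<open>z\<^sub>J\<close> is at least of the order \<open>|I| / |J|\<close>; this is what
  turns a bound of the energies into a Carleson condition.\<close>

lemma green_ge_box:
  assumes p: "0 < p" "p \<le> 1" and IJ: "I \<in> arcs" "J \<in> arcs" "I \<subseteq> J" and z: "z \<in> box_nbhd I"
  shows "ennreal (arc_length I powr p) \<le> ennreal (7744 * arc_length J powr p) * enn_powr (green z (box_center J)) p"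
proof -
  let ?l = "arc_length I" and ?L = "arc_length J" and ?b = "box_center J"
  have l: "0 < ?l" "0 < ?L" "?l \<le> ?L" using arcs_length IJ arc_length_mono by auto
  have z1: "cmod z < 1" "?l / 4 \<le> 1 - cmod z" "cmod (z - box_center I) \<le> 11 * ?l" using z by (auto simp: box_nbhd_def)
  have b: "cmod ?b < 1" by (rule box_center_in_disc[OF IJ(2)])
  have "cmod (z - ?b) \<le> cmod (z - box_center I) + cmod (box_center I - ?b)"
    using norm_triangle_ineq[of "z - box_center I" "box_center I - ?b"] by simp
  then have "cmod (z - ?b) \<le> 21 * ?L" using z1(3) l(3) box_center_dist_arcs[OF IJ] by linarith
  then have K: "kernel ?b z \<le> 22 * ?L" using kernel_box_le[OF IJ(2) z1(1), of 21] by simp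
  have K0: "0 < kernel ?b z" by (rule kernel_box_center[OF IJ(2) z1(1)])
  have "?l / (7744 * ?L) = (?L / 2) * (?l / 4) / (2 * (22 * ?L)\<^sup>2)"
    using l by (simp add: power2_eq_square field_simps)
  also have "\<dots> \<le> (1 - cmod ?b) * (1 - cmod z) / (2 * (kernel ?b z)\<^sup>2)"
  proof (rule frac_le)
    show "2 * (kernel ?b z)\<^sup>2 \<le> 2 * (22 * ?L)\<^sup>2" using K K0 by (intro mult_left_mono power_mono) auto
    show "?L / 2 * (?l / 4) \<le> (1 - cmod ?b) * (1 - cmod z)"
      using z1 l cmod_box_center[OF IJ(2)] by (intro mult_mono) auto
    show "0 \<le> (1 - cmod ?b) * (1 - cmod z)" using b z1 by simp
    show "0 < 2 * (kernel ?b z)\<^sup>2" using K0 by simp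
  qed
  finally have "ennreal (?l / (7744 * ?L)) \<le> green z ?b"
    using green_ge[OF b z1(1)] by (meson ennreal_leI order_trans)
  then have "enn_powr (ennreal (?l / (7744 * ?L))) p \<le> enn_powr (green z ?b) p"
    using p by (intro enn_powr_mono) auto
  then have g: "ennreal ((?l / (7744 * ?L)) powr p) \<le> enn_powr (green z ?b) p" using l by simp
  have "?l powr p = 7744 powr p * ?L powr p * (?l / (7744 * ?L)) powr p"
    using l by (simp add: powr_divide powr_mult)
  also have "\<dots> \<le> 7744 * ?L powr p * (?l / (7744 * ?L)) powr p"
    using powr_mono[of p 1 7744] p by (intro mult_right_mono) auto
  finally have "ennreal (?l powr p) \<le> ennreal (7744 * ?L powr p * (?l / (7744 * ?L)) powr p)" by (rule ennreal_leI)
  also have "\<dots> = ennreal (7744 * ?L powr p) * ennreal ((?l / (7744 * ?L)) powr p)" by (rule ennreal_mult) auto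
  also have "\<dots> \<le> ennreal (7744 * ?L powr p) * enn_powr (green z ?b) p" by (intro mult_left_mono g) simp
  finally show ?thesis .
qed

end

definition upper_const :: real where
  "upper_const = 16 * 7744 * overlap_const"

context dyadic_tree
begin

text \<open>The \<open>p\<close>-Carleson property of \<open>|f'|\<^sup>2 (1 - |z|)\<^sup>p dA\<close> at \<open>J\<close> is read off from the energy at the pole \<open>z\<^sub>J\<close>.\<close>

lemma energy_carleson:
  assumes p: "0 < p" "p \<le> 1" and f: "f holomorphic_on unit_disc"
    and J: "J \<in> arcs" and F: "finite F" "F \<subseteq> arcs"
  shows "(\<Sum>I\<in>{I \<in> F. I \<subseteq> J}. ennreal (16 / pi * arc_length I powr p)
      * (\<integral>\<^sup>+z\<in>box_nbhd I. ennreal ((cmod (deriv f z))\<^sup>2) \<partial>lborel))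
    \<le> ennreal (upper_const * arc_length J powr p) * energy p f (box_center J)"
proof -
  let ?F = "{I \<in> F. I \<subseteq> J}" and ?g = "\<lambda>z. enn_powr (green z (box_center J)) p"
  let ?d = "\<lambda>z. ennreal (indicator unit_disc z * (cmod (deriv f z))\<^sup>2)"
  have [measurable]: "?d \<in> borel_measurable borel" using measurable_deriv_sq[OF f] by simp
  have pos: "0 < overlap_const" by (rule overlap_const_pos)
  have d: "(\<integral>\<^sup>+z\<in>box_nbhd I. ennreal ((cmod (deriv f z))\<^sup>2) \<partial>lborel) = (\<integral>\<^sup>+z. ?d z * indicator (box_nbhd I) z \<partial>lborel)" for I
    by (intro nn_integral_cong) (auto simp: box_nbhd_def indicator_def)
  have pt: "(\<Sum>I\<in>?F. ennreal (arc_length I powr p) * indicator (box_nbhd I) z)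
      \<le> ennreal (7744 * overlap_const * arc_length J powr p) * ?g z" if z: "cmod z < 1" for z
  proof -
    have "(\<Sum>I\<in>?F. ennreal (arc_length I powr p) * indicator (box_nbhd I) z)
      \<le> (\<Sum>I\<in>?F. ennreal (7744 * arc_length J powr p) * ?g z * ennreal (indicator (box_nbhd I) z))"
    proof (rule sum_mono)
      fix I assume I: "I \<in> ?F"
      then have "I \<in> arcs" "I \<subseteq> J" using F by auto
      then show "ennreal (arc_length I powr p) * indicator (box_nbhd I) z
        \<le> ennreal (7744 * arc_length J powr p) * ?g z * ennreal (indicator (box_nbhd I) z)"
        using green_ge_box[OF p _ J] by (cases "z \<in> box_nbhd I") auto
    qed
    also have "\<dots> = ennreal (7744 * arc_length J powr p) * ?g z * ennreal (\<Sum>I\<in>?F. indicator (box_nbhd I) z)"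
      by (simp add: sum_distrib_left[symmetric] sum_ennreal)
    also have "\<dots> \<le> ennreal (7744 * arc_length J powr p) * ?g z * ennreal overlap_const"
      using F z by (intro mult_left_mono ennreal_leI box_nbhd_overlap) auto
    also have "\<dots> = ennreal (7744 * arc_length J powr p) * ennreal overlap_const * ?g z" by (simp add: mult_ac)
    also have "ennreal (7744 * arc_length J powr p) * ennreal overlap_const = ennreal (7744 * overlap_const * arc_length J powr p)"
      using pos by (subst ennreal_mult[symmetric]) (auto simp: mult_ac)
    finally show ?thesis .
  qed
  have "(\<Sum>I\<in>?F. ennreal (16 / pi * arc_length I powr p) * (\<integral>\<^sup>+z\<in>box_nbhd I. ennreal ((cmod (deriv f z))\<^sup>2) \<partial>lborel))
    = (\<Sum>I\<in>?F. ennreal (16 / pi) * (\<integral>\<^sup>+z. ?d z * (ennreal (arc_length I powr p) * indicator (box_nbhd I) z) \<partial>lborel))"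
  proof (rule sum.cong[OF refl])
    fix I assume "I \<in> ?F"
    have "(\<integral>\<^sup>+z. ?d z * (ennreal (arc_length I powr p) * indicator (box_nbhd I) z) \<partial>lborel)
      = (\<integral>\<^sup>+z. ennreal (arc_length I powr p) * (?d z * indicator (box_nbhd I) z) \<partial>lborel)"
      by (simp add: mult_ac)
    also have "\<dots> = ennreal (arc_length I powr p) * (\<integral>\<^sup>+z. ?d z * indicator (box_nbhd I) z \<partial>lborel)"
      by (rule nn_integral_cmult) measurable
    finally show "ennreal (16 / pi * arc_length I powr p) * (\<integral>\<^sup>+z\<in>box_nbhd I. ennreal ((cmod (deriv f z))\<^sup>2) \<partial>lborel)
      = ennreal (16 / pi) * (\<integral>\<^sup>+z. ?d z * (ennreal (arc_length I powr p) * indicator (box_nbhd I) z) \<partial>lborel)"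
      unfolding d by (subst ennreal_mult) (auto simp: mult.assoc)
  qed
  also have "\<dots> = ennreal (16 / pi) * (\<integral>\<^sup>+z. (\<Sum>I\<in>?F. ?d z * (ennreal (arc_length I powr p) * indicator (box_nbhd I) z)) \<partial>lborel)"
    by (subst nn_integral_sum) (auto simp: sum_distrib_left)
  also have "\<dots> \<le> ennreal (16 / pi) * (\<integral>\<^sup>+z. ennreal (7744 * overlap_const * arc_length J powr p) * (?d z * ?g z) \<partial>lborel)"
  proof (intro mult_left_mono nn_integral_mono)
    fix z
    show "(\<Sum>I\<in>?F. ?d z * (ennreal (arc_length I powr p) * indicator (box_nbhd I) z))
      \<le> ennreal (7744 * overlap_const * arc_length J powr p) * (?d z * ?g z)"
    proof (cases "z \<in> unit_disc")
      case True
      then have "?d z * (\<Sum>I\<in>?F. ennreal (arc_length I powr p) * indicator (box_nbhd I) z)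
        \<le> ?d z * (ennreal (7744 * overlap_const * arc_length J powr p) * ?g z)"
        by (intro mult_left_mono pt) auto
      then show ?thesis unfolding sum_distrib_left[symmetric] by (simp add: mult.left_commute)
    qed simp
  qed simp
  also have "\<dots> = ennreal (16 / pi) * (ennreal (7744 * overlap_const * arc_length J powr p) * (\<integral>\<^sup>+z. ?d z * ?g z \<partial>lborel))"
    by (subst nn_integral_cmult) auto
  also have "\<dots> = ennreal (upper_const * arc_length J powr p) * energy p f (box_center J)"
  proof -
    have "ennreal (16 / pi) = ennreal 16 * ennreal (1 / pi)" by (subst ennreal_mult[symmetric]) auto
    moreover have "ennreal (upper_const * arc_length J powr p) = ennreal 16 * ennreal (7744 * overlap_const * arc_length J powr p)"
      using pos by (subst ennreal_mult[symmetric]) (auto simp: upper_const_def mult_ac)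
    ultimately show ?thesis unfolding energy_lborel[OF f] by (simp only: mult_ac)
  qed
  finally show ?thesis .
qed

lemma disc_in_upper_box:
  assumes z: "z \<in> unit_disc" obtains k I where "I \<in> level k" "z \<in> upper_box I"
proof -
  obtain k :: nat where k: "1 / 2 ^ Suc k < 1 - cmod z" "1 - cmod z \<le> 1 / 2 ^ k"
    using dyadic_bracket[of "1 - cmod z"] z by auto
  obtain w where w: "w \<in> unit_circle" "z = of_real (cmod z) * w"
  proof (cases "z = 0")
    case True then show thesis by (intro that[of 1]) auto
  next
    case False then show thesis by (intro that[of "z / of_real (cmod z)"]) (auto simp: norm_divide)
  qed
  obtain I where I: "I \<in> level k" "w \<in> I" using level_cover[OF w(1)] by blast
  have "z \<in> upper_box I" unfolding upper_box_def level_length[OF I(1)] using w(2) I(2) k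
    by (intro CollectI exI[of _ "cmod z"] exI[of _ w]) auto
  with I(1) show thesis by (rule that)
qed

text \<open>Summation by parts over the tree: each \<open>\<lambda>\<^sub>J\<close> is multiplied by the Carleson mass below \<open>J\<close>. The sums are
  truncated to finitely many generations, which contain all ancestors of their members.\<close>

lemma energy_comp_le_cover:
  assumes p: "0 < p" "p \<le> 1" and \<phi>: "\<phi> holomorphic_on unit_disc" "\<phi> ` unit_disc \<subseteq> unit_disc"
    and f: "f holomorphic_on unit_disc" and E: "\<And>b. b \<in> unit_disc \<Longrightarrow> energy p f b \<le> 1"
    and lam0: "\<And>J. J \<in> arcs \<Longrightarrow> 0 \<le> lam J"
    and cov: "\<And>I. I \<in> arcs \<Longrightarrow> box_average p \<phi> a I \<le> (\<Sum>\<^sub>\<infinity>J\<in>{J\<in>arcs. I \<subseteq> J}. ennreal (lam J))"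
  shows "energy p (f \<circ> \<phi>) a \<le> ennreal upper_const * (\<Sum>\<^sub>\<infinity>J\<in>arcs. ennreal (lam J * arc_length J powr p))"
    (is "_ \<le> _ * ?total")
proof -
  define N where "N I = (\<integral>\<^sup>+z\<in>box_nbhd I. ennreal ((cmod (deriv f z))\<^sup>2) \<partial>lborel)" for I
  define B where "B I = ennreal (16 / (pi * (arc_length I)\<^sup>2)) * N I" for I
  have df: "deriv f holomorphic_on unit_disc" using f by (intro holomorphic_deriv) auto
  define \<phi>' where "\<phi>' = (\<lambda>z. if z \<in> unit_disc then \<phi> z else 0)"
  have [measurable]: "\<phi>' \<in> borel_measurable borel"
    unfolding \<phi>'_def using \<phi>(1)
    by (intro borel_measurable_continuous_on_if) (auto intro: holomorphic_on_imp_continuous_on)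
  define W where "W z = ennreal (indicator unit_disc z * (cmod (deriv \<phi> z))\<^sup>2) * enn_powr (green z a) p" for z
  have [measurable]: "(\<lambda>z. ennreal (indicator unit_disc z * (cmod (deriv \<phi> z))\<^sup>2)) \<in> borel_measurable borel"
    using measurable_deriv_sq[OF \<phi>(1)] by simp
  have W [measurable]: "W \<in> borel_measurable area" unfolding W_def by measurable
  let ?t = "\<lambda>I. B I * pullback_mass p \<phi> a (upper_box I)"
  have pm: "pullback_mass p \<phi> a (upper_box I) = (\<integral>\<^sup>+z. indicator (upper_box I) (\<phi>' z) * W z \<partial>area)" for I
    unfolding pullback_mass_def
    by (intro nn_integral_cong) (auto simp: W_def \<phi>'_def indicator_def)
  have box_meas [measurable]: "(\<lambda>z. indicator (upper_box I) (\<phi>' z) * W z) \<in> borel_measurable area" if "I \<in> arcs" for I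
  proof -
    have [measurable]: "upper_box I \<in> sets borel" by (rule upper_box_borel[OF that])
    show ?thesis by measurable
  qed
  have term_meas: "(\<lambda>z. B I * (indicator (upper_box I) (\<phi>' z) * W z)) \<in> borel_measurable area" if "I \<in> arcs" for I
    using box_meas[OF that] by measurable
  have "energy p (f \<circ> \<phi>) a \<le> (\<integral>\<^sup>+z. (\<Sum>k. \<Sum>I\<in>level k. B I * (indicator (upper_box I) (\<phi>' z) * W z)) \<partial>area)"
    unfolding energy_comp[OF f \<phi>]
  proof (rule nn_integral_mono)
    fix z
    show "ennreal ((cmod (deriv f (\<phi> z)))\<^sup>2) * (ennreal ((cmod (deriv \<phi> z))\<^sup>2) * enn_powr (green z a) p) * indicator unit_disc z
      \<le> (\<Sum>k. \<Sum>I\<in>level k. B I * (indicator (upper_box I) (\<phi>' z) * W z))"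
    proof (cases "z \<in> unit_disc")
      case True
      then have "\<phi> z \<in> unit_disc" using \<phi>(2) by blast
      then obtain k I where I: "I \<in> level k" "\<phi> z \<in> upper_box I" by (rule disc_in_upper_box)
      have "ennreal ((cmod (deriv f (\<phi> z)))\<^sup>2) \<le> B I"
        unfolding B_def N_def by (rule deriv_sq_le_box[OF level_in_arcs[OF I(1)] I(2) df])
      then have "ennreal ((cmod (deriv f (\<phi> z)))\<^sup>2) * (ennreal ((cmod (deriv \<phi> z))\<^sup>2) * enn_powr (green z a) p) \<le> B I * W z"
        unfolding W_def using True by (simp add: mult_right_mono)
      also have "\<dots> = B I * (indicator (upper_box I) (\<phi>' z) * W z)" using True I(2) by (simp add: \<phi>'_def)
      also have "\<dots> \<le> (\<Sum>I\<in>level k. B I * (indicator (upper_box I) (\<phi>' z) * W z))"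
        using I(1) finite_level by (intro member_le_sum) auto
      also have "\<dots> = (\<Sum>k\<in>{k}. \<Sum>I\<in>level k. B I * (indicator (upper_box I) (\<phi>' z) * W z))" by simp
      also have "\<dots> \<le> (\<Sum>k. \<Sum>I\<in>level k. B I * (indicator (upper_box I) (\<phi>' z) * W z))"
        by (intro sum_le_suminf) auto
      finally show ?thesis using True by simp
    qed simp
  qed
  also have "\<dots> = (\<Sum>k. \<integral>\<^sup>+z. (\<Sum>I\<in>level k. B I * (indicator (upper_box I) (\<phi>' z) * W z)) \<partial>area)"
    by (intro nn_integral_suminf borel_measurable_sum term_meas) (auto intro: level_in_arcs)
  also have "\<dots> = (\<Sum>k. \<Sum>I\<in>level k. ?t I)"
  proof (rule suminf_cong)
    fix k
    have "(\<integral>\<^sup>+z. (\<Sum>I\<in>level k. B I * (indicator (upper_box I) (\<phi>' z) * W z)) \<partial>area)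
      = (\<Sum>I\<in>level k. \<integral>\<^sup>+z. B I * (indicator (upper_box I) (\<phi>' z) * W z) \<partial>area)"
      by (intro nn_integral_sum term_meas) (auto intro: level_in_arcs)
    also have "\<dots> = (\<Sum>I\<in>level k. ?t I)"
      unfolding pm by (intro sum.cong refl nn_integral_cmult box_meas) (auto intro: level_in_arcs)
    finally show "(\<integral>\<^sup>+z. (\<Sum>I\<in>level k. B I * (indicator (upper_box I) (\<phi>' z) * W z)) \<partial>area) = (\<Sum>I\<in>level k. ?t I)" .
  qed
  also have "\<dots> \<le> ennreal upper_const * ?total"
  proof (rule suminf_le_const[OF summableI])
    fix n
    define F where "F = (\<Union>k\<in>{..<n}. level k)"
    have F: "finite F" "F \<subseteq> arcs" by (auto simp: F_def finite_level intro: level_in_arcs)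
    have anc: "{J \<in> arcs. I \<subseteq> J} = {J \<in> F. I \<subseteq> J}" if IF: "I \<in> F" for I
    proof -
      obtain k where k: "k < n" "I \<in> level k" using IF by (auto simp: F_def)
      have "J \<in> F" if J: "J \<in> arcs" "I \<subseteq> J" for J
      proof -
        obtain j where j: "J \<in> level j" using J by (auto simp: arcs_def)
        then have "j \<le> k" using level_mono[OF k(2) j J(2)] by simp
        then show ?thesis using j k by (auto simp: F_def)
      qed
      then show ?thesis using F by auto
    qed
    let ?c = "\<lambda>I. ennreal (16 / pi * arc_length I powr p) * N I"
    have t: "?t I \<le> (\<Sum>J\<in>{J \<in> F. I \<subseteq> J}. ?c I * ennreal (lam J))" if I: "I \<in> F" for I
    proof -
      have Ia: "I \<in> arcs" using I F by auto
      let ?l = "arc_length I"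
      have l: "0 < ?l" using arcs_length[OF Ia] by simp
      have "pullback_mass p \<phi> a (upper_box I) = ennreal (?l powr (p + 2)) * box_average p \<phi> a I"
      proof -
        have "ennreal (?l powr (p + 2)) * ennreal (1 / ?l powr (p + 2)) = 1"
          using l by (subst ennreal_mult[symmetric]) auto
        then show ?thesis
          unfolding box_average_def counting_fun_integral[OF \<phi> upper_box_borel[OF Ia]] mult.assoc[symmetric] by simp
      qed
      then have "?t I = ennreal (16 / (pi * ?l\<^sup>2)) * ennreal (?l powr (p + 2)) * N I * box_average p \<phi> a I"
        by (simp add: B_def mult_ac)
      also have "ennreal (16 / (pi * ?l\<^sup>2)) * ennreal (?l powr (p + 2)) = ennreal (16 / pi * ?l powr p)"
      proof -
        have "16 / (pi * ?l\<^sup>2) * ?l powr (p + 2) = 16 / pi * ?l powr p"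
          using l by (simp add: powr_add)
        then show ?thesis by (subst ennreal_mult[symmetric]) auto
      qed
      also have "\<dots> * N I * box_average p \<phi> a I \<le> ?c I * (\<Sum>J\<in>{J \<in> F. I \<subseteq> J}. ennreal (lam J))"
        using cov[OF Ia] finite_ancestors[OF Ia] unfolding anc[OF I] by (intro mult_left_mono) auto
      finally show ?thesis by (simp add: sum_distrib_left)
    qed
    have "(\<Sum>k<n. \<Sum>I\<in>level k. ?t I) = (\<Sum>I\<in>F. ?t I)"
      unfolding F_def by (rule sum.UNION_disjoint[symmetric]) (auto simp: finite_level dest: level_unique)
    also have "\<dots> \<le> (\<Sum>I\<in>F. \<Sum>J\<in>{J \<in> F. I \<subseteq> J}. ?c I * ennreal (lam J))" by (rule sum_mono[OF t])
    also have "\<dots> = (\<Sum>J\<in>F. \<Sum>I\<in>{I \<in> F. I \<subseteq> J}. ?c I * ennreal (lam J))"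
      by (rule sum.swap_restrict) (use F in auto)
    also have "\<dots> \<le> (\<Sum>J\<in>F. ennreal upper_const * ennreal (lam J * arc_length J powr p))"
    proof (rule sum_mono)
      fix J assume "J \<in> F"
      then have J: "J \<in> arcs" using F by auto
      have "(\<Sum>I\<in>{I \<in> F. I \<subseteq> J}. ?c I * ennreal (lam J)) = (\<Sum>I\<in>{I \<in> F. I \<subseteq> J}. ?c I) * ennreal (lam J)"
        by (simp add: sum_distrib_right)
      also have "\<dots> \<le> ennreal (upper_const * arc_length J powr p) * energy p f (box_center J) * ennreal (lam J)"
        unfolding N_def by (intro mult_right_mono energy_carleson p f J F) simp
      also have "\<dots> \<le> ennreal (upper_const * arc_length J powr p) * 1 * ennreal (lam J)"
        using box_center_in_disc[OF J] by (intro mult_right_mono mult_left_mono E) auto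
      also have "\<dots> = ennreal upper_const * ennreal (lam J * arc_length J powr p)"
        using lam0[OF J] overlap_const_pos by (simp add: upper_const_def ennreal_mult mult_ac flip: ennreal_mult)
      finally show "(\<Sum>I\<in>{I \<in> F. I \<subseteq> J}. ?c I * ennreal (lam J)) \<le> ennreal upper_const * ennreal (lam J * arc_length J powr p)" .
    qed
    also have "\<dots> = ennreal upper_const * (\<Sum>J\<in>F. ennreal (lam J * arc_length J powr p))"
      by (simp add: sum_distrib_left)
    also have "\<dots> \<le> ennreal upper_const * ?total"
      using F by (intro mult_left_mono) (auto simp: nonneg_infsum_complete intro!: SUP_upper)
    finally show "(\<Sum>k<n. \<Sum>I\<in>level k. ?t I) \<le> ennreal upper_const * ?total" .
  qed
  finally show ?thesis .
qed

theorem opnorm_le_sup_gauge: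
  assumes p: "0 < p" "p \<le> 1" and \<phi>: "\<phi> holomorphic_on unit_disc" "\<phi> ` unit_disc \<subseteq> unit_disc"
  shows "(comp_seminorm_opnorm p \<phi>)\<^sup>2 \<le> ennreal upper_const * sup_gauge p \<phi> arcs"
proof -
  have C: "0 < upper_const" using overlap_const_pos by (simp add: upper_const_def)
  have "comp_seminorm_opnorm p \<phi> \<le> enn_powr (ennreal upper_const * sup_gauge p \<phi> arcs) (1/2)"
    unfolding comp_seminorm_opnorm_def
  proof (rule SUP_least)
    fix f assume "f \<in> {f \<in> Qp p. Qp_seminorm p f \<le> 1}"
    then have f: "f holomorphic_on unit_disc" "Qp_seminorm p f \<le> 1" by (auto simp: Qp_def)
    have E: "energy p f b \<le> 1" if "b \<in> unit_disc" for b
      using energy_le_seminorm[OF that, of p f] f(2) ennreal_sq_le_1_iff by (meson order_trans)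
    show "Qp_seminorm p (f \<circ> \<phi>) \<le> enn_powr (ennreal upper_const * sup_gauge p \<phi> arcs) (1/2)"
      unfolding ennreal_sq_le_iff
    proof (rule Qp_seminorm_sq_leI)
      fix a assume a: "a \<in> unit_disc"
      have "ennreal (1 / upper_const) * energy p (f \<circ> \<phi>) a \<le> gauge_Bp p arcs (box_average p \<phi> a)"
        unfolding gauge_Bp_def
      proof (rule Inf_greatest, clarify)
        fix lam assume lam: "\<forall>J\<in>arcs. 0 \<le> lam J"
          "\<forall>I\<in>arcs. box_average p \<phi> a I \<le> (\<Sum>\<^sub>\<infinity>J\<in>{J \<in> arcs. I \<subseteq> J}. ennreal (lam J))"
        have "ennreal (1 / upper_const) * energy p (f \<circ> \<phi>) a
          \<le> ennreal (1 / upper_const) * (ennreal upper_const * (\<Sum>\<^sub>\<infinity>J\<in>arcs. ennreal (lam J * arc_length J powr p)))"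
          using lam by (intro mult_left_mono energy_comp_le_cover p \<phi> f E) auto
        also have "\<dots> = (ennreal (1 / upper_const) * ennreal upper_const) * (\<Sum>\<^sub>\<infinity>J\<in>arcs. ennreal (lam J * arc_length J powr p))"
          by (simp only: mult.assoc)
        also have "ennreal (1 / upper_const) * ennreal upper_const = 1"
          using C by (subst ennreal_mult[symmetric]) auto
        finally show "ennreal (1 / upper_const) * energy p (f \<circ> \<phi>) a \<le> (\<Sum>\<^sub>\<infinity>J\<in>arcs. ennreal (lam J * arc_length J powr p))"
          by (simp only: mult_1)
      qed
      also have "\<dots> \<le> sup_gauge p \<phi> arcs" unfolding sup_gauge_def using a by (rule SUP_upper)
      finally have "ennreal upper_const * (ennreal (1 / upper_const) * energy p (f \<circ> \<phi>) a) \<le> ennreal upper_const * sup_gauge p \<phi> arcs"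
        by (rule mult_left_mono) simp
      moreover have "ennreal upper_const * ennreal (1 / upper_const) = 1"
        using C by (subst ennreal_mult[symmetric]) auto
      ultimately show "energy p (f \<circ> \<phi>) a \<le> ennreal upper_const * sup_gauge p \<phi> arcs"
        by (simp flip: mult.assoc)
    qed
  qed
  then show ?thesis by (simp only: ennreal_sq_le_iff)
qed

end


section \<open>The standard dyadic system\<close>

definition circle_param :: "real \<Rightarrow> complex" where
  "circle_param t = cis (2 * pi * t)"

lemma inj_on_circle_param: "inj_on circle_param {0..<1}"
proof (rule inj_onI)
  fix s t :: real assume st: "s \<in> {0..<1}" "t \<in> {0..<1}" "circle_param s = circle_param t"
  have "\<i> * of_real (2 * pi * s) = \<i> * of_real (2 * pi * t)"
  proof (rule exp_complex_eqI)
    have "\<bar>s - t\<bar> < 1" using st by auto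
    then have "2 * pi * \<bar>s - t\<bar> < 2 * pi * 1" by (intro mult_strict_left_mono) auto
    moreover have "2 * pi * \<bar>s - t\<bar> = \<bar>2 * pi * s - 2 * pi * t\<bar>"
      by (simp add: abs_mult flip: right_diff_distrib)
    ultimately show "\<bar>Im (\<i> * of_real (2 * pi * s)) - Im (\<i> * of_real (2 * pi * t))\<bar> < 2 * pi" by simp
    show "exp (\<i> * of_real (2 * pi * s)) = exp (\<i> * of_real (2 * pi * t))"
      using st(3) by (simp only: circle_param_def cis_conv_exp)
  qed
  then show "s = t" by (simp del: of_real_mult)
qed

lemma range_circle_param: "circle_param ` {0..<1} = unit_circle"
proof (intro subset_antisym subsetI)
  fix w assume "w \<in> unit_circle"
  then have "cmod w = 1" by simp
  then obtain t where t: "0 \<le> t" "t < 2 * pi" "w = Complex (cos t) (sin t)"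
    using complex_unimodular_polar by blast
  then have "w = circle_param (t / (2 * pi))" by (simp add: circle_param_def cis.code)
  moreover have "t / (2 * pi) \<in> {0..<1}" using t by (simp add: field_simps)
  ultimately show "w \<in> circle_param ` {0..<1}" by blast
qed (auto simp: circle_param_def)

definition std_arc :: "nat \<Rightarrow> nat \<Rightarrow> complex set" where
  "std_arc k i = circle_param ` {real i / 2 ^ k..<real (Suc i) / 2 ^ k}"

definition std_level :: "nat \<Rightarrow> complex set set" where
  "std_level k = std_arc k ` {..<2 ^ k}"

lemma std_interval:
  assumes "i < 2 ^ k"
  shows "{real i / 2 ^ k..<real (Suc i) / 2 ^ k} \<subseteq> {0..<1}" "real (Suc i) / 2 ^ k \<le> 1"
proof -
  have "Suc i \<le> 2 ^ k" using assms by simp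
  then have "real (Suc i) \<le> real (2 ^ k)" by (simp only: of_nat_le_iff)
  then have "real (Suc i) \<le> 2 ^ k" by simp
  then show le: "real (Suc i) / 2 ^ k \<le> 1" by (simp add: divide_le_eq)
  show "{real i / 2 ^ k..<real (Suc i) / 2 ^ k} \<subseteq> {0..<1}"
  proof
    fix t assume t: "t \<in> {real i / 2 ^ k..<real (Suc i) / 2 ^ k}"
    have "0 \<le> real i / 2 ^ k" by simp
    then show "t \<in> {0..<1}" using t le unfolding atLeastLessThan_iff by linarith
  qed
qed

lemma image_scale_ivl:
  fixes c :: real assumes "0 < c" shows "(\<lambda>t. c * t) ` {a..<b} = {c * a..<c * b}"
proof (intro subset_antisym subsetI)
  fix x assume "x \<in> {c * a..<c * b}"
  then have "x / c \<in> {a..<b}" "x = c * (x / c)" using assms by (auto simp: field_simps)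
  then show "x \<in> (\<lambda>t. c * t) ` {a..<b}" by blast
qed (use assms in auto)

lemma half_open_std_arc: "half_open_arc (std_arc k i)"
proof -
  let ?a = "real i / 2 ^ k" and ?b = "real (Suc i) / 2 ^ k"
  have "{2 * pi * ?a..<2 * pi * ?b} = (\<lambda>t. 2 * pi * t) ` {?a..<?b}"
    by (rule image_scale_ivl[symmetric]) simp
  then have "std_arc k i = cis ` {2 * pi * ?a..<2 * pi * ?b}"
    by (simp only: std_arc_def image_image circle_param_def[abs_def])
  moreover have "2 * pi * ?a < 2 * pi * ?b" by (simp add: divide_strict_right_mono)
  moreover have "2 * pi * ?b \<le> 2 * pi * ?a + 2 * pi"
  proof -
    have "?b = ?a + 1 / 2 ^ k" by (simp add: add_divide_distrib)
    moreover have "1 / 2 ^ k \<le> (1::real)" by (simp add: divide_le_eq)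
    ultimately have "?b \<le> ?a + 1" by simp
    then have "2 * pi * ?b \<le> 2 * pi * (?a + 1)" by (intro mult_left_mono) auto
    then show ?thesis by (simp only: distrib_left mult_1_right)
  qed
  ultimately show ?thesis unfolding half_open_arc_def by blast
qed

lemma arc_length_std_arc:
  assumes "i < 2 ^ k" shows "arc_length (std_arc k i) = 1 / 2 ^ k"
proof -
  let ?S = "{real i / 2 ^ k..<real (Suc i) / 2 ^ k}"
  have "{t \<in> {0..<1}. cis (2 * pi * t) \<in> std_arc k i} = ?S"
    using std_interval(1)[OF assms] inj_on_image_mem_iff[OF inj_on_circle_param _ std_interval(1)[OF assms]]
    unfolding std_arc_def circle_param_def[symmetric] by blast
  then have "arc_length (std_arc k i) = measure lborel ?S" by (simp only: arc_length_def)
  also have "\<dots> = real (Suc i) / 2 ^ k - real i / 2 ^ k"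
    by (rule measure_lborel_Ico) (simp add: divide_right_mono)
  also have "\<dots> = 1 / 2 ^ k" by (simp add: add_divide_distrib)
  finally show ?thesis .
qed

lemma std_arc_disjoint:
  assumes "i < 2 ^ k" "j < 2 ^ k" "i \<noteq> j" shows "std_arc k i \<inter> std_arc k j = {}"
proof -
  let ?S = "\<lambda>i. {real i / 2 ^ k..<real (Suc i) / 2 ^ k}"
  have "?S i \<inter> ?S j = {}" if "i < j" for i j
  proof -
    have "real (Suc i) / 2 ^ k \<le> real j / 2 ^ k" using that by (intro divide_right_mono) auto
    then show ?thesis by auto
  qed
  then have "?S i \<inter> ?S j = {}" using assms(3) by (metis Int_commute linorder_neqE_nat)
  moreover have "circle_param ` ?S i \<inter> circle_param ` ?S j = circle_param ` (?S i \<inter> ?S j)"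
    by (rule inj_on_image_Int[OF inj_on_circle_param std_interval(1)[OF assms(1)] std_interval(1)[OF assms(2)], symmetric])
  ultimately show ?thesis by (simp only: std_arc_def image_empty)
qed

lemma std_arc_nonempty: "std_arc k i \<noteq> {}"
  by (rule half_open_arc_nonempty[OF half_open_std_arc])

lemma inj_std_arc: "inj_on (std_arc k) {..<2 ^ k}"
proof (rule inj_onI)
  fix i j :: nat assume "i \<in> {..<2 ^ k}" "j \<in> {..<2 ^ k}" "std_arc k i = std_arc k j"
  then show "i = j" using std_arc_disjoint[of i k j] std_arc_nonempty[of k j] by auto
qed

lemma partition_std_level: "partition_on unit_circle (std_level k)"
proof (rule partition_onI)
  show "\<Union>(std_level k) = unit_circle"
  proof (intro subset_antisym subsetI)
    fix w assume "w \<in> \<Union>(std_level k)"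
    then obtain i where "w \<in> std_arc k i" unfolding std_level_def by blast
    then show "w \<in> unit_circle" using half_open_arc_subset[OF half_open_std_arc] by blast
  next
    fix w assume "w \<in> unit_circle"
    then obtain t where t: "t \<in> {0..<1}" "w = circle_param t" using range_circle_param by blast
    define i where "i = nat \<lfloor>2 ^ k * t\<rfloor>"
    have fl: "real i = of_int \<lfloor>2 ^ k * t\<rfloor>" using t by (simp add: i_def)
    have "real i \<le> 2 ^ k * t" "2 ^ k * t < real i + 1" unfolding fl by linarith+
    then have ti: "t \<in> {real i / 2 ^ k..<real (Suc i) / 2 ^ k}" by (simp add: field_simps)
    have "real i < 2 ^ k"
    proof -
      have "2 ^ k * t < 2 ^ k * 1" using t by (intro mult_strict_left_mono) auto
      then show ?thesis using \<open>real i \<le> 2 ^ k * t\<close> by linarith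
    qed
    then have "real i < real (2 ^ k)" by simp
    then have "i < 2 ^ k" by (simp only: of_nat_less_iff)
    then show "w \<in> \<Union>(std_level k)" using ti t(2) unfolding std_level_def std_arc_def by blast
  qed
next
  fix I J assume "I \<in> std_level k" "J \<in> std_level k" "I \<noteq> J"
  then show "disjnt I J" unfolding std_level_def disjnt_def using std_arc_disjoint by auto
next
  show "{} \<notin> std_level k" unfolding std_level_def using std_arc_nonempty by auto
qed

lemma std_level_parent:
  assumes "I \<in> std_level (Suc k)" shows "\<exists>J\<in>std_level k. I \<subseteq> J"
proof -
  obtain i where i: "i < 2 ^ Suc k" "I = std_arc (Suc k) i" using assms by (auto simp: std_level_def)
  define j where "j = i div 2"
  have j: "j < 2 ^ k" using i(1) by (auto simp: j_def)
  have ij: "2 * j \<le> i" "Suc i \<le> 2 * Suc j" by (auto simp: j_def)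
  have "real (2 * j) / 2 ^ Suc k \<le> real i / 2 ^ Suc k" using ij(1) by (intro divide_right_mono) (simp_all only: of_nat_le_iff, simp)
  moreover have "real (Suc i) / 2 ^ Suc k \<le> real (2 * Suc j) / 2 ^ Suc k" using ij(2) by (intro divide_right_mono) (simp_all only: of_nat_le_iff, simp)
  moreover have "real (2 * m) / 2 ^ Suc k = real m / 2 ^ k" for m by simp
  ultimately have "{real i / 2 ^ Suc k..<real (Suc i) / 2 ^ Suc k} \<subseteq> {real j / 2 ^ k..<real (Suc j) / 2 ^ k}"
    by (intro ivl_subset[THEN iffD2] disjI2 conjI) (simp_all only:)
  then have "I \<subseteq> std_arc k j" unfolding i(2) std_arc_def by (rule image_mono)
  then show ?thesis using j by (auto simp: std_level_def)
qed

lemma dyadic_system_exists: "\<exists>\<D>. dyadic_system \<D>"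
proof (intro exI)
  show "dyadic_system (\<Union>k. std_level k)"
    unfolding dyadic_system_def
  proof (intro exI[of _ std_level] conjI allI ballI)
    show "std_level 0 = {unit_circle}"
      using range_circle_param by (simp add: std_level_def std_arc_def lessThan_Suc)
    show "card (std_level k) = 2 ^ k" for k unfolding std_level_def by (simp add: card_image[OF inj_std_arc])
  next
    fix k I assume I: "I \<in> std_level k"
    then show "half_open_arc I" by (auto simp: std_level_def half_open_std_arc)
    show "arc_length I = 1 / 2 ^ k" using I by (auto simp: std_level_def arc_length_std_arc)
  qed (rule refl partition_std_level std_level_parent | assumption)+
qed

section \<open>Boundedness and comparison of the norms\<close>

text \<open>Point evaluations are continuous, so that the term \<open>|f(\<phi>(0))|\<close> in the norm is harmless.\<close>

lemma Qp_growth: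
  assumes p: "0 < p" "p \<le> 1" and w: "cmod w < 1"
  shows "\<exists>C\<ge>0. \<forall>f\<in>Qp p. ennreal (cmod (f w - f 0)) \<le> ennreal C * Qp_seminorm p f"
proof -
  define r where "r = (1 - cmod w) / 2"
  have "0 < r" unfolding r_def using w by simp
  moreover have "r \<le> 1" by (rule order_trans[of _ "1 / 2"]) (simp_all add: r_def)
  ultimately have r: "0 < r" "r \<le> 1" by auto
  define C where "C = sqrt (2 / r ^ 3)"
  have C0: "0 \<le> C" using r by (simp add: C_def)
  show ?thesis
  proof (intro exI[of _ C] conjI C0 ballI)
    fix f assume f: "f \<in> Qp p"
    then have hol: "f holomorphic_on unit_disc" by (simp add: Qp_def)
    obtain s where s: "0 \<le> s" "Qp_seminorm p f = ennreal s"
      using f by (cases "Qp_seminorm p f") (auto simp: Qp_def)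
    define d where "d z = ennreal (indicator unit_disc z * (cmod (deriv f z))\<^sup>2)" for z
    have [measurable]: "d \<in> borel_measurable borel" unfolding d_def using measurable_deriv_sq[OF hol] by simp
    have bound: "cmod (deriv f z) \<le> C * s" if z: "z \<in> cball 0 (cmod w)" for z
    proof -
      have sub: "v \<in> unit_disc \<and> r \<le> 1 - cmod v" if "v \<in> ball z r" for v
      proof -
        have "cmod (v - z) < r" using that by (simp add: dist_norm norm_minus_commute)
        moreover have "cmod v \<le> cmod z + cmod (v - z)" using norm_triangle_ineq[of z "v - z"] by simp
        ultimately have "cmod v \<le> 1 - r" using z by (simp add: r_def field_simps)
        then show ?thesis using r by simp
      qed
      have g: "ennreal (r / 2) \<le> enn_powr (green v 0) p" if "v \<in> ball z r" for v
      proof -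
        have v: "cmod v < 1" "r \<le> 1 - cmod v" using sub[OF that] by auto
        have "ennreal (r / 2) \<le> ennreal ((1 - cmod v) / 2)" using v(2) by (intro ennreal_leI) simp
        also have "\<dots> \<le> green v 0" using green_ge[of 0 v] v(1) by simp
        finally have "enn_powr (ennreal (r / 2)) p \<le> enn_powr (green v 0) p" using p by (intro enn_powr_mono) auto
        moreover have "r / 2 \<le> (r / 2) powr p" using powr_mono'[of p 1 "r / 2"] p r by simp
        ultimately show ?thesis using r by (simp add: order_trans[OF ennreal_leI])
      qed
      have [measurable]: "ball z r \<in> sets borel" by simp
      have "deriv f holomorphic_on ball z r"
        using sub by (intro holomorphic_on_subset[OF holomorphic_deriv[OF hol open_ball]]) blast
      then have "ennreal (pi * r\<^sup>2 * (cmod (deriv f z))\<^sup>2) \<le> (\<integral>\<^sup>+v\<in>ball z r. ennreal ((cmod (deriv f v))\<^sup>2) \<partial>lborel)"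
        by (rule disc_sub_mean_sq[OF _ r(1)])
      then have "ennreal (r / 2) * ennreal (pi * r\<^sup>2 * (cmod (deriv f z))\<^sup>2)
          \<le> ennreal (r / 2) * (\<integral>\<^sup>+v\<in>ball z r. ennreal ((cmod (deriv f v))\<^sup>2) \<partial>lborel)"
        by (rule mult_left_mono) simp
      also have "(\<integral>\<^sup>+v\<in>ball z r. ennreal ((cmod (deriv f v))\<^sup>2) \<partial>lborel) = (\<integral>\<^sup>+v. d v * indicator (ball z r) v \<partial>lborel)"
        using sub by (intro nn_integral_cong) (auto simp: indicator_def d_def)
      also have "ennreal (r / 2) * \<dots> = (\<integral>\<^sup>+v. ennreal (r / 2) * (d v * indicator (ball z r) v) \<partial>lborel)"
        by (rule nn_integral_cmult[symmetric]) measurable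
      also have "\<dots> \<le> (\<integral>\<^sup>+v. d v * enn_powr (green v 0) p \<partial>lborel)"
      proof (rule nn_integral_mono)
        fix v
        show "ennreal (r / 2) * (d v * indicator (ball z r) v) \<le> d v * enn_powr (green v 0) p"
        proof (cases "v \<in> ball z r")
          case True
          have "d v * ennreal (r / 2) \<le> d v * enn_powr (green v 0) p" by (intro mult_left_mono g True) simp
          then show ?thesis using True by (simp add: mult.commute)
        qed simp
      qed
      also have "\<dots> = ennreal pi * energy p f 0"
      proof -
        have "ennreal pi * ennreal (1 / pi) = 1" by (subst ennreal_mult[symmetric]) auto
        then show ?thesis unfolding energy_lborel[OF hol] mult.assoc[symmetric] d_def by simp
      qed
      also have "\<dots> \<le> ennreal pi * ennreal (s\<^sup>2)"
        using energy_le_seminorm[of 0 p f] s by (intro mult_left_mono) (auto simp: ennreal_power)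
      finally have "ennreal (r / 2) * ennreal (pi * r\<^sup>2 * (cmod (deriv f z))\<^sup>2) \<le> ennreal pi * ennreal (s\<^sup>2)" .
      moreover have "ennreal (r / 2 * (pi * r\<^sup>2 * (cmod (deriv f z))\<^sup>2)) = ennreal (r / 2) * ennreal (pi * r\<^sup>2 * (cmod (deriv f z))\<^sup>2)"
        using r by (intro ennreal_mult) auto
      moreover have "ennreal (pi * s\<^sup>2) = ennreal pi * ennreal (s\<^sup>2)" by (intro ennreal_mult) auto
      ultimately have "ennreal (r / 2 * (pi * r\<^sup>2 * (cmod (deriv f z))\<^sup>2)) \<le> ennreal (pi * s\<^sup>2)"
        by (simp only:)
      then have "r / 2 * (pi * r\<^sup>2 * (cmod (deriv f z))\<^sup>2) \<le> pi * s\<^sup>2"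
        by (subst (asm) ennreal_le_iff) auto
      then have "pi * (r ^ 3 / 2 * (cmod (deriv f z))\<^sup>2) \<le> pi * s\<^sup>2"
        by (simp add: power2_eq_square power3_eq_cube mult_ac)
      then have "r ^ 3 / 2 * (cmod (deriv f z))\<^sup>2 \<le> s\<^sup>2" by (rule mult_left_le_imp_le) simp
      then have "(cmod (deriv f z))\<^sup>2 \<le> 2 / r ^ 3 * s\<^sup>2" using r by (simp add: field_simps)
      also have "\<dots> = (C * s)\<^sup>2" using r by (simp add: C_def power_mult_distrib)
      finally show ?thesis by (rule power2_le_imp_le) (use C0 s in auto)
    qed
    have "cmod (f w - f 0) \<le> C * s * cmod (w - 0)"
    proof (rule field_differentiable_bound[of "cball 0 (cmod w)" f "deriv f"])
      fix z :: complex assume z: "z \<in> cball 0 (cmod w)"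
      then have "z \<in> unit_disc" using w by simp
      then show "(f has_field_derivative deriv f z) (at z within cball 0 (cmod w))"
        by (rule has_field_derivative_at_within[OF holomorphic_derivI[OF hol open_ball]])
      show "cmod (deriv f z) \<le> C * s" by (rule bound[OF z])
    qed auto
    also have "\<dots> \<le> C * s * 1" using w C0 s by (intro mult_left_mono) auto
    finally have "ennreal (cmod (f w - f 0)) \<le> ennreal (C * s)" by (simp add: ennreal_leI)
    then show "ennreal (cmod (f w - f 0)) \<le> ennreal C * Qp_seminorm p f"
      using C0 s by (simp add: ennreal_mult)
  qed
qed

lemma Qp_comp_holomorphic:
  assumes "f \<in> Qp p" "\<phi> holomorphic_on unit_disc" "\<phi> ` unit_disc \<subseteq> unit_disc"
  shows "f \<circ> \<phi> holomorphic_on unit_disc"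
  using assms by (intro holomorphic_on_compose_gen[of \<phi> unit_disc f unit_disc]) (auto simp: Qp_def)

text \<open>Functions of seminorm zero need the argument that all their multiples lie in the unit ball.\<close>

lemma opnorm_bound:
  assumes \<phi>: "\<phi> holomorphic_on unit_disc" "\<phi> ` unit_disc \<subseteq> unit_disc"
    and A: "comp_seminorm_opnorm p \<phi> = ennreal A" "0 \<le> A" and f: "f \<in> Qp p"
  shows "Qp_seminorm p (f \<circ> \<phi>) \<le> ennreal A * Qp_seminorm p f"
proof -
  have hol: "f holomorphic_on unit_disc" using f by (simp add: Qp_def)
  have hc: "f \<circ> \<phi> holomorphic_on unit_disc" by (rule Qp_comp_holomorphic[OF f \<phi>])
  obtain s where s: "0 \<le> s" "Qp_seminorm p f = ennreal s"
    using f by (cases "Qp_seminorm p f") (auto simp: Qp_def)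
  have scale: "ennreal t * Qp_seminorm p (f \<circ> \<phi>) \<le> ennreal A" if t: "0 \<le> t" "t * s \<le> 1" for t
  proof -
    let ?h = "\<lambda>z. of_real t * f z"
    have "Qp_seminorm p ?h = ennreal (t * s)"
      using Qp_seminorm_cmult[OF hol, of p "of_real t"] t s by (simp add: ennreal_mult)
    moreover have "ennreal (t * s) \<le> 1" using t(2) by (simp add: ennreal_le_1)
    moreover have "?h holomorphic_on unit_disc" using hol by (intro holomorphic_intros)
    ultimately have "?h \<in> {f \<in> Qp p. Qp_seminorm p f \<le> 1}" by (simp add: Qp_def)
    then have "Qp_seminorm p (?h \<circ> \<phi>) \<le> comp_seminorm_opnorm p \<phi>"
      unfolding comp_seminorm_opnorm_def by (rule SUP_upper)
    moreover have "?h \<circ> \<phi> = (\<lambda>z. of_real t * (f \<circ> \<phi>) z)" by auto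
    ultimately show ?thesis using Qp_seminorm_cmult[OF hc, of p "of_real t"] t A(1) by simp
  qed
  show ?thesis
  proof (cases "s = 0")
    case False
    then have sp: "0 < s" using s by simp
    have "ennreal s * (ennreal (1 / s) * Qp_seminorm p (f \<circ> \<phi>)) \<le> ennreal s * ennreal A"
      using sp by (intro mult_left_mono scale) auto
    moreover have "ennreal s * (ennreal (1 / s) * Qp_seminorm p (f \<circ> \<phi>)) = Qp_seminorm p (f \<circ> \<phi>)"
    proof -
      have "ennreal s * ennreal (1 / s) = 1" using sp by (subst ennreal_mult[symmetric]) auto
      then show ?thesis by (simp flip: mult.assoc)
    qed
    ultimately show ?thesis by (simp add: s(2) mult.commute)
  next
    case True
    have "Qp_seminorm p (f \<circ> \<phi>) = 0"
    proof (rule ccontr)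
      assume n0: "Qp_seminorm p (f \<circ> \<phi>) \<noteq> 0"
      show False
      proof (cases "Qp_seminorm p (f \<circ> \<phi>)")
        case (real q)
        then have q: "0 < q" using n0 by (simp add: less_le)
        have "ennreal ((A + 1) / q) * ennreal q \<le> ennreal A" using scale[of "(A + 1) / q"] q A(2) True real by simp
        then have "ennreal (A + 1) \<le> ennreal A" using q A(2) by (simp flip: ennreal_mult)
        then show False using A(2) by (simp add: ennreal_le_iff)
      next
        case top
        then show False using scale[of 1] True by (simp add: top_unique)
      qed
    qed
    then show ?thesis by simp
  qed
qed

theorem comp_bounded_iff:
  assumes p: "0 < p" "p \<le> 1" and \<phi>: "\<phi> holomorphic_on unit_disc" "\<phi> ` unit_disc \<subseteq> unit_disc"
  shows "comp_bounded_on_Qp p \<phi> \<longleftrightarrow> comp_seminorm_opnorm p \<phi> < top"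
proof
  assume "comp_bounded_on_Qp p \<phi>"
  then obtain M where M: "\<And>f. f \<in> Qp p \<Longrightarrow> Qp_norm p (f \<circ> \<phi>) \<le> ennreal M * Qp_norm p f"
    unfolding comp_bounded_on_Qp_def by blast
  have "comp_seminorm_opnorm p \<phi> \<le> ennreal M"
    unfolding comp_seminorm_opnorm_def
  proof (rule SUP_least)
    fix f assume "f \<in> {f \<in> Qp p. Qp_seminorm p f \<le> 1}"
    then have f: "f \<in> Qp p" "Qp_seminorm p f \<le> 1" by auto
    let ?h = "\<lambda>z. f z - f 0"
    have hol: "f holomorphic_on unit_disc" using f by (simp add: Qp_def)
    have h: "Qp_seminorm p ?h = Qp_seminorm p f" by (rule Qp_seminorm_diff_const[OF hol])
    have "?h \<in> Qp p" using f(1) h by (auto simp: Qp_def intro!: holomorphic_intros)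
    have "Qp_seminorm p (f \<circ> \<phi>) = Qp_seminorm p (?h \<circ> \<phi>)"
      using Qp_seminorm_diff_const[OF Qp_comp_holomorphic[OF f(1) \<phi>], of p "f 0"] by (simp add: o_def)
    also have "\<dots> \<le> Qp_norm p (?h \<circ> \<phi>)" by (simp add: Qp_norm_def)
    also have "\<dots> \<le> ennreal M * Qp_norm p ?h" by (rule M[OF \<open>?h \<in> Qp p\<close>])
    also have "\<dots> \<le> ennreal M * 1" using f(2) h by (intro mult_left_mono) (auto simp: Qp_norm_def)
    finally show "Qp_seminorm p (f \<circ> \<phi>) \<le> ennreal M" by simp
  qed
  then show "comp_seminorm_opnorm p \<phi> < top" by (simp add: le_less_trans)
next
  assume "comp_seminorm_opnorm p \<phi> < top"
  then obtain A where A: "comp_seminorm_opnorm p \<phi> = ennreal A" "0 \<le> A"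
    by (cases "comp_seminorm_opnorm p \<phi>") auto
  have "\<phi> 0 \<in> \<phi> ` unit_disc" by (rule imageI) simp
  from subsetD[OF \<phi>(2) this] have "cmod (\<phi> 0) < 1" by simp
  from Qp_growth[OF p this] obtain C where C: "0 \<le> C"
    "\<forall>f\<in>Qp p. ennreal (cmod (f (\<phi> 0) - f 0)) \<le> ennreal C * Qp_seminorm p f" by (elim exE conjE)
  show "comp_bounded_on_Qp p \<phi>"
    unfolding comp_bounded_on_Qp_def
  proof (intro conjI ballI exI[of _ "1 + C + A"])
    fix f assume f: "f \<in> Qp p"
    have S: "Qp_seminorm p (f \<circ> \<phi>) \<le> ennreal A * Qp_seminorm p f" by (rule opnorm_bound[OF \<phi> A f])
    also have "\<dots> < top" using f by (auto simp: Qp_def ennreal_mult_less_top)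
    finally show "f \<circ> \<phi> \<in> Qp p" using Qp_comp_holomorphic[OF f \<phi>] by (simp add: Qp_def)
    have "ennreal (cmod (f (\<phi> 0))) \<le> ennreal (cmod (f 0) + cmod (f (\<phi> 0) - f 0))"
      using norm_triangle_ineq[of "f 0" "f (\<phi> 0) - f 0"] by (intro ennreal_leI) simp
    also have "\<dots> \<le> ennreal (cmod (f 0)) + ennreal C * Qp_seminorm p f"
      using C(2) f by (simp add: ennreal_plus)
    finally have "Qp_norm p (f \<circ> \<phi>) \<le> ennreal (cmod (f 0)) + ennreal C * Qp_seminorm p f + ennreal A * Qp_seminorm p f"
      unfolding Qp_norm_def using S by (simp add: add_mono)
    also have "\<dots> \<le> (1 + ennreal C + ennreal A) * ennreal (cmod (f 0)) + (1 + ennreal C + ennreal A) * Qp_seminorm p f"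
    proof -
      have "ennreal (cmod (f 0)) \<le> (1 + ennreal C + ennreal A) * ennreal (cmod (f 0))"
        using mult_right_mono[of 1 "1 + ennreal C + ennreal A" "ennreal (cmod (f 0))"] by (simp add: add.assoc)
      moreover have "ennreal C * Qp_seminorm p f + ennreal A * Qp_seminorm p f \<le> (1 + ennreal C + ennreal A) * Qp_seminorm p f"
        by (simp add: distrib_right add.assoc)
      ultimately show ?thesis by (simp add: add.assoc add_mono)
    qed
    also have "\<dots> = ennreal (1 + C + A) * Qp_norm p f"
      using C(1) A(2) by (simp add: Qp_norm_def distrib_left ennreal_plus)
    finally show "Qp_norm p (f \<circ> \<phi>) \<le> ennreal (1 + C + A) * Qp_norm p f" .
  qed
qed

lemma ennreal_divide_left_le:
  assumes "0 < c" "x \<le> ennreal c * y" shows "ennreal (1 / c) * x \<le> y"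
proof -
  have "ennreal (1 / c) * x \<le> ennreal (1 / c) * (ennreal c * y)" using assms(2) by (rule mult_left_mono) simp
  also have "\<dots> = (ennreal (1 / c) * ennreal c) * y" by (simp only: mult.assoc)
  also have "ennreal (1 / c) * ennreal c = 1" using assms(1) by (subst ennreal_mult[symmetric]) auto
  finally show ?thesis by simp
qed

text \<open>Each one-sided bound holds for every dyadic system with the same constant, so that it passes to the
  supremum and to the infimum; the existence of a system is what puts the infimum below the supremum.\<close>

theorem theorem1p2:
  fixes p :: real
  assumes "0 < p" and "p \<le> 1"
  shows "(\<forall>\<phi>. \<phi> holomorphic_on unit_disc \<and> \<phi> ` unit_disc \<subseteq> unit_disc \<longrightarrow>
             (comp_bounded_on_Qp p \<phi> \<longleftrightarrow> (\<exists>\<D>. dyadic_system \<D> \<and> sup_gauge p \<phi> \<D> < \<infinity>))) \<and>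
         (\<exists>C\<ge>1. \<forall>\<phi>. \<phi> holomorphic_on unit_disc \<and> \<phi> ` unit_disc \<subseteq> unit_disc \<longrightarrow>
             comparable C ((comp_seminorm_opnorm p \<phi>)\<^sup>2) (SUP \<D>\<in>{\<D>. dyadic_system \<D>}. sup_gauge p \<phi> \<D>) \<and>
             comparable C (SUP \<D>\<in>{\<D>. dyadic_system \<D>}. sup_gauge p \<phi> \<D>)
                          (INF \<D>\<in>{\<D>. dyadic_system \<D>}. sup_gauge p \<phi> \<D>))"
proof -
  let ?L = "lower_const p" and ?U = "upper_const"
  obtain \<D>0 where \<D>0: "dyadic_system \<D>0" using dyadic_system_exists by blast
  have L: "0 < ?L" using test_const_nonneg[OF assms(1)] by (simp add: lower_const_def)
  have U: "0 < ?U" using overlap_const_pos by (simp add: upper_const_def)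
  define C where "C = 1 + ?L + ?U + ?L * ?U"
  have C: "1 \<le> C" "?L \<le> C" "?U \<le> C" "?L * ?U \<le> C" "0 < C"
    using L U mult_pos_pos[OF L U] unfolding C_def by linarith+
  have lower: "sup_gauge p \<phi> \<D> \<le> ennreal ?L * (comp_seminorm_opnorm p \<phi>)\<^sup>2"
    and upper: "(comp_seminorm_opnorm p \<phi>)\<^sup>2 \<le> ennreal ?U * sup_gauge p \<phi> \<D>"
    if \<phi>: "\<phi> holomorphic_on unit_disc" "\<phi> ` unit_disc \<subseteq> unit_disc" and D: "dyadic_system \<D>" for \<phi> \<D>
  proof -
    obtain level where t: "dyadic_tree level" and eq: "\<D> = dyadic_tree.arcs level" using dyadic_system_tree[OF D] by blast
    show "sup_gauge p \<phi> \<D> \<le> ennreal ?L * (comp_seminorm_opnorm p \<phi>)\<^sup>2"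
      unfolding eq by (rule dyadic_tree.sup_gauge_le_opnorm[OF t assms \<phi>])
    show "(comp_seminorm_opnorm p \<phi>)\<^sup>2 \<le> ennreal ?U * sup_gauge p \<phi> \<D>"
      unfolding eq by (rule dyadic_tree.opnorm_le_sup_gauge[OF t assms \<phi>])
  qed
  show ?thesis
  proof (intro conjI allI impI exI[of _ C] C(1); elim conjE)
    fix \<phi> assume \<phi>: "\<phi> holomorphic_on unit_disc" "\<phi> ` unit_disc \<subseteq> unit_disc"
    have fin: "comp_seminorm_opnorm p \<phi> < top \<longleftrightarrow> (comp_seminorm_opnorm p \<phi>)\<^sup>2 < top"
      by (cases "comp_seminorm_opnorm p \<phi>") (auto simp: ennreal_power power2_eq_square ennreal_mult_less_top)
    show "comp_bounded_on_Qp p \<phi> \<longleftrightarrow> (\<exists>\<D>. dyadic_system \<D> \<and> sup_gauge p \<phi> \<D> < \<infinity>)"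
      unfolding comp_bounded_iff[OF assms \<phi>] fin
    proof
      assume *: "(comp_seminorm_opnorm p \<phi>)\<^sup>2 < top"
      have "sup_gauge p \<phi> \<D>0 \<le> ennreal ?L * (comp_seminorm_opnorm p \<phi>)\<^sup>2" by (rule lower[OF \<phi> \<D>0])
      also have "\<dots> < \<infinity>" using * by (simp add: ennreal_mult_less_top)
      finally show "\<exists>\<D>. dyadic_system \<D> \<and> sup_gauge p \<phi> \<D> < \<infinity>" using \<D>0 by blast
    next
      assume "\<exists>\<D>. dyadic_system \<D> \<and> sup_gauge p \<phi> \<D> < \<infinity>"
      then obtain \<D> where D: "dyadic_system \<D>" "sup_gauge p \<phi> \<D> < \<infinity>" by blast
      have "(comp_seminorm_opnorm p \<phi>)\<^sup>2 \<le> ennreal ?U * sup_gauge p \<phi> \<D>" by (rule upper[OF \<phi> D(1)])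
      also have "\<dots> < top" using D(2) by (simp add: ennreal_mult_less_top)
      finally show "(comp_seminorm_opnorm p \<phi>)\<^sup>2 < top" .
    qed
  next
    fix \<phi> assume \<phi>: "\<phi> holomorphic_on unit_disc" "\<phi> ` unit_disc \<subseteq> unit_disc"
    let ?A = "(comp_seminorm_opnorm p \<phi>)\<^sup>2"
    let ?S = "SUP \<D>\<in>{\<D>. dyadic_system \<D>}. sup_gauge p \<phi> \<D>"
    let ?I = "INF \<D>\<in>{\<D>. dyadic_system \<D>}. sup_gauge p \<phi> \<D>"
    have mono: "ennreal a * x \<le> ennreal C * x" if "a \<le> C" for a x
      using that by (intro mult_right_mono ennreal_leI) auto
    have SL: "?S \<le> ennreal ?L * ?A" using lower[OF \<phi>] by (intro SUP_least) auto
    have IA: "ennreal (1 / ?U) * ?A \<le> ?I"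
      using upper[OF \<phi>] U by (intro INF_greatest ennreal_divide_left_le) auto
    have IS: "?I \<le> ?S" using \<D>0 by (intro INF_lower2[of \<D>0] SUP_upper) auto
    have D0S: "sup_gauge p \<phi> \<D>0 \<le> ?S" using \<D>0 by (intro SUP_upper) auto
    show "comparable C ?A ?S"
      unfolding comparable_def
    proof
      show "ennreal (1 / C) * ?S \<le> ?A"
        using order_trans[OF SL mono[OF C(2)]] by (rule ennreal_divide_left_le[OF C(5)])
      have "?A \<le> ennreal ?U * sup_gauge p \<phi> \<D>0" by (rule upper[OF \<phi> \<D>0])
      also have "\<dots> \<le> ennreal ?U * ?S" using D0S by (rule mult_left_mono) simp
      finally show "?A \<le> ennreal C * ?S" using mono[OF C(3)] by (rule order_trans)
    qed
    show "comparable C ?S ?I"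
      unfolding comparable_def
    proof
      have "?I \<le> ennreal 1 * ?S" using IS by simp
      then have "?I \<le> ennreal C * ?S" using mono[OF C(1)] by (rule order_trans)
      then show "ennreal (1 / C) * ?I \<le> ?S" by (rule ennreal_divide_left_le[OF C(5)])
      have "?S \<le> ennreal ?L * (ennreal ?U * (ennreal (1 / ?U) * ?A))"
      proof -
        have "ennreal ?U * ennreal (1 / ?U) = 1" using U by (subst ennreal_mult[symmetric]) auto
        then have "ennreal ?U * (ennreal (1 / ?U) * ?A) = ?A" by (simp flip: mult.assoc)
        then show ?thesis using SL by simp
      qed
      also have "\<dots> \<le> ennreal ?L * (ennreal ?U * ?I)" by (intro mult_left_mono IA) auto
      also have "\<dots> = ennreal (?L * ?U) * ?I" using L U by (simp add: ennreal_mult mult.assoc)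
      also have "\<dots> \<le> ennreal C * ?I" by (rule mono[OF C(4)])
      finally show "?S \<le> ennreal C * ?I" .
    qed
  qed
qed

end
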